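(* Let $G$ be a finite connected simple undirected graph with $N$ vertices and normalized graph Laplacian $L$, and consider the linear-quadratic game on $G$ with parameters $T,a,q,\varepsilon,c,\sigma$ described in the context. Suppose that fictitious play starts from $F^{i,0}\equiv 0$ for every $i\in[N]$ (i.e. from the linear feedback functions $\phi^{i,0}(t,x)=-q e_i^{\top}Lx$), and that $$\max\left\{[c+T(\varepsilon-q^2)]\,\|L\|^2,\ \frac{2}{\log 2}(a+q)T\|L\|\right\}\le 1,\qquad T\le \frac{1}{100}.$$ Then the fictitious play scheme converges to a Markovian Nash equilibrium of the game. That is, for every $i\in[N]$ and $t\in[0,T]$ the limit $F^{i,\infty}_t:=\lim_{k\to\infty}F^{i,k}_t$ exists, $(F^{1,\infty},\dots,F^{N,\infty})$ solves on $[0,T]$ the coupled Riccati system (R) of the context, and hence the feedback functions $\phi^{i,k}(t,x)=-e_i^{\top}(F^{i,k}_t+qL)x$ converge pointwise as $k\to\infty$ to $\hat\alpha^i(t,x)=-q e_i^{\top}Lx-e_i^{\top}F^{i,\infty}_t x$, where $(\hat\alpha^1,\dots,\hat\alpha^N)$ is a Markovian Nash equilibrium.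
   Context: Notation: $[N]=\{1,\dots,N\}$; $\mathbb{S}^{N\times N}$ is the set of real symmetric $N\times N$ matrices; $\|\cdot\|$ is the matrix 2-norm; $e_1,\dots,e_N$ is the standard basis of $\mathbb{R}^N$; $\log$ is the natural logarithm; $\mathbb{N}$ includes $0$. Graph: $G=(V,E)$, $V=\{v_1,\dots,v_N\}$, $d_v$ is the degree of $v$, $u\sim v$ means adjacency. The normalized Laplacian $L\in\mathbb{S}^{N\times N}$ is $L_{ii}=1$, $L_{ij}=-1/\sqrt{d_{v_i}d_{v_j}}$ if $i\ne j$ and $v_i\sim v_j$, $L_{ij}=0$ otherwise. Game: parameters $T>0$, $a\ge0$, $q\ge 0$, $\varepsilon\ge 0$, $c>0$, $\sigma>0$ with $q^2\le\varepsilon$. On a filtered probability space supporting independent Brownian motions $W^1,\dots,W^N$, with $(\mathcal{F}_t)$ the filtration they generate, player $i$ has real-valued state $$dX^i_t=(\alpha^i_t-a e_i^{\top}LX_t)\,dt+\sigma\,dW^i_t,\qquad X_t=[X^1_t,\dots,X^N_t]^{\top},\quad X_0=x_0\in\mathbb{R}^N,$$ and chooses $\alpha^i$ in $\mathcal{A}=\{\alpha:\ \alpha \text{ progressively measurable with respect to }(\mathcal{F}_t),\ \mathbb{E}\int_0^T|\alpha_t|^2dt<\infty\}$ to minimize $$J^i(\alpha)=\mathbb{E}\left[\int_0^T \left(\tfrac12(\alpha^i_t)^2+q\alpha^i_t\, e_i^{\top}LX_t+\tfrac{\varepsilon}{2}(e_i^{\top}LX_t)^2\right)dt+\tfrac{c}{2}(e_i^{\top}LX_T)^2\right],\quad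 \alpha=(\alpha^1,\dots,\alpha^N).$$ A Markovian strategy is $\alpha^i_t=\phi^i(t,X_t)$ with $\phi^i:[0,T]\times\mathbb{R}^N\to\mathbb{R}$ Borel and $\sup_{t,x}|\phi^i(t,x)|/(1+\|x\|)<\infty$. A collection $\hat\alpha=(\hat\alpha^1,\dots,\hat\alpha^N)$ of Markovian strategies is a Markovian Nash equilibrium if $J^i((\alpha,\hat\alpha^{-i}))\ge J^i(\hat\alpha)$ for all $i\in[N]$ and $\alpha\in\mathcal{A}$, where $(\alpha,\hat\alpha^{-i})$ is obtained by replacing player $i$'s strategy by $\alpha$ while all other players keep their (feedback) strategies. Coupled Riccati system (R) for $F^i:[0,T]\to\mathbb{S}^{N\times N}$, $i\in[N]$: $$\dot F^i_t+\sum_{j=1}^N[-(a+q)L-F^j_t]e_je_j^{\top}F^i_t+\sum_{j=1}^N F^i_te_je_j^{\top}[-(a+q)L-F^j_t]+(\varepsilon-q^2)Le_ie_i^{\top}L+F^i_te_ie_i^{\top}F^i_t=0,\quad F^i_T=cLe_ie_i^{\top}L.$$ Fictitious play: at stage $k+1$ each player $i$ optimizes her own cost assuming every player $j\neq i$ uses the feedback function $\phi^{j,k}$ of stage $k$; the optimizer is $\phi^{i,k+1}$. Started from linear feedback functions $\phi^{j,0}(t,x)=-e_j^{\top}(F^{j,0}_t+qL)x$, the procedure is described by $\phi^{i,k}(t,x)=-e_i^{\top}(F^{i,k}_t+qL)x$, where, given $\{F^{j,k}\}_{j\in[N]}$, $F^{i,k+1}:[0,T]\to\mathbb{S}^{N\times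 N}$ is the solution of $$\dot F^{i,k+1}_t-F^{i,k+1}_te_ie_i^{\top}F^{i,k+1}_t+(\varepsilon-q^2)Le_ie_i^{\top}L-(a+q)LF^{i,k+1}_t-(a+q)F^{i,k+1}_tL-F^{i,k+1}_t\sum_{j\ne i}e_je_j^{\top}F^{j,k}_t-\sum_{j\neq i}F^{j,k}_te_je_j^{\top}F^{i,k+1}_t=0,$$ $F^{i,k+1}_T=cLe_ie_i^{\top}L$. *)

theory Defs
  imports "HOL-Probability.Probability"
begin

section \<open>Graphs\<close>

text \<open>The vertex set is the whole finite index type \<open>'n\<close>, so that \<open>N = CARD('n)\<close>; players are
  identified with vertices.\<close>

definition simple_graph :: "('n \<Rightarrow> 'n \<Rightarrow> bool) \<Rightarrow> bool" where
  "simple_graph E \<longleftrightarrow> symp E \<and> irreflp E"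

definition connected_graph :: "('n \<Rightarrow> 'n \<Rightarrow> bool) \<Rightarrow> bool" where
  "connected_graph E \<longleftrightarrow> (\<forall>u v. E\<^sup>*\<^sup>* u v)"

definition degree_of :: "('n::finite \<Rightarrow> 'n \<Rightarrow> bool) \<Rightarrow> 'n \<Rightarrow> nat" where
  "degree_of E v = card {u. E v u}"

definition normalized_laplacian :: "('n::finite \<Rightarrow> 'n \<Rightarrow> bool) \<Rightarrow> real^'n^'n" where
  "normalized_laplacian E =
     (\<chi> i j. if i = j then 1
            else if E i j then - 1 / sqrt (real (degree_of E i) * real (degree_of E j))
            else 0)"


section \<open>Matrices\<close>

text \<open>The norm of the type \<open>real^'n^'n\<close> is the Frobenius norm, hence the explicit operator norm.\<close>

definition matrix_norm2 :: "real^'n^'n \<Rightarrow> real" where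
  "matrix_norm2 A = onorm (\<lambda>x. A *v x)"

text \<open>\<open>unit_dyad i\<close> is \<open>e\<^sub>i e\<^sub>i\<^sup>T\<close>.\<close>

definition unit_dyad :: "'n::finite \<Rightarrow> real^'n^'n" where
  "unit_dyad i = (\<chi> r s. (axis i 1 :: real^'n) $ r * (axis i 1 :: real^'n) $ s)"


section \<open>The coupled Riccati system and fictitious play\<close>

definition riccati_system ::
  "real^'n^'n \<Rightarrow> real \<Rightarrow> real \<Rightarrow> real \<Rightarrow> real \<Rightarrow> real \<Rightarrow> ('n::finite \<Rightarrow> real \<Rightarrow> real^'n^'n) \<Rightarrow> bool" where
  "riccati_system L T a q \<epsilon> c F \<longleftrightarrow>
     (\<forall>i.
       (\<forall>t\<in>{0..T}. transpose (F i t) = F i t) \<and>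
       (\<forall>t\<in>{0..T}. \<exists>F'. (F i has_vector_derivative F') (at t within {0..T}) \<and>
          F' + (\<Sum>j\<in>UNIV. (- ((a + q) *\<^sub>R L) - F j t) ** unit_dyad j ** F i t)
             + (\<Sum>j\<in>UNIV. F i t ** unit_dyad j ** (- ((a + q) *\<^sub>R L) - F j t))
             + (\<epsilon> - q\<^sup>2) *\<^sub>R (L ** unit_dyad i ** L)
             + F i t ** unit_dyad i ** F i t = 0) \<and>
       F i T = c *\<^sub>R (L ** unit_dyad i ** L))"

text \<open>\<open>F i k\<close> is the matrix function of player \<open>i\<close> at stage \<open>k\<close>.\<close>

definition fictitious_play ::
  "real^'n^'n \<Rightarrow> real \<Rightarrow> real \<Rightarrow> real \<Rightarrow> real \<Rightarrow> real \<Rightarrow> ('n::finite \<Rightarrow> nat \<Rightarrow> real \<Rightarrow> real^'n^'n) \<Rightarrow> bool" where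
  "fictitious_play L T a q \<epsilon> c F \<longleftrightarrow>
     (\<forall>k i.
       (\<forall>t\<in>{0..T}. transpose (F i (Suc k) t) = F i (Suc k) t) \<and>
       (\<forall>t\<in>{0..T}. \<exists>F'. (F i (Suc k) has_vector_derivative F') (at t within {0..T}) \<and>
          F' - F i (Suc k) t ** unit_dyad i ** F i (Suc k) t
             + (\<epsilon> - q\<^sup>2) *\<^sub>R (L ** unit_dyad i ** L)
             - (a + q) *\<^sub>R (L ** F i (Suc k) t)
             - (a + q) *\<^sub>R (F i (Suc k) t ** L)
             - F i (Suc k) t ** (\<Sum>j\<in>UNIV - {i}. unit_dyad j ** F j k t)
             - (\<Sum>j\<in>UNIV - {i}. F j k t ** unit_dyad j ** F i (Suc k) t) = 0) \<and>
       F i (Suc k) T = c *\<^sub>R (L ** unit_dyad i ** L))"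

definition fictitious_play_from_zero ::
  "real^'n^'n \<Rightarrow> real \<Rightarrow> real \<Rightarrow> real \<Rightarrow> real \<Rightarrow> real \<Rightarrow> ('n::finite \<Rightarrow> nat \<Rightarrow> real \<Rightarrow> real^'n^'n) \<Rightarrow> bool" where
  "fictitious_play_from_zero L T a q \<epsilon> c F \<longleftrightarrow>
     (\<forall>i. \<forall>t\<in>{0..T}. F i 0 t = 0) \<and> fictitious_play L T a q \<epsilon> c F"

text \<open>The linear feedback function \<open>-e\<^sub>i\<^sup>T (F\<^sub>t + q L) x\<close>.\<close>

definition linear_feedback ::
  "real^'n^'n \<Rightarrow> real \<Rightarrow> 'n::finite \<Rightarrow> (real \<Rightarrow> real^'n^'n) \<Rightarrow> real \<Rightarrow> real^'n \<Rightarrow> real" where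
  "linear_feedback L q i F t x = - (((F t + q *\<^sub>R L) *v x) $ i)"


section \<open>Brownian motions and progressive measurability\<close>

text \<open>Only the time interval \<open>[0,T]\<close> matters; a Brownian motion on \<open>[0,\<infinity>)\<close> restricts to
  one in this sense. All paths are continuous, the start at 0 is almost sure.\<close>

definition brownian_motion_on :: "real \<Rightarrow> 'w measure \<Rightarrow> (real \<Rightarrow> 'w \<Rightarrow> real) \<Rightarrow> bool" where
  "brownian_motion_on T M B \<longleftrightarrow>
     (\<forall>t\<in>{0..T}. B t \<in> borel_measurable M) \<and>
     (AE \<omega> in M. B 0 \<omega> = 0) \<and>
     (\<forall>\<omega>\<in>space M. continuous_on {0..T} (\<lambda>t. B t \<omega>)) \<and>
     (\<forall>s t. 0 \<le> s \<longrightarrow> s < t \<longrightarrow> t \<le> T \<longrightarrow>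
        distributed M lborel (\<lambda>\<omega>. B t \<omega> - B s \<omega>) (normal_density 0 (sqrt (t - s)))) \<and>
     (\<forall>n (\<tau>::nat \<Rightarrow> real). 0 \<le> \<tau> 0 \<longrightarrow> (\<forall>k<n. \<tau> k < \<tau> (Suc k)) \<longrightarrow> \<tau> n \<le> T \<longrightarrow>
        prob_space.indep_vars M (\<lambda>_. borel) (\<lambda>k \<omega>. B (\<tau> (Suc k)) \<omega> - B (\<tau> k) \<omega>) {..<n})"

text \<open>Independence of processes is independence of the path-valued random elements with respect to
  the product \<open>\<sigma>\<close>-algebra.\<close>

definition independent_brownian_motions ::
  "real \<Rightarrow> 'w measure \<Rightarrow> ('n \<Rightarrow> real \<Rightarrow> 'w \<Rightarrow> real) \<Rightarrow> bool" where
  "independent_brownian_motions T M W \<longleftrightarrow>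
     (\<forall>i. brownian_motion_on T M (W i)) \<and>
     prob_space.indep_vars M (\<lambda>_. PiM {0..T} (\<lambda>_. borel)) (\<lambda>i \<omega>. \<lambda>t\<in>{0..T}. W i t \<omega>) UNIV"

text \<open>The filtration is not augmented by null sets.\<close>

definition generated_filtration :: "'w measure \<Rightarrow> ('n \<Rightarrow> real \<Rightarrow> 'w \<Rightarrow> real) \<Rightarrow> real \<Rightarrow> 'w measure" where
  "generated_filtration M W t =
     sigma (space M) {W i s -` A \<inter> space M | i s A. s \<in> {0..t} \<and> A \<in> sets borel}"

definition progressively_measurable ::
  "real \<Rightarrow> (real \<Rightarrow> 'w measure) \<Rightarrow> (real \<Rightarrow> 'w \<Rightarrow> 'b::topological_space) \<Rightarrow> bool" where
  "progressively_measurable T \<F> Y \<longleftrightarrow>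
     (\<forall>t\<in>{0..T}. (\<lambda>(s, \<omega>). Y s \<omega>)
        \<in> borel_measurable (restrict_space borel {0..t} \<Otimes>\<^sub>M \<F> t))"

definition admissible_controls ::
  "real \<Rightarrow> 'w measure \<Rightarrow> ('n \<Rightarrow> real \<Rightarrow> 'w \<Rightarrow> real) \<Rightarrow> (real \<Rightarrow> 'w \<Rightarrow> real) set" where
  "admissible_controls T M W =
     {\<alpha>. progressively_measurable T (generated_filtration M W) \<alpha> \<and>
         (\<integral>\<^sup>+\<omega>. (\<integral>\<^sup>+t\<in>{0..T}. ennreal ((\<alpha> t \<omega>)\<^sup>2) \<partial>lborel) \<partial>M) < \<infinity>}"


section \<open>The game\<close>

text \<open>A strategy maps time, scenario and current state to an action. This covers both feedback
  functions, which ignore the scenario, and controls in \<open>admissible_controls\<close>, which ignore the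
  state argument.\<close>

type_synonym ('w, 'n) strategy = "real \<Rightarrow> 'w \<Rightarrow> real^'n \<Rightarrow> real"

definition feedback :: "(real \<Rightarrow> real^'n \<Rightarrow> real) \<Rightarrow> ('w, 'n) strategy" where
  "feedback \<phi> = (\<lambda>t \<omega> x. \<phi> t x)"

definition open_loop :: "(real \<Rightarrow> 'w \<Rightarrow> real) \<Rightarrow> ('w, 'n) strategy" where
  "open_loop \<alpha> = (\<lambda>t \<omega> x. \<alpha> t \<omega>)"

definition markovian_strategy :: "real \<Rightarrow> (real \<Rightarrow> real^'n \<Rightarrow> real) \<Rightarrow> bool" where
  "markovian_strategy T \<phi> \<longleftrightarrow>
     (\<lambda>(t, x). \<phi> t x) \<in> borel_measurable (restrict_space borel ({0..T} \<times> UNIV)) \<and>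
     bdd_above ((\<lambda>(t, x). \<bar>\<phi> t x\<bar> / (1 + norm x)) ` ({0..T} \<times> UNIV))"

text \<open>Solutions \<open>X\<close> of the state equation when the players use the strategies \<open>\<beta>\<close>. The noise is
  additive, so the stochastic differential equation is the pathwise integral equation below.
  Here \<open>(L *v x) $ i\<close> is \<open>e\<^sub>i\<^sup>T L x\<close>.\<close>

definition state_process ::
  "real^'n^'n \<Rightarrow> real \<Rightarrow> real \<Rightarrow> real \<Rightarrow> real^'n \<Rightarrow> 'w measure \<Rightarrow> ('n::finite \<Rightarrow> real \<Rightarrow> 'w \<Rightarrow> real) \<Rightarrow>
   ('n \<Rightarrow> ('w, 'n) strategy) \<Rightarrow> (real \<Rightarrow> 'w \<Rightarrow> real^'n) \<Rightarrow> bool" where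
  "state_process L T a \<sigma> x\<^sub>0 M W \<beta> X \<longleftrightarrow>
     progressively_measurable T (generated_filtration M W) X \<and>
     (AE \<omega> in M. continuous_on {0..T} (\<lambda>t. X t \<omega>) \<and>
        (\<forall>i. set_integrable lborel {0..T} (\<lambda>s. \<beta> i s \<omega> (X s \<omega>)) \<and>
          (\<forall>t\<in>{0..T}.
             X t \<omega> $ i = x\<^sub>0 $ i
               + (LINT s:{0..t}|lborel. \<beta> i s \<omega> (X s \<omega>) - a * (L *v X s \<omega>) $ i)
               + \<sigma> * W i t \<omega>)))"

text \<open>The cost \<open>J\<^sup>i\<close> of player \<open>i\<close> under the strategies \<open>\<beta>\<close>, evaluated along a state process
  \<open>X\<close> for \<open>\<beta>\<close>. For Markovian strategies and square integrable controls all integrands are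
  integrable, by linear growth, so that the convention for divergent integrals is never used.\<close>

definition game_cost ::
  "real^'n^'n \<Rightarrow> real \<Rightarrow> real \<Rightarrow> real \<Rightarrow> real \<Rightarrow> 'w measure \<Rightarrow> 'n::finite \<Rightarrow>
   ('n \<Rightarrow> ('w, 'n) strategy) \<Rightarrow> (real \<Rightarrow> 'w \<Rightarrow> real^'n) \<Rightarrow> real" where
  "game_cost L T q \<epsilon> c M i \<beta> X =
     prob_space.expectation M (\<lambda>\<omega>.
       (LINT t:{0..T}|lborel.
          1/2 * (\<beta> i t \<omega> (X t \<omega>))\<^sup>2
          + q * \<beta> i t \<omega> (X t \<omega>) * (L *v X t \<omega>) $ i
          + \<epsilon>/2 * ((L *v X t \<omega>) $ i)\<^sup>2)
       + c/2 * ((L *v X T \<omega>) $ i)\<^sup>2)"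

text \<open>The existence of the state processes, for the profile itself and for every unilateral
  deviation, is part of the definition; otherwise the cost comparison could hold vacuously.\<close>

definition markovian_nash ::
  "real^'n^'n \<Rightarrow> real \<Rightarrow> real \<Rightarrow> real \<Rightarrow> real \<Rightarrow> real \<Rightarrow> real \<Rightarrow> real^'n \<Rightarrow> 'w measure \<Rightarrow>
   ('n::finite \<Rightarrow> real \<Rightarrow> 'w \<Rightarrow> real) \<Rightarrow> ('n \<Rightarrow> real \<Rightarrow> real^'n \<Rightarrow> real) \<Rightarrow> bool" where
  "markovian_nash L T a q \<epsilon> c \<sigma> x\<^sub>0 M W \<phi> \<longleftrightarrow>
     (let \<beta> = (\<lambda>j. feedback (\<phi> j)) in
       (\<forall>i. markovian_strategy T (\<phi> i)) \<and>
       (\<exists>X. state_process L T a \<sigma> x\<^sub>0 M W \<beta> X) \<and>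
       (\<forall>i. \<forall>\<alpha>\<in>admissible_controls T M W.
          (\<exists>Y. state_process L T a \<sigma> x\<^sub>0 M W (\<beta>(i := open_loop \<alpha>)) Y) \<and>
          (\<forall>X Y. state_process L T a \<sigma> x\<^sub>0 M W \<beta> X \<longrightarrow>
             state_process L T a \<sigma> x\<^sub>0 M W (\<beta>(i := open_loop \<alpha>)) Y \<longrightarrow>
             game_cost L T q \<epsilon> c M i (\<beta>(i := open_loop \<alpha>)) Y
               \<ge> game_cost L T q \<epsilon> c M i \<beta> X)))"

end

theory Submission
  imports Defs
begin

text \<open>The matrices of all players are treated as one family \<open>F = (F\<^sup>1, \<dots>, F\<^sup>N)\<close>. Fictitious play
  and the coupled Riccati system are then terminal value problems for one quadratic vector field
  \<open>f\<close> (\<open>best_response_field\<close>): stage \<open>k + 1\<close> solves \<open>F' = f F F\<^sub>k\<close>, where \<open>F\<^sub>k\<close> is the result of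
  stage \<open>k\<close>, and the Riccati system is \<open>G' = f G G\<close>. On a short horizon such problems are
  contractions. The difficulty is that the smallness condition does not involve \<open>N\<close>, whereas the
  closed-loop matrix \<open>\<Sum>\<^sub>j e\<^sub>j e\<^sub>j\<^sup>T F\<^sup>j\<close> takes one row from each of \<open>N\<close> matrices, so that its
  2-norm can exceed the 2-norms of the \<open>F\<^sup>j\<close> by a factor of order \<open>sqrt N\<close>. All estimates
  therefore use \<open>family_norm\<close>, the supremum of \<open>\<Sum>\<^sub>i z\<^sub>i (U e\<^sub>i) \<bullet> (F\<^sup>i y)\<close> over matrices \<open>U\<close> of
  2-norm at most one and vectors \<open>z\<close>, \<open>y\<close> in the unit ball. It dominates the 2-norm of the
  closed-loop matrix, it is submultiplicative on every product that occurs in \<open>f\<close>, and it is at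
  most \<open>\<parallel>L\<parallel>\<^sup>2\<close> on the family \<open>L e\<^sub>i e\<^sub>i\<^sup>T L\<close>; no factor depending on \<open>N\<close> enters the smallness
  condition.

  In this norm, Gronwall's inequality shows that the ball of radius 3 is invariant
  (\<open>family_norm_trapped\<close>) and that one stage multiplies the distance to \<open>G\<close>, uniformly in time,
  by at most 18/25 (\<open>best_response_contraction\<close>). Solutions in the ball are found by truncating
  the quadratic part of \<open>f\<close> (\<open>trapped_path_exists\<close>), once for each stage and once for \<open>G\<close>
  itself; uniqueness (\<open>best_response_unique\<close>) puts every given fictitious play sequence into the
  ball. The limit therefore never has to be taken inside a differential equation.

  The Nash property is proved without stochastic integrals. The noise is additive, so it cancels
  in the difference \<open>z = Y - X\<close> between the state after a deviation of player \<open>i\<close> and the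
  equilibrium state, and \<open>z\<close> is absolutely continuous in time. As \<open>q\<^sup>2 \<le> \<epsilon>\<close>, the cost is a
  convex quadratic function, hence the cost difference is at least its part that is linear in
  the deviation. Integrating by parts with \<open>\<zeta> = G\<^sup>i z\<close> and using the Riccati equation, this
  linear part equals, path by path, \<open>\<integral> \<zeta>'\<^sub>t \<bullet> \<sigma> (W\<^sub>T - W\<^sub>t) dt\<close> (\<open>pathwise_comparison\<close>). Since
  \<open>\<zeta>'\<^sub>t\<close> is determined by the noise up to time \<open>t\<close>, while \<open>W\<^sub>T - W\<^sub>t\<close> is centred and independent
  of the past (\<open>increment_independent\<close>), the expectation of this integral is zero
  (\<open>adjoint_noise_expectation\<close>). The remaining work is the progressively measurable construction
  of state processes, by variation of constants, and the square integrability that justifies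
  Fubini's theorem.\<close>

section \<open>Gronwall's inequality and Lipschitz differential equations\<close>

lemma gronwall_from_zero:
  fixes u :: "real \<Rightarrow> real"
  assumes cont: "continuous_on {0..T} u"
    and le: "\<And>t. t \<in> {0..T} \<Longrightarrow> u t \<le> A + C * integral {0..t} u"
    and C: "C \<ge> 0" and t: "t \<in> {0..T}"
  shows "u t \<le> A * exp (C * t)"
proof -
  define h where "h = (\<lambda>t. (A + C * integral {0..t} u) * exp (- (C * t)))"
  have der: "(h has_real_derivative
      (C * u s * exp (- (C * s)) - C * exp (- (C * s)) * (A + C * integral {0..s} u))) (at s within {0..T})"
    if "s \<in> {0..T}" for s
    unfolding h_def
    by (rule derivative_eq_intros integral_has_real_derivative[OF cont that] refl | simp)+
  have "h t \<le> h 0"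
  proof (rule DERIV_nonpos_imp_decreasing_open[of 0 t h])
    show "0 \<le> t" using t by simp
    show "continuous_on {0..t} h"
      using der t by (intro DERIV_continuous_on[of _ _ "\<lambda>s. C * u s * exp (- (C * s)) - C * exp (- (C * s)) * (A + C * integral {0..s} u)"])
        (rule DERIV_subset[OF der], use t in auto)
    fix s assume s: "0 < s" "s < t"
    then have "(h has_real_derivative
      (C * u s * exp (- (C * s)) - C * exp (- (C * s)) * (A + C * integral {0..s} u))) (at s)"
      using der[of s] t by (simp add: at_within_Icc_at)
    moreover have "C * u s * exp (- (C * s)) - C * exp (- (C * s)) * (A + C * integral {0..s} u) \<le> 0"
    proof -
      have "C * exp (- (C * s)) * u s \<le> C * exp (- (C * s)) * (A + C * integral {0..s} u)"
        using le[of s] s t C by (intro mult_left_mono) auto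
      then show ?thesis by (simp add: algebra_simps)
    qed
    ultimately show "\<exists>y. (h has_real_derivative y) (at s) \<and> y \<le> 0" by blast
  qed
  then have "(A + C * integral {0..t} u) * exp (- (C * t)) \<le> A" by (simp add: h_def)
  then have "A + C * integral {0..t} u \<le> A * exp (C * t)"
    by (simp add: exp_minus field_simps)
  with le[OF t] show ?thesis by linarith
qed

lemma gronwall_to_end:
  fixes u :: "real \<Rightarrow> real"
  assumes cont: "continuous_on {0..T} u"
    and le: "\<And>t. t \<in> {0..T} \<Longrightarrow> u t \<le> A + C * integral {t..T} u"
    and C: "C \<ge> 0" and t: "t \<in> {0..T}"
  shows "u t \<le> A * exp (C * (T - t))"
proof -
  have "(\<lambda>s. u (T - s)) (T - t) \<le> A * exp (C * (T - t))"
  proof (rule gronwall_from_zero[where T=T])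
    show "continuous_on {0..T} (\<lambda>s. u (T - s))"
      by (rule continuous_on_compose2[OF cont]) (auto intro!: continuous_intros)
    fix s assume s: "s \<in> {0..T}"
    have "(u has_integral integral {T - s..T} u) {T - s..T}"
      by (intro integrable_integral integrable_continuous_real continuous_on_subset[OF cont]) (use s in auto)
    from has_integral_affinity[OF this[unfolded box_real(2)[symmetric]], of "-1" T]
    have "((\<lambda>x. u (T - x)) has_integral integral {T - s..T} u) ((\<lambda>x. T - x) ` {T - s..T})"
      by simp
    moreover have "(\<lambda>x. T - x) ` {T - s..T} = {0..s}" by simp
    ultimately have "integral {0..s} (\<lambda>x. u (T - x)) = integral {T - s..T} u"
      by (simp add: integral_unique)
    then show "u (T - s) \<le> A + C * integral {0..s} (\<lambda>s. u (T - s))"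
      using le[of "T - s"] s by simp
  qed (use C t in auto)
  then show ?thesis by simp
qed

text \<open>The Picard operator is a contraction on an interval of any length for the weighted norm
  \<open>sup\<^sub>t exp (- \<mu> t) \<parallel>x t\<parallel>\<close> with \<open>\<mu> > K\<close>. The fixed point below is the weighted solution \<open>exp (-
  \<mu> t) x t\<close>; clamping the time to \<open>{0..T}\<close> makes it a bounded continuous function on the whole
  line, a type on which Banach's theorem applies.\<close>

lemma lipschitz_ode_solution:
  fixes f :: "real \<Rightarrow> 'a::banach \<Rightarrow> 'a"
  assumes T: "0 \<le> T" and K: "0 \<le> K"
    and cont: "continuous_on ({0..T} \<times> UNIV) (\<lambda>(t, x). f t x)"
    and lip: "\<And>t x y. t \<in> {0..T} \<Longrightarrow> norm (f t x - f t y) \<le> K * norm (x - y)"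
  shows "\<exists>x. x 0 = x0 \<and> (\<forall>t\<in>{0..T}. (x has_vector_derivative f t (x t)) (at t within {0..T}))"
proof -
  define \<mu> where "\<mu> = K + 1"
  have \<mu>: "\<mu> > 0" using K by (simp add: \<mu>_def)
  define cl where "cl = (\<lambda>t::real. max 0 (min T t))"
  have cl: "cl t \<in> {0..T}" for t using T by (auto simp: cl_def)
  have cont_cl: "continuous_on S cl" for S unfolding cl_def by (intro continuous_intros)
  have cont_f: "continuous_on S (\<lambda>s. f s (y s))" if "continuous_on S y" "S \<subseteq> {0..T}" for y :: "real \<Rightarrow> 'a" and S
  proof -
    have "continuous_on S (\<lambda>s. (s, y s))" using that(1) by (intro continuous_intros)
    from continuous_on_compose2[OF cont this] that(2) show ?thesis by auto
  qed
  define P where "P = (\<lambda>(y::real \<Rightarrow> 'a) t. x0 + integral {0..t} (\<lambda>s. f s (exp (\<mu> * s) *\<^sub>R y s)))"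
  define \<Gamma> where "\<Gamma> = (\<lambda>(y::real \<Rightarrow>\<^sub>C 'a) t. exp (- (\<mu> * cl t)) *\<^sub>R P y (cl t))"
  have int_f: "(\<lambda>s. f s (exp (\<mu> * s) *\<^sub>R apply_bcontfun y s)) integrable_on {0..t}" if "t \<in> {0..T}" for y t
    using that by (intro integrable_continuous_real cont_f continuous_intros) auto
  have contP: "continuous_on {0..T} (\<lambda>t. exp (- (\<mu> * t)) *\<^sub>R P (apply_bcontfun y) t)" for y
    unfolding P_def using T by (intro continuous_intros indefinite_integral_continuous_1 int_f) auto
  have in_bc: "\<Gamma> y \<in> bcontfun" for y
  proof -
    have eq: "\<Gamma> y = (\<lambda>t. (\<lambda>t. exp (- (\<mu> * t)) *\<^sub>R P (apply_bcontfun y) t) (cl t))"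
      by (simp add: \<Gamma>_def)
    have "continuous_on UNIV (\<Gamma> y)"
      unfolding eq by (rule continuous_on_compose2[OF contP cont_cl], rule image_subsetI, rule cl)
    moreover have "bounded (range (\<Gamma> y))"
    proof (rule bounded_subset)
      show "bounded ((\<lambda>t. exp (- (\<mu> * t)) *\<^sub>R P (apply_bcontfun y) t) ` {0..T})"
        by (intro compact_imp_bounded compact_continuous_image contP) simp
      show "range (\<Gamma> y) \<subseteq> (\<lambda>t. exp (- (\<mu> * t)) *\<^sub>R P (apply_bcontfun y) t) ` {0..T}"
        unfolding eq by (intro image_subsetI) (rule image_eqI[OF refl cl])
    qed
    ultimately show ?thesis by (simp add: bcontfun_def)
  qed
  have \<Gamma>_lip: "dist (Bcontfun (\<Gamma> y)) (Bcontfun (\<Gamma> z)) \<le> (K / \<mu>) * dist y z" for y z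
  proof (rule dist_bound)
    fix t
    define s where "s = cl t"
    have s: "s \<in> {0..T}" unfolding s_def by (rule cl)
    have "P y s - P z s = integral {0..s} (\<lambda>r. f r (exp (\<mu> * r) *\<^sub>R y r) - f r (exp (\<mu> * r) *\<^sub>R z r))"
      unfolding P_def by (simp add: integral_diff int_f[OF s])
    moreover have "norm \<dots> \<le> integral {0..s} (\<lambda>r. K * dist y z * exp (\<mu> * r))"
    proof (rule integral_norm_bound_integral)
      fix r assume r: "r \<in> {0..s}"
      have "norm (f r (exp (\<mu> * r) *\<^sub>R y r) - f r (exp (\<mu> * r) *\<^sub>R z r)) \<le> K * (exp (\<mu> * r) * dist (y r) (z r))"
        using lip[of r "exp (\<mu> * r) *\<^sub>R y r" "exp (\<mu> * r) *\<^sub>R z r"] r s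
        by (simp add: scaleR_diff_right[symmetric] dist_norm)
      also have "\<dots> \<le> K * (exp (\<mu> * r) * dist y z)"
        using K by (intro mult_left_mono dist_bounded) auto
      finally show "norm (f r (exp (\<mu> * r) *\<^sub>R y r) - f r (exp (\<mu> * r) *\<^sub>R z r)) \<le> K * dist y z * exp (\<mu> * r)"
        by (simp add: mult_ac)
    next
      show "(\<lambda>r. f r (exp (\<mu> * r) *\<^sub>R y r) - f r (exp (\<mu> * r) *\<^sub>R z r)) integrable_on {0..s}"
        by (intro integrable_diff int_f s)
      show "(\<lambda>r. K * dist y z * exp (\<mu> * r)) integrable_on {0..s}"
        by (intro integrable_continuous_real continuous_intros)
    qed
    moreover have "integral {0..s} (\<lambda>r. K * dist y z * exp (\<mu> * r)) = K * dist y z * (exp (\<mu> * s) - 1) / \<mu>"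
    proof (rule integral_unique)
      have "((\<lambda>r. K * dist y z * exp (\<mu> * r)) has_integral
        (K * dist y z * exp (\<mu> * s) / \<mu> - K * dist y z * exp (\<mu> * 0) / \<mu>)) {0..s}"
        using s \<mu> by (intro fundamental_theorem_of_calculus)
          (auto intro!: derivative_eq_intros simp: has_real_derivative_iff_has_vector_derivative[symmetric])
      then show "((\<lambda>r. K * dist y z * exp (\<mu> * r)) has_integral K * dist y z * (exp (\<mu> * s) - 1) / \<mu>) {0..s}"
        by (simp add: algebra_simps diff_divide_distrib)
    qed
    ultimately have "norm (P y s - P z s) \<le> K * dist y z * exp (\<mu> * s) / \<mu>"
      using K \<mu> by (smt (verit) divide_right_mono mult_left_mono mult_nonneg_nonneg zero_le_dist)
    then have "exp (- (\<mu> * s)) * norm (P y s - P z s) \<le> exp (- (\<mu> * s)) * (K * dist y z * exp (\<mu> * s) / \<mu>)"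
      by (intro mult_left_mono) auto
    also have "\<dots> = (K / \<mu>) * dist y z" by (simp add: exp_minus field_simps)
    finally have "dist (\<Gamma> y t) (\<Gamma> z t) \<le> (K / \<mu>) * dist y z"
      by (simp add: \<Gamma>_def dist_norm s_def scaleR_diff_right[symmetric])
    then show "dist (apply_bcontfun (Bcontfun (\<Gamma> y)) t) (apply_bcontfun (Bcontfun (\<Gamma> z)) t) \<le> K / \<mu> * dist y z"
      by (simp add: Bcontfun_inverse in_bc)
  qed
  have "\<exists>!y. Bcontfun (\<Gamma> y) = y"
    by (rule banach_fix_type[where c="K / \<mu>"]) (use K \<Gamma>_lip in \<open>auto simp: \<mu>_def\<close>)
  then obtain y where y: "Bcontfun (\<Gamma> y) = y" by blast
  have fix_y: "apply_bcontfun y t = exp (- (\<mu> * t)) *\<^sub>R P y t" if "t \<in> {0..T}" for t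
  proof -
    have "apply_bcontfun y t = \<Gamma> y t" using y in_bc[of y] by (metis Bcontfun_inverse)
    moreover have "cl t = t" using that by (auto simp: cl_def)
    ultimately show ?thesis by (simp add: \<Gamma>_def)
  qed
  define x where "x = P y"
  have yx: "exp (\<mu> * t) *\<^sub>R apply_bcontfun y t = x t" if "t \<in> {0..T}" for t
    using fix_y[OF that] by (simp add: x_def exp_minus)
  have "(x has_vector_derivative f t (x t)) (at t within {0..T})" if t: "t \<in> {0..T}" for t
  proof -
    have "(P y has_vector_derivative 0 + f t (exp (\<mu> * t) *\<^sub>R y t)) (at t within {0..T})"
      unfolding P_def
      by (intro has_vector_derivative_add has_vector_derivative_const
          integral_has_vector_derivative[OF _ t] cont_f continuous_intros) auto
    then show ?thesis using yx[OF t] by (simp add: x_def)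
  qed
  moreover have "x 0 = x0" by (simp add: x_def P_def)
  ultimately show ?thesis by blast
qed

lemma has_vector_derivative_reflect:
  fixes x :: "real \<Rightarrow> 'a::real_normed_vector"
  assumes "(x has_vector_derivative d) (at (T - t) within {0..T})" and "t \<in> {0..T}"
  shows "((\<lambda>s. x (T - s)) has_vector_derivative - d) (at t within {0..T})"
proof -
  have "(\<lambda>s. T - s) ` {0..T} \<subseteq> {0..T}" by auto
  then have "(x has_vector_derivative d) (at (T - t) within (\<lambda>s. T - s) ` {0..T})"
    using assms(1) has_vector_derivative_within_subset by blast
  moreover have "((\<lambda>s. T - s) has_vector_derivative -1) (at t within {0..T})"
    by (auto intro!: derivative_eq_intros)
  ultimately have "((x \<circ> (\<lambda>s. T - s)) has_vector_derivative (-1) *\<^sub>R d) (at t within {0..T})"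
    by (rule vector_diff_chain_within[rotated])
  then show ?thesis by (simp add: o_def)
qed

lemma lipschitz_ode_terminal:
  fixes f :: "real \<Rightarrow> 'a::banach \<Rightarrow> 'a"
  assumes T: "0 \<le> T" and K: "0 \<le> K"
    and cont: "continuous_on ({0..T} \<times> UNIV) (\<lambda>(t, x). f t x)"
    and lip: "\<And>t x y. t \<in> {0..T} \<Longrightarrow> norm (f t x - f t y) \<le> K * norm (x - y)"
  shows "\<exists>x. x T = xT \<and> (\<forall>t\<in>{0..T}. (x has_vector_derivative f t (x t)) (at t within {0..T}))"
proof -
  have "\<exists>x. x 0 = xT \<and> (\<forall>t\<in>{0..T}. (x has_vector_derivative - f (T - t) (x t)) (at t within {0..T}))"
  proof (rule lipschitz_ode_solution[OF T K])
    have "continuous_on ({0..T} \<times> UNIV) (\<lambda>z::real \<times> 'a. (\<lambda>(t, x). f t x) (T - fst z, snd z))"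
      by (rule continuous_on_compose2[OF cont]) (auto intro!: continuous_intros)
    then show "continuous_on ({0..T} \<times> UNIV) (\<lambda>(t, x). - f (T - t) x)"
      by (auto simp: case_prod_beta intro!: continuous_intros)
  next
    fix t x y assume "t \<in> {0..T}"
    then show "norm (- f (T - t) x - - f (T - t) y) \<le> K * norm (x - y)"
      using lip[of "T - t" x y] by (simp add: norm_minus_commute)
  qed
  then obtain x where x: "x 0 = xT"
    "\<And>t. t \<in> {0..T} \<Longrightarrow> (x has_vector_derivative - f (T - t) (x t)) (at t within {0..T})" by blast
  have "((\<lambda>s. x (T - s)) has_vector_derivative f t (x (T - t))) (at t within {0..T})" if "t \<in> {0..T}" for t
    using has_vector_derivative_reflect[of x "- f t (x (T - t))" T t] x(2)[of "T - t"] that by simp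
  with x(1) show ?thesis by (intro exI[of _ "\<lambda>s. x (T - s)"]) simp
qed

section \<open>Matrices\<close>

lemma bounded_bilinear_matrix_mult:
  "bounded_bilinear ((**) :: real^'n^'m \<Rightarrow> real^'p^'n \<Rightarrow> real^'p^'m)"
proof -
  have "bilinear ((**) :: real^'n^'m \<Rightarrow> real^'p^'n \<Rightarrow> real^'p^'m)"
    unfolding bilinear_def
    by (auto intro!: linearI simp: vec_eq_iff matrix_matrix_mult_def algebra_simps sum.distrib sum_distrib_left)
  then show ?thesis by (simp add: bilinear_conv_bounded_bilinear)
qed

lemma bounded_bilinear_matrix_vector_mult:
  "bounded_bilinear ((*v) :: real^'n^'m \<Rightarrow> real^'n \<Rightarrow> real^'m)"
proof -
  have "bilinear ((*v) :: real^'n^'m \<Rightarrow> real^'n \<Rightarrow> real^'m)"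
    unfolding bilinear_def
    by (auto intro!: linearI simp: matrix_vector_mult_add_rdistrib matrix_vector_right_distrib
      scaleR_matrix_vector_assoc matrix_vector_mult_scaleR)
  then show ?thesis by (simp add: bilinear_conv_bounded_bilinear)
qed

lemmas matrix_mult_simps =
  bounded_bilinear.add_left[OF bounded_bilinear_matrix_mult]
  bounded_bilinear.add_right[OF bounded_bilinear_matrix_mult]
  bounded_bilinear.diff_left[OF bounded_bilinear_matrix_mult]
  bounded_bilinear.diff_right[OF bounded_bilinear_matrix_mult]
  bounded_bilinear.minus_left[OF bounded_bilinear_matrix_mult]
  bounded_bilinear.minus_right[OF bounded_bilinear_matrix_mult]
  bounded_bilinear.scaleR_left[OF bounded_bilinear_matrix_mult]
  bounded_bilinear.scaleR_right[OF bounded_bilinear_matrix_mult]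
  bounded_bilinear.zero_left[OF bounded_bilinear_matrix_mult]
  bounded_bilinear.zero_right[OF bounded_bilinear_matrix_mult]

lemmas matrix_vector_simps =
  bounded_bilinear.add_left[OF bounded_bilinear_matrix_vector_mult]
  bounded_bilinear.add_right[OF bounded_bilinear_matrix_vector_mult]
  bounded_bilinear.diff_left[OF bounded_bilinear_matrix_vector_mult]
  bounded_bilinear.diff_right[OF bounded_bilinear_matrix_vector_mult]
  bounded_bilinear.minus_left[OF bounded_bilinear_matrix_vector_mult]
  bounded_bilinear.minus_right[OF bounded_bilinear_matrix_vector_mult]
  bounded_bilinear.scaleR_left[OF bounded_bilinear_matrix_vector_mult]
  bounded_bilinear.scaleR_right[OF bounded_bilinear_matrix_vector_mult]
  bounded_bilinear.zero_left[OF bounded_bilinear_matrix_vector_mult]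
  bounded_bilinear.zero_right[OF bounded_bilinear_matrix_vector_mult]

lemmas continuous_on_matrix_mult [continuous_intros] =
  bounded_bilinear.continuous_on[OF bounded_bilinear_matrix_mult]

lemmas continuous_on_matrix_vector_mult [continuous_intros] =
  bounded_bilinear.continuous_on[OF bounded_bilinear_matrix_vector_mult]

lemma linear_transpose: "linear (transpose :: real^'n^'m \<Rightarrow> real^'m^'n)"
  by (rule linearI) (auto simp: transpose_def vec_eq_iff)

lemmas bounded_linear_transpose = linear_transpose[unfolded linear_conv_bounded_linear]

lemmas transpose_simps =
  linear_add[OF linear_transpose] linear_diff[OF linear_transpose] linear_neg[OF linear_transpose]
  linear_cmul[OF linear_transpose] linear_sum[OF linear_transpose]

lemma unit_dyad_nth: "unit_dyad i $ r $ s = (if r = i \<and> s = i then 1 else 0)"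
  by (simp add: unit_dyad_def axis_def)

lemma transpose_unit_dyad [simp]: "transpose (unit_dyad i) = unit_dyad i"
  by (auto simp: vec_eq_iff transpose_def unit_dyad_nth)

lemma sandwich_unit_dyad_nth: "(A ** unit_dyad i ** B) $ r $ s = A $ r $ i * B $ i $ s"
proof -
  have "(A ** unit_dyad i) $ r $ k = (if k = i then A $ r $ i else 0)" for k
    by (cases "k = i") (simp_all add: matrix_matrix_mult_def unit_dyad_nth if_distrib[of "\<lambda>x. _ * x"] cong: if_cong)
  then have "(A ** unit_dyad i ** B) $ r $ s = (\<Sum>k\<in>UNIV. (if k = i then A $ r $ i else 0) * B $ k $ s)"
    by (simp add: matrix_matrix_mult_def[of "A ** unit_dyad i" B])
  also have "\<dots> = (\<Sum>k\<in>UNIV. if k = i then A $ r $ i * B $ i $ s else 0)"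
    by (intro sum.cong) auto
  finally show ?thesis by simp
qed

text \<open>The product \<open>A e\<^sub>i e\<^sub>i\<^sup>T B\<close> has rank one; this form of it is what makes the estimates
  below independent of the number of players.\<close>

lemma sandwich_unit_dyad_vector:
  "(A ** unit_dyad i ** B) *v y = ((B *v y) $ i) *\<^sub>R (A *v axis i 1)"
proof -
  have "((A ** unit_dyad i ** B) *v y) $ r = (B *v y) $ i * A $ r $ i" for r
    by (simp add: matrix_vector_mult_def sandwich_unit_dyad_nth sum_distrib_left sum_distrib_right mult_ac)
  then show ?thesis by (simp add: vec_eq_iff matrix_vector_mult_basis column_def)
qed

text \<open>A bound for the 2-norm as an inequality, which composes without computing any norm.\<close>

definition matrix_bounded :: "real^'n^'m \<Rightarrow> real \<Rightarrow> bool" where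
  "matrix_bounded V v \<longleftrightarrow> 0 \<le> v \<and> (\<forall>x. norm (V *v x) \<le> v * norm x)"

lemma transpose_matrix_inner: "(transpose V *v x) \<bullet> y = x \<bullet> (V *v y)" for V :: "real^'n^'m"
  by (simp add: dot_lmul_matrix transpose_matrix_vector)

lemma matrix_bounded_mult:
  assumes "matrix_bounded V v" "matrix_bounded U u"
  shows "matrix_bounded (V ** U) (v * u)"
  unfolding matrix_bounded_def
proof (intro conjI allI)
  show "0 \<le> v * u" using assms by (simp add: matrix_bounded_def)
  fix x
  have "norm ((V ** U) *v x) \<le> v * norm (U *v x)"
    using assms(1) by (simp add: matrix_bounded_def matrix_vector_mul_assoc[symmetric])
  also have "\<dots> \<le> v * (u * norm x)"
    using assms by (intro mult_left_mono) (auto simp: matrix_bounded_def)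
  finally show "norm ((V ** U) *v x) \<le> v * u * norm x" by simp
qed

text \<open>Cauchy-Schwarz with bounded weights: summing over the players costs nothing as long as two
  of the three factors are components of vectors.\<close>

lemma abs_weighted_sum_le:
  fixes z w :: "real^'n"
  assumes "\<And>i. \<bar>b i\<bar> \<le> C" and "0 \<le> C"
  shows "\<bar>\<Sum>i\<in>UNIV. z $ i * b i * w $ i\<bar> \<le> C * norm z * norm w"
proof -
  have "\<bar>\<Sum>i\<in>UNIV. z $ i * b i * w $ i\<bar> = \<bar>(\<chi> i. z $ i * b i) \<bullet> w\<bar>"
    by (simp add: inner_vec_def)
  also have "\<dots> \<le> norm (\<chi> i. z $ i * b i) * norm w" by (rule Cauchy_Schwarz_ineq2)
  also have "norm (\<chi> i. z $ i * b i) \<le> norm (C *\<^sub>R z)"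
  proof (rule norm_le_componentwise_cart)
    fix i show "norm ((\<chi> i. z $ i * b i) $ i) \<le> norm ((C *\<^sub>R z) $ i)"
      using mult_right_mono[OF assms(1)[of i], of "\<bar>z $ i\<bar>"] assms(2) by (simp add: abs_mult mult_ac)
  qed
  finally show ?thesis using assms(2) by (simp add: mult_right_mono)
qed

section \<open>A norm for families of matrices\<close>

text \<open>The linear functionals that define the norm. For \<open>U = 1\<close> this is \<open>z \<bullet> (S y)\<close>, where \<open>S\<close> is
  the matrix whose \<open>i\<close>-th row is the \<open>i\<close>-th row of \<open>M\<^sub>i\<close>. A general \<open>U\<close> makes the class of
  functionals stable under multiplication of all \<open>M\<^sub>i\<close> from the left by a common matrix.\<close>

definition family_pairing :: "real^'n^'n \<Rightarrow> real^'n \<Rightarrow> real^'n \<Rightarrow> real^'n^'n^'n \<Rightarrow> real" where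
  "family_pairing U z y M = (\<Sum>i\<in>UNIV. z $ i * ((U *v axis i 1) \<bullet> (M $ i *v y)))"

definition family_tests :: "((real^'n^'n) \<times> (real^'n) \<times> (real^'n)) set" where
  "family_tests = {(U, z, y). matrix_bounded U 1 \<and> norm z \<le> 1 \<and> norm y \<le> 1}"

text \<open>The norm in which the system of Riccati equations is estimated; \<open>own_rows_bounded\<close> is the
  property that a maximum over the players of 2-norms lacks.\<close>

definition family_norm :: "real^'n^'n^'n \<Rightarrow> real" where
  "family_norm M = (SUP (U, z, y)\<in>family_tests. family_pairing U z y M)"

lemma family_pairing_linear: "linear (family_pairing U z y)"
  by (rule linearI)
    (simp_all add: family_pairing_def matrix_vector_simps inner_add_right sum.distrib sum_distrib_left algebra_simps)

text \<open>The Euclidean norm is used only qualitatively, for continuity and for the existence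
  theorem, so its comparison constants with \<open>family_norm\<close> may depend on the dimension.\<close>

lemma family_pairing_le_multiple_norm:
  "\<exists>C\<ge>0. \<forall>(M :: real^'n^'n^'n) U z y. (U, z, y) \<in> family_tests \<longrightarrow> family_pairing U z y M \<le> C * norm M"
proof -
  obtain B where B: "B > 0" "\<And>(A::real^'n^'n) x. norm (A *v x) \<le> norm A * norm x * B"
    using bounded_bilinear.pos_bounded[OF bounded_bilinear_matrix_vector_mult] by blast
  have "family_pairing U z y M \<le> (real CARD('n) * B) * norm M"
    if "(U, z, y) \<in> family_tests" for M :: "real^'n^'n^'n" and U z y
  proof -
    have "z $ i * ((U *v axis i 1) \<bullet> (M $ i *v y)) \<le> B * norm M" for i
    proof -
      have "z $ i * ((U *v axis i 1) \<bullet> (M $ i *v y)) \<le> \<bar>z $ i\<bar> * \<bar>(U *v axis i 1) \<bullet> (M $ i *v y)\<bar>"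
        by (metis abs_ge_self abs_mult)
      also have "\<dots> \<le> 1 * (1 * (norm M * 1 * B))"
      proof (intro mult_mono)
        show "\<bar>z $ i\<bar> \<le> 1" using that component_le_norm_cart[of z i] by (auto simp: family_tests_def)
        have "\<bar>(U *v axis i 1) \<bullet> (M $ i *v y)\<bar> \<le> norm (U *v axis i 1) * norm (M $ i *v y)"
          by (rule Cauchy_Schwarz_ineq2)
        also have "\<dots> \<le> 1 * (norm M * 1 * B)"
        proof (intro mult_mono)
          have "norm (U *v axis i 1) \<le> 1 * norm (axis i 1 :: real^'n)"
            using that unfolding family_tests_def matrix_bounded_def by blast
          then show "norm (U *v axis i 1) \<le> 1" by (simp add: norm_axis_1)
          have "norm (M $ i *v y) \<le> norm (M $ i) * norm y * B" by (rule B)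
          also have "\<dots> \<le> norm M * 1 * B"
            using that B(1) by (intro mult_mono Finite_Cartesian_Product.norm_nth_le) (auto simp: family_tests_def)
          finally show "norm (M $ i *v y) \<le> norm M * 1 * B" .
        qed auto
        finally show "\<bar>(U *v axis i 1) \<bullet> (M $ i *v y)\<bar> \<le> 1 * (norm M * 1 * B)" .
      qed auto
      finally show ?thesis by (simp add: mult_ac)
    qed
    then have "family_pairing U z y M \<le> (\<Sum>i\<in>(UNIV::'n set). B * norm M)"
      unfolding family_pairing_def by (intro sum_mono)
    then show ?thesis by (simp add: mult_ac)
  qed
  then show ?thesis using B(1) by (intro exI[of _ "real CARD('n) * B"]) auto
qed

lemma family_norm_leI:
  fixes M :: "real^'n^'n^'n"
  assumes "\<And>U z y. matrix_bounded U 1 \<Longrightarrow> norm z \<le> 1 \<Longrightarrow> norm y \<le> 1 \<Longrightarrow> family_pairing U z y M \<le> C"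
  shows "family_norm M \<le> C"
  unfolding family_norm_def
proof (rule cSUP_least)
  have "(0, 0, 0) \<in> family_tests" by (simp add: family_tests_def matrix_bounded_def)
  then show "(family_tests :: ((real^'n^'n) \<times> (real^'n) \<times> (real^'n)) set) \<noteq> {}" by blast
qed (use assms in \<open>auto simp: family_tests_def\<close>)

lemma family_pairing_le_norm:
  fixes M :: "real^'n^'n^'n"
  assumes "(U, z, y) \<in> family_tests"
  shows "family_pairing U z y M \<le> family_norm M"
proof -
  obtain C where "\<And>(M :: real^'n^'n^'n) U z y. (U, z, y) \<in> family_tests \<Longrightarrow> family_pairing U z y M \<le> C * norm M"
    using family_pairing_le_multiple_norm by metis
  then have "bdd_above ((\<lambda>(U, z, y). family_pairing U z y M) ` family_tests)"
    by (intro bdd_aboveI[of _ "C * norm M"]) auto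
  from cSUP_upper[OF assms this] show ?thesis by (simp add: family_norm_def)
qed

lemma family_pairing_bound:
  fixes M :: "real^'n^'n^'n"
  assumes "matrix_bounded U u"
  shows "\<bar>family_pairing U z y M\<bar> \<le> family_norm M * (u * norm z * norm y)"
proof -
  have main: "family_pairing U z y M \<le> family_norm M * (u * norm z * norm y)" for z
  proof (cases "u = 0 \<or> z = 0 \<or> y = 0")
    case True
    moreover have "U *v x = 0" if "u = 0" for x using assms that by (auto simp: matrix_bounded_def)
    ultimately have "family_pairing U z y M = 0" by (auto simp: family_pairing_def)
    then show ?thesis using True by auto
  next
    case False
    with assms have u: "u > 0" by (auto simp: matrix_bounded_def)
    have "matrix_bounded ((1/u) *\<^sub>R U) 1"
      using assms u by (auto simp: matrix_bounded_def matrix_vector_simps field_simps)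
    then have "((1/u) *\<^sub>R U, (1/norm z) *\<^sub>R z, (1/norm y) *\<^sub>R y) \<in> family_tests"
      by (auto simp: family_tests_def)
    from family_pairing_le_norm[OF this, of M]
    have "(1/u) * (1/norm z) * (1/norm y) * family_pairing U z y M \<le> family_norm M"
      by (simp add: family_pairing_def matrix_vector_simps sum_distrib_left mult_ac)
    then show ?thesis using u False by (simp add: field_simps)
  qed
  have "family_pairing U (- z) y M = - family_pairing U z y M"
    by (simp add: family_pairing_def sum_negf)
  with main[of z] main[of "- z"] show ?thesis by (simp add: abs_le_iff)
qed

lemma family_norm_nonneg: "0 \<le> family_norm M" for M :: "real^'n^'n^'n"
proof -
  have "(0, 0, 0) \<in> family_tests" by (simp add: family_tests_def matrix_bounded_def)
  from family_pairing_le_norm[OF this, of M] show ?thesis by (simp add: family_pairing_def)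
qed

lemma family_norm_le_of_pairing_bound:
  fixes M :: "real^'n^'n^'n"
  assumes "\<And>U z y. matrix_bounded U 1 \<Longrightarrow> \<bar>family_pairing U z y M\<bar> \<le> C * (1 * norm z * norm y)" "0 \<le> C"
  shows "family_norm M \<le> C"
proof (rule family_norm_leI)
  fix U :: "real^'n^'n" and z y :: "real^'n"
  assume *: "matrix_bounded U 1" "norm z \<le> 1" "norm y \<le> 1"
  have "C * (1 * norm z * norm y) \<le> C * (1 * 1 * 1)"
    using * assms(2) by (intro mult_left_mono mult_mono) auto
  then show "family_pairing U z y M \<le> C" using assms(1)[OF *(1), of z y] by linarith
qed

lemma family_norm_triangle: "family_norm (M + M') \<le> family_norm M + family_norm M'" for M :: "real^'n^'n^'n"
  by (rule family_norm_leI) (auto simp: linear_add[OF family_pairing_linear] family_tests_def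
    intro!: add_mono family_pairing_le_norm)

lemma family_norm_scaleR: "family_norm (r *\<^sub>R M) \<le> \<bar>r\<bar> * family_norm M" for M :: "real^'n^'n^'n"
proof (rule family_norm_le_of_pairing_bound)
  fix U :: "real^'n^'n" and z y :: "real^'n"
  assume "matrix_bounded U 1"
  from mult_left_mono[OF family_pairing_bound[OF this, of z y M], of "\<bar>r\<bar>"]
  show "\<bar>family_pairing U z y (r *\<^sub>R M)\<bar> \<le> \<bar>r\<bar> * family_norm M * (1 * norm z * norm y)"
    by (simp add: linear_cmul[OF family_pairing_linear] abs_mult)
qed (simp add: family_norm_nonneg)

lemma family_norm_zero [simp]: "family_norm (0 :: real^'n^'n^'n) = 0"
  using family_norm_scaleR[of 0 "0 :: real^'n^'n^'n"] family_norm_nonneg[of "0 :: real^'n^'n^'n"] by simp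

lemma family_norm_minus: "family_norm (- M) = family_norm M" for M :: "real^'n^'n^'n"
  using family_norm_scaleR[of "-1" M] family_norm_scaleR[of "-1" "- M"] by simp

lemma family_norm_triangle_diff: "family_norm (M - M') \<le> family_norm M + family_norm M'"
  for M :: "real^'n^'n^'n"
  using family_norm_triangle[of M "- M'"] by (simp add: family_norm_minus)

text \<open>Taking \<open>z\<close> to be the \<open>i\<close>-th unit vector isolates the contribution of player \<open>i\<close>.\<close>

lemma own_block_bound:
  fixes M :: "real^'n^'n^'n"
  assumes "matrix_bounded U u"
  shows "\<bar>(U *v axis i 1) \<bullet> (M $ i *v y)\<bar> \<le> family_norm M * (u * norm y)"
proof -
  have "family_pairing U (axis i 1) y M = (U *v axis i 1) \<bullet> (M $ i *v y)"
  proof -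
    have "family_pairing U (axis i 1) y M =
        (\<Sum>k\<in>UNIV. if k = i then (U *v axis i 1) \<bullet> (M $ i *v y) else 0)"
      unfolding family_pairing_def by (intro sum.cong) (auto simp: axis_def)
    then show ?thesis by simp
  qed
  with family_pairing_bound[OF assms, of "axis i 1" y M] show ?thesis by (simp add: norm_axis_1)
qed

lemma entry_le_family_norm: "\<bar>M $ i $ r $ s\<bar> \<le> family_norm M" for M :: "real^'n^'n^'n"
proof -
  \<comment> \<open>The matrix unit that maps the \<open>i\<close>-th to the \<open>r\<close>-th basis vector.\<close>
  define U :: "real^'n^'n" where "U = (\<chi> k l. if k = r \<and> l = i then 1 else 0)"
  have Ux: "U *v x = (x $ i) *\<^sub>R axis r 1" for x
  proof -
    have "(U *v x) $ k = (\<Sum>l\<in>UNIV. if l = i then (if k = r then x $ i else 0) else 0)" for k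
      by (simp only: matrix_vector_mult_def U_def vec_lambda_beta, intro sum.cong) auto
    then show ?thesis by (simp add: vec_eq_iff axis_def)
  qed
  have "matrix_bounded U 1"
    using component_le_norm_cart by (auto simp: matrix_bounded_def Ux norm_axis_1)
  moreover have "U *v axis i 1 = axis r 1" by (simp add: Ux)
  ultimately show ?thesis
    using own_block_bound[of U 1 i M "axis s 1"]
    by (simp add: norm_axis_1 matrix_vector_mult_basis[of "M $ i"] inner_axis' column_def
        del: matrix_vector_mult_basis)
qed

lemma norm_le_family_norm: "norm M \<le> real CARD('n) ^ 3 * family_norm M" for M :: "real^'n^'n^'n"
proof -
  have "norm M \<le> (\<Sum>i\<in>UNIV. norm (M $ i))" unfolding norm_vec_def by (rule L2_set_le_sum) simp
  also have "\<dots> \<le> (\<Sum>i\<in>UNIV. \<Sum>r\<in>UNIV. norm (M $ i $ r))"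
    by (intro sum_mono) (simp add: norm_vec_def L2_set_le_sum)
  also have "\<dots> \<le> (\<Sum>i\<in>UNIV. \<Sum>r\<in>UNIV. \<Sum>s\<in>UNIV. \<bar>M $ i $ r $ s\<bar>)"
    by (intro sum_mono norm_le_l1_cart)
  also have "\<dots> \<le> (\<Sum>i\<in>(UNIV::'n set). \<Sum>r\<in>(UNIV::'n set). \<Sum>s\<in>(UNIV::'n set). family_norm M)"
    by (intro sum_mono entry_le_family_norm)
  finally show ?thesis by (simp add: power3_eq_cube mult_ac)
qed

lemma family_norm_le_multiple_norm:
  "\<exists>C\<ge>0. \<forall>M :: real^'n^'n^'n. family_norm M \<le> C * norm M"
proof -
  obtain C where C: "C \<ge> 0"
    "\<And>(M :: real^'n^'n^'n) U z y. (U, z, y) \<in> family_tests \<Longrightarrow> family_pairing U z y M \<le> C * norm M"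
    using family_pairing_le_multiple_norm by metis
  have "family_norm M \<le> C * norm M" for M :: "real^'n^'n^'n"
    by (rule family_norm_leI) (auto intro!: C simp: family_tests_def)
  with C(1) show ?thesis by blast
qed

lemma family_norm_continuous: "continuous_on S (family_norm :: real^'n^'n^'n \<Rightarrow> real)"
proof -
  obtain C where C: "C \<ge> 0" "\<And>M :: real^'n^'n^'n. family_norm M \<le> C * norm M"
    using family_norm_le_multiple_norm by blast
  have "C-lipschitz_on S (family_norm :: real^'n^'n^'n \<Rightarrow> real)"
  proof (rule lipschitz_onI)
    fix M M' :: "real^'n^'n^'n"
    have "family_norm M \<le> family_norm (M - M') + family_norm M'"
      "family_norm M' \<le> family_norm (M - M') + family_norm M"
      using family_norm_triangle[of "M - M'" M'] family_norm_triangle[of "M' - M" M]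
        family_norm_minus[of "M - M'"] by simp_all
    then show "dist (family_norm M) (family_norm M') \<le> C * dist M M'"
      using C(2)[of "M - M'"] by (simp add: dist_norm abs_le_iff)
  qed (rule C)
  then show ?thesis by (rule lipschitz_on_continuous_on)
qed

section \<open>The vector field of fictitious play\<close>

text \<open>The matrix \<open>\<Sum>\<^sub>j e\<^sub>j e\<^sub>j\<^sup>T K\<^sub>j\<close> through which all players enter the dynamics; its \<open>j\<close>-th
  row is the \<open>j\<close>-th row of \<open>K\<^sub>j\<close>.\<close>

definition own_rows :: "real^'n^'n^'n \<Rightarrow> real^'n^'n" where
  "own_rows K = (\<chi> j. K $ j $ j)"

definition cross_term :: "real^'n^'n^'n \<Rightarrow> real^'n^'n^'n \<Rightarrow> real^'n^'n^'n" where
  "cross_term H K = (\<chi> i. H $ i ** unit_dyad i ** K $ i)"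

definition left_mult :: "real^'n^'n \<Rightarrow> real^'n^'n^'n \<Rightarrow> real^'n^'n^'n" where
  "left_mult V M = (\<chi> i. V ** M $ i)"

definition right_mult :: "real^'n^'n^'n \<Rightarrow> real^'n^'n \<Rightarrow> real^'n^'n^'n" where
  "right_mult M V = (\<chi> i. M $ i ** V)"

definition laplacian_source :: "real^'n^'n \<Rightarrow> real^'n^'n^'n" where
  "laplacian_source L = (\<chi> i. L ** unit_dyad i ** L)"

text \<open>Completing the sums over \<open>j \<noteq> i\<close> of fictitious play to sums over all \<open>j\<close> produces
  \<open>own_rows\<close>, at the price of the two mixed terms in \<open>F\<close> and \<open>K\<close>. For \<open>K = F\<close> the three cross
  terms add up to the single term \<open>- F\<^sub>i e\<^sub>i e\<^sub>i\<^sup>T F\<^sub>i\<close> of the coupled system.\<close>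

definition quadratic_part :: "real^'n^'n^'n \<Rightarrow> real^'n^'n^'n \<Rightarrow> real^'n^'n^'n" where
  "quadratic_part F K = cross_term F F - cross_term F K - cross_term K F
     + right_mult F (own_rows K) + left_mult (transpose (own_rows K)) F"

text \<open>The time derivative of the players' matrices \<open>F\<close> when each of them optimizes against the
  feedback matrices \<open>K\<close>; the parameters stand for \<open>\<kappa> = a + q\<close> and \<open>\<delta> = \<epsilon> - q\<^sup>2\<close>.\<close>

definition best_response_field ::
  "real^'n^'n \<Rightarrow> real \<Rightarrow> real \<Rightarrow> real^'n^'n^'n \<Rightarrow> real^'n^'n^'n \<Rightarrow> real^'n^'n^'n" where
  "best_response_field L \<kappa> \<delta> F K =
     \<kappa> *\<^sub>R (left_mult L F + right_mult F L) + quadratic_part F K - \<delta> *\<^sub>R laplacian_source L"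

definition symmetric_family :: "real^'n^'n^'n \<Rightarrow> bool" where
  "symmetric_family M \<longleftrightarrow> (\<forall>i. transpose (M $ i) = M $ i)"

lemma linear_own_rows: "linear (own_rows :: real^'n^'n^'n \<Rightarrow> real^'n^'n)"
  by (rule linearI) (auto simp: own_rows_def vec_eq_iff)

lemma bounded_bilinear_cross_term:
  "bounded_bilinear (cross_term :: real^'n^'n^'n \<Rightarrow> real^'n^'n^'n \<Rightarrow> real^'n^'n^'n)"
proof -
  have "bilinear (cross_term :: real^'n^'n^'n \<Rightarrow> real^'n^'n^'n \<Rightarrow> real^'n^'n^'n)"
    unfolding bilinear_def
    by (auto intro!: linearI simp: vec_eq_iff cross_term_def sandwich_unit_dyad_nth algebra_simps)
  then show ?thesis by (simp add: bilinear_conv_bounded_bilinear)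
qed

lemma bounded_bilinear_left_mult:
  "bounded_bilinear (left_mult :: real^'n^'n \<Rightarrow> real^'n^'n^'n \<Rightarrow> real^'n^'n^'n)"
proof -
  have "bilinear (left_mult :: real^'n^'n \<Rightarrow> real^'n^'n^'n \<Rightarrow> real^'n^'n^'n)"
    unfolding bilinear_def
    by (auto intro!: linearI simp: vec_eq_iff[where 'a="real^'n^'n"] left_mult_def matrix_mult_simps)
  then show ?thesis by (simp add: bilinear_conv_bounded_bilinear)
qed

lemma bounded_bilinear_right_mult:
  "bounded_bilinear (right_mult :: real^'n^'n^'n \<Rightarrow> real^'n^'n \<Rightarrow> real^'n^'n^'n)"
proof -
  have "bilinear (right_mult :: real^'n^'n^'n \<Rightarrow> real^'n^'n \<Rightarrow> real^'n^'n^'n)"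
    unfolding bilinear_def
    by (auto intro!: linearI simp: vec_eq_iff[where 'a="real^'n^'n"] right_mult_def matrix_mult_simps)
  then show ?thesis by (simp add: bilinear_conv_bounded_bilinear)
qed

lemma own_rows_eq_sum: "own_rows K = (\<Sum>j\<in>UNIV. unit_dyad j ** K $ j)"
proof -
  have "(unit_dyad j ** K $ j) $ r $ s = (if j = r then K $ r $ r $ s else 0)" for j r s
    using sandwich_unit_dyad_nth[of "mat 1" j "K $ j" r s, unfolded matrix_mul_lid] by (simp add: mat_def)
  then show ?thesis by (simp add: own_rows_def vec_eq_iff)
qed

lemma transpose_own_rows_eq_sum:
  assumes "symmetric_family K"
  shows "transpose (own_rows K) = (\<Sum>j\<in>UNIV. K $ j ** unit_dyad j)"
  using assms by (simp add: own_rows_eq_sum transpose_simps matrix_transpose_mul symmetric_family_def)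

lemma own_rows_vector_nth: "(own_rows K *v y) $ i = (K $ i *v y) $ i"
  by (simp add: own_rows_def matrix_vector_mult_def)

lemma family_norm_triangle_five:
  "family_norm (a - b - c + d + e) \<le> family_norm a + family_norm b + family_norm c + family_norm d + family_norm e"
  for a :: "real^'n^'n^'n"
  using family_norm_triangle[of "a - b - c + d" e] family_norm_triangle[of "a - b - c" d]
    family_norm_triangle_diff[of "a - b" c] family_norm_triangle_diff[of a b] by linarith

section \<open>Bounds for the vector field\<close>

text \<open>This is the functional with \<open>U = 1\<close> and \<open>z = S y\<close>, where \<open>S\<close> is the matrix of own rows.\<close>

lemma own_rows_bounded: "matrix_bounded (own_rows K) (family_norm K)" for K :: "real^'n^'n^'n"
  unfolding matrix_bounded_def
proof (intro conjI allI family_norm_nonneg)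
  fix y
  let ?z = "own_rows K *v y"
  have id: "matrix_bounded (mat 1 :: real^'n^'n) 1" by (simp add: matrix_bounded_def)
  have "norm ?z * norm ?z = ?z \<bullet> ?z" by (simp add: dot_square_norm power2_eq_square)
  also have "\<dots> = family_pairing (mat 1) ?z y K"
    by (simp add: family_pairing_def inner_vec_def[of ?z ?z] inner_axis' own_rows_vector_nth)
  also have "\<dots> \<le> family_norm K * (1 * norm ?z * norm y)"
    using family_pairing_bound[OF id, of ?z y K] by linarith
  finally have "norm ?z * norm ?z \<le> (family_norm K * norm y) * norm ?z" by (simp add: mult_ac)
  then show "norm ?z \<le> family_norm K * norm y"
    using family_norm_nonneg[of K] by (cases "norm ?z = 0") (auto simp: mult_le_cancel_right)
qed

text \<open>By \<open>sandwich_unit_dyad_vector\<close> the \<open>i\<close>-th summand of the pairing factors into \<open>z\<^sub>i\<close>, a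
  scalar bounded by the norm of \<open>H\<close>, and the \<open>i\<close>-th component of \<open>own_rows K y\<close>.\<close>

lemma family_norm_cross_term: "family_norm (cross_term H K) \<le> family_norm H * family_norm K"
  for H :: "real^'n^'n^'n"
proof (rule family_norm_le_of_pairing_bound)
  fix U :: "real^'n^'n" and z y :: "real^'n"
  assume U: "matrix_bounded U 1"
  have eq: "family_pairing U z y (cross_term H K) =
    (\<Sum>i\<in>UNIV. z $ i * ((U *v axis i 1) \<bullet> (H $ i *v axis i 1)) * (own_rows K *v y) $ i)"
    by (simp add: family_pairing_def cross_term_def sandwich_unit_dyad_vector own_rows_vector_nth mult_ac)
  have "\<bar>(U *v axis i 1) \<bullet> (H $ i *v axis i 1)\<bar> \<le> family_norm H" for i
    using own_block_bound[OF U, of i H "axis i 1"] by (simp add: norm_axis_1)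
  then have "\<bar>family_pairing U z y (cross_term H K)\<bar> \<le> family_norm H * norm z * norm (own_rows K *v y)"
    unfolding eq by (rule abs_weighted_sum_le) (rule family_norm_nonneg)
  also have "\<dots> \<le> family_norm H * norm z * (family_norm K * norm y)"
    using own_rows_bounded[of K] family_norm_nonneg[of H]
    by (intro mult_left_mono) (auto simp: matrix_bounded_def)
  finally show "\<bar>family_pairing U z y (cross_term H K)\<bar> \<le> family_norm H * family_norm K * (1 * norm z * norm y)"
    by (simp add: mult_ac)
qed (simp add: family_norm_nonneg)

lemma family_norm_right_mult:
  fixes M :: "real^'n^'n^'n"
  assumes "matrix_bounded V v"
  shows "family_norm (right_mult M V) \<le> family_norm M * v"
proof (rule family_norm_le_of_pairing_bound)
  fix U :: "real^'n^'n" and z y :: "real^'n"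
  assume U: "matrix_bounded U 1"
  have "family_pairing U z y (right_mult M V) = family_pairing U z (V *v y) M"
    by (simp add: family_pairing_def right_mult_def matrix_vector_mul_assoc)
  then have "\<bar>family_pairing U z y (right_mult M V)\<bar> \<le> family_norm M * (1 * norm z * norm (V *v y))"
    using family_pairing_bound[OF U, of z "V *v y" M] by simp
  also have "\<dots> \<le> family_norm M * (1 * norm z * (v * norm y))"
    using assms family_norm_nonneg[of M] by (intro mult_left_mono) (auto simp: matrix_bounded_def)
  finally show "\<bar>family_pairing U z y (right_mult M V)\<bar> \<le> family_norm M * v * (1 * norm z * norm y)"
    by (simp add: mult_ac)
qed (use assms family_norm_nonneg[of M] in \<open>simp add: matrix_bounded_def\<close>)

text \<open>The left factor moves onto the test matrix \<open>U\<close>.\<close>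

lemma family_norm_left_mult:
  fixes M :: "real^'n^'n^'n"
  assumes "matrix_bounded V v"
  shows "family_norm (left_mult (transpose V) M) \<le> v * family_norm M"
proof (rule family_norm_le_of_pairing_bound)
  fix U :: "real^'n^'n" and z y :: "real^'n"
  assume U: "matrix_bounded U 1"
  have "(U *v axis i 1) \<bullet> ((transpose V ** M $ i) *v y) = ((V ** U) *v axis i 1) \<bullet> (M $ i *v y)" for i
    by (metis inner_commute matrix_vector_mul_assoc transpose_matrix_inner)
  then have "family_pairing U z y (left_mult (transpose V) M) = family_pairing (V ** U) z y M"
    by (simp add: family_pairing_def left_mult_def)
  then show "\<bar>family_pairing U z y (left_mult (transpose V) M)\<bar> \<le> v * family_norm M * (1 * norm z * norm y)"
    using family_pairing_bound[OF matrix_bounded_mult[OF assms U], of z y M] by (simp add: mult_ac)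
qed (use assms family_norm_nonneg[of M] in \<open>simp add: matrix_bounded_def\<close>)

lemma family_norm_laplacian_source:
  fixes L :: "real^'n^'n"
  assumes "matrix_bounded L l"
  shows "family_norm (laplacian_source L) \<le> l\<^sup>2"
proof (rule family_norm_le_of_pairing_bound)
  have l: "0 \<le> l" using assms by (simp add: matrix_bounded_def)
  fix U :: "real^'n^'n" and z y :: "real^'n"
  assume U: "matrix_bounded U 1"
  have eq: "family_pairing U z y (laplacian_source L) =
    (\<Sum>i\<in>UNIV. z $ i * ((U *v axis i 1) \<bullet> (L *v axis i 1)) * (L *v y) $ i)"
    by (simp add: family_pairing_def laplacian_source_def sandwich_unit_dyad_vector mult_ac)
  have "\<bar>(U *v axis i 1) \<bullet> (L *v axis i 1)\<bar> \<le> l" for i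
  proof -
    have "norm (U *v axis i 1) \<le> 1 * norm (axis i 1 :: real^'n)" "norm (L *v axis i 1) \<le> l * norm (axis i 1 :: real^'n)"
      using U assms unfolding matrix_bounded_def by blast+
    note b = this
    have "\<bar>(U *v axis i 1) \<bullet> (L *v axis i 1)\<bar> \<le> norm (U *v axis i 1) * norm (L *v axis i 1)"
      by (rule Cauchy_Schwarz_ineq2)
    also have "\<dots> \<le> (1 * norm (axis i 1 :: real^'n)) * (l * norm (axis i 1 :: real^'n))"
      using b by (rule mult_mono) auto
    finally show ?thesis by (simp add: norm_axis_1)
  qed
  then have "\<bar>family_pairing U z y (laplacian_source L)\<bar> \<le> l * norm z * norm (L *v y)"
    unfolding eq by (rule abs_weighted_sum_le) (rule l)
  also have "\<dots> \<le> l * norm z * (l * norm y)"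
    using assms l by (intro mult_left_mono) (auto simp: matrix_bounded_def)
  finally show "\<bar>family_pairing U z y (laplacian_source L)\<bar> \<le> l\<^sup>2 * (1 * norm z * norm y)"
    by (simp add: power2_eq_square mult_ac)
qed simp

lemma family_norm_left_mult_own_rows:
  "family_norm (left_mult (transpose (own_rows K)) M) \<le> family_norm K * family_norm M"
  for M :: "real^'n^'n^'n"
  by (rule family_norm_left_mult[OF own_rows_bounded])

lemma family_norm_right_mult_own_rows:
  "family_norm (right_mult M (own_rows K)) \<le> family_norm M * family_norm K"
  for M :: "real^'n^'n^'n"
  by (rule family_norm_right_mult[OF own_rows_bounded])

lemma family_norm_drift:
  fixes M :: "real^'n^'n^'n"
  assumes "matrix_bounded L l" "transpose L = L"
  shows "family_norm (left_mult L M + right_mult M L) \<le> 2 * l * family_norm M"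
  using family_norm_triangle[of "left_mult L M" "right_mult M L"]
    family_norm_left_mult[OF assms(1), of M] family_norm_right_mult[OF assms(1), of M] assms(2)
  by (simp add: mult_ac)

text \<open>Five products, each at most \<open>R\<^sup>2\<close>.\<close>

lemma family_norm_quadratic_part:
  fixes F :: "real^'n^'n^'n"
  assumes "family_norm F \<le> R" "family_norm K \<le> R"
  shows "family_norm (quadratic_part F K) \<le> 5 * R\<^sup>2"
proof -
  have prod: "family_norm A * family_norm B \<le> R\<^sup>2"
    if "family_norm A \<le> R" "family_norm B \<le> R" for A B :: "real^'n^'n^'n"
    using mult_mono[OF that] that family_norm_nonneg[of A] family_norm_nonneg[of B]
    by (simp add: power2_eq_square)
  note p = prod[OF assms(1) assms(1)] prod[OF assms] prod[OF assms(2,1)]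
  have "family_norm (cross_term F F - cross_term F K - cross_term K F + right_mult F (own_rows K)
      + left_mult (transpose (own_rows K)) F) \<le>
      family_norm (cross_term F F) + family_norm (cross_term F K) + family_norm (cross_term K F)
       + family_norm (right_mult F (own_rows K)) + family_norm (left_mult (transpose (own_rows K)) F)"
    by (rule family_norm_triangle_five)
  then show ?thesis
    unfolding quadratic_part_def
    using p family_norm_cross_term[of F F] family_norm_cross_term[of F K] family_norm_cross_term[of K F]
      family_norm_right_mult_own_rows[of F K] family_norm_left_mult_own_rows[of K F]
    by linarith
qed

text \<open>Each product is telescoped as \<open>b F K - b H J = b (F - H) K + b H (K - J)\<close>, up to the order
  of the factors. In the estimate that follows, the term quadratic in \<open>F\<close> contributes 2 to the
  coefficient of \<open>F - H\<close>, and each of the other four products contributes 1 to both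
  coefficients.\<close>

lemma quadratic_part_diff:
  "quadratic_part F K - quadratic_part H J =
     (cross_term (F - H) F + cross_term H (F - H))
   - (cross_term (F - H) K + cross_term H (K - J))
   - (cross_term (K - J) F + cross_term J (F - H))
   + (right_mult (F - H) (own_rows K) + right_mult H (own_rows (K - J)))
   + (left_mult (transpose (own_rows K)) (F - H) + left_mult (transpose (own_rows (K - J))) H)"
  unfolding quadratic_part_def
  by (simp add: linear_diff[OF linear_own_rows] transpose_simps
    bounded_bilinear.diff_left[OF bounded_bilinear_cross_term] bounded_bilinear.diff_right[OF bounded_bilinear_cross_term]
    bounded_bilinear.diff_left[OF bounded_bilinear_left_mult] bounded_bilinear.diff_right[OF bounded_bilinear_left_mult]
    bounded_bilinear.diff_left[OF bounded_bilinear_right_mult] bounded_bilinear.diff_right[OF bounded_bilinear_right_mult])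

lemma family_norm_quadratic_part_diff:
  fixes F :: "real^'n^'n^'n"
  assumes R: "family_norm F \<le> R" "family_norm K \<le> R" "family_norm H \<le> R" "family_norm J \<le> R"
  shows "family_norm (quadratic_part F K - quadratic_part H J)
    \<le> 6 * R * family_norm (F - H) + 4 * R * family_norm (K - J)"
proof -
  have R0: "0 \<le> R" using R(1) family_norm_nonneg[of F] by linarith
  have prod: "family_norm A * family_norm B \<le> R * family_norm B" "family_norm B * family_norm A \<le> R * family_norm B"
    if "family_norm A \<le> R" for A B :: "real^'n^'n^'n"
    using mult_right_mono[OF that family_norm_nonneg[of B]] by (simp_all add: mult.commute)
  have pair: "family_norm (A + B) \<le> a + b" if "family_norm A \<le> a" "family_norm B \<le> b" for A B :: "real^'n^'n^'n" and a b
    using family_norm_triangle[of A B] that by linarith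
  let ?d = "R * family_norm (F - H)" and ?e = "R * family_norm (K - J)"
  note ct = order_trans[OF family_norm_cross_term] and rm = order_trans[OF family_norm_right_mult_own_rows]
    and lm = order_trans[OF family_norm_left_mult_own_rows]
  have "family_norm (cross_term (F - H) F + cross_term H (F - H)) \<le> ?d + ?d"
    by (intro pair ct prod R)
  moreover have "family_norm (cross_term (F - H) K + cross_term H (K - J)) \<le> ?d + ?e"
    by (intro pair ct prod R)
  moreover have "family_norm (cross_term (K - J) F + cross_term J (F - H)) \<le> ?e + ?d"
    by (intro pair ct prod R)
  moreover have "family_norm (right_mult (F - H) (own_rows K) + right_mult H (own_rows (K - J))) \<le> ?d + ?e"
    by (intro pair rm prod R)
  moreover have "family_norm (left_mult (transpose (own_rows K)) (F - H) + left_mult (transpose (own_rows (K - J))) H) \<le> ?d + ?e"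
    by (intro pair lm prod R)
  ultimately have "family_norm (quadratic_part F K - quadratic_part H J)
      \<le> (?d + ?d) + (?d + ?e) + (?e + ?d) + (?d + ?e) + (?d + ?e)"
    unfolding quadratic_part_diff
    by (intro order_trans[OF family_norm_triangle_five] add_mono)
  then show ?thesis by (simp add: algebra_simps)
qed

lemma best_response_field_diff:
  "best_response_field L \<kappa> \<delta> F K - best_response_field L \<kappa> \<delta> H J =
    \<kappa> *\<^sub>R (left_mult L (F - H) + right_mult (F - H) L) + (quadratic_part F K - quadratic_part H J)"
  unfolding best_response_field_def
  by (simp add: algebra_simps bounded_bilinear.diff_right[OF bounded_bilinear_left_mult]
    bounded_bilinear.diff_left[OF bounded_bilinear_right_mult])

lemma family_norm_field_diff:
  fixes F :: "real^'n^'n^'n"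
  assumes L: "matrix_bounded L l" "transpose L = L" and \<kappa>: "0 \<le> \<kappa>"
    and R: "family_norm F \<le> R" "family_norm K \<le> R" "family_norm H \<le> R" "family_norm J \<le> R"
  shows "family_norm (best_response_field L \<kappa> \<delta> F K - best_response_field L \<kappa> \<delta> H J)
    \<le> 4 * R * family_norm (K - J) + (2 * \<kappa> * l + 6 * R) * family_norm (F - H)"
proof -
  have "family_norm (\<kappa> *\<^sub>R (left_mult L (F - H) + right_mult (F - H) L)) \<le> \<kappa> * (2 * l * family_norm (F - H))"
    using family_norm_scaleR[of \<kappa> "left_mult L (F - H) + right_mult (F - H) L"]
      mult_left_mono[OF family_norm_drift[OF L, of "F - H"] \<kappa>] \<kappa> by simp
  then show ?thesis
    unfolding best_response_field_diff
    using family_norm_triangle[of "\<kappa> *\<^sub>R (left_mult L (F - H) + right_mult (F - H) L)" "quadratic_part F K - quadratic_part H J"]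
      family_norm_quadratic_part_diff[OF R]
    by (simp add: algebra_simps)
qed

section \<open>Symmetry of the vector field\<close>

lemma transpose_cross_term:
  assumes "symmetric_family H" "symmetric_family K"
  shows "transpose (cross_term H K $ i) = cross_term K H $ i"
  using assms by (simp add: cross_term_def matrix_transpose_mul matrix_mul_assoc symmetric_family_def)

lemma symmetric_quadratic_part:
  assumes "symmetric_family F" "symmetric_family K"
  shows "symmetric_family (quadratic_part F K)"
  unfolding symmetric_family_def
proof
  fix i
  have F: "transpose (F $ i) = F $ i" using assms by (simp add: symmetric_family_def)
  show "transpose (quadratic_part F K $ i) = quadratic_part F K $ i"
    by (simp add: quadratic_part_def transpose_simps transpose_cross_term assms right_mult_def left_mult_def
        matrix_transpose_mul F)
qed

lemma symmetric_laplacian_source: "transpose L = L \<Longrightarrow> symmetric_family (laplacian_source L)"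
  by (simp add: symmetric_family_def laplacian_source_def matrix_transpose_mul matrix_mul_assoc)

section \<open>Convergence of fictitious play\<close>

text \<open>Families are vectors of matrices, so that a system of matrix equations is one equation.\<close>

lemma has_vector_derivative_vecI:
  fixes X :: "real \<Rightarrow> real^'n^'n^'n"
  assumes "\<And>i. ((\<lambda>t. X t $ i) has_vector_derivative X' $ i) (at t within S)"
  shows "(X has_vector_derivative X') (at t within S)"
proof -
  have lin: "bounded_linear (axis i :: real^'n^'n \<Rightarrow> real^'n^'n^'n)" for i :: 'n
    unfolding linear_conv_bounded_linear[symmetric]
    by (rule linearI) (auto simp: axis_def vec_eq_iff)
  have rep: "(\<Sum>i\<in>UNIV. axis i (M $ i)) = M" for M :: "real^'n^'n^'n"
    by (simp add: vec_eq_iff axis_def)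
  have "((\<lambda>t. \<Sum>i\<in>UNIV. axis i (X t $ i)) has_vector_derivative (\<Sum>i\<in>UNIV. axis i (X' $ i))) (at t within S)"
    by (intro has_vector_derivative_sum bounded_linear.has_vector_derivative[OF lin] assms)
  then show ?thesis by (simp add: rep)
qed

lemma has_vector_derivative_vecD:
  assumes "(X has_vector_derivative X') (at t within S)"
  shows "((\<lambda>t. X t $ i) has_vector_derivative X' $ i) (at t within S)"
  using bounded_linear.has_vector_derivative[OF bounded_linear_vec_nth assms] .

text \<open>The norm need not be differentiable along the path, but each of its defining linear
  functionals is. The fundamental theorem of calculus bounds these one by one, and the supremum
  is taken before Gronwall's inequality is applied.\<close>

lemma family_norm_gronwall:
  fixes X :: "real \<Rightarrow> real^'n^'n^'n"
  assumes der: "\<And>t. t \<in> {0..T} \<Longrightarrow> (X has_vector_derivative X' t) (at t within {0..T})"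
    and bound: "\<And>t. t \<in> {0..T} \<Longrightarrow> family_norm (X' t) \<le> A + C * family_norm (X t)"
    and A: "0 \<le> A" and C: "0 \<le> C" and t: "t \<in> {0..T}"
  shows "family_norm (X t) \<le> (family_norm (X T) + T * A) * exp (C * (T - t))"
proof (rule gronwall_to_end[OF _ _ C t])
  have contX: "continuous_on {0..T} X"
    using der by (intro continuous_on_vector_derivative) auto
  show cont: "continuous_on {0..T} (\<lambda>t. family_norm (X t))"
    by (rule continuous_on_compose2[OF family_norm_continuous contX]) auto
  fix t assume t: "t \<in> {0..T}"
  have int: "(\<lambda>s. family_norm (X s)) integrable_on {t..T}"
    using t by (intro integrable_continuous_real continuous_on_subset[OF cont]) auto
  have int2: "((\<lambda>s. A + C * family_norm (X s)) has_integral (A * (T - t) + C * integral {t..T} (\<lambda>s. family_norm (X s)))) {t..T}"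
    using has_integral_add[OF has_integral_const_real[of A t T] has_integral_mult_right[OF integrable_integral[OF int], of C]] t
    by (simp add: mult_ac)
  have int_nonneg: "0 \<le> integral {t..T} (\<lambda>s. family_norm (X s))"
    by (rule integral_nonneg[OF int]) (rule family_norm_nonneg)
  show "family_norm (X t) \<le> family_norm (X T) + T * A + C * integral {t..T} (\<lambda>s. family_norm (X s))"
  proof (rule family_norm_leI)
    fix U :: "real^'n^'n" and z y :: "real^'n"
    assume *: "matrix_bounded U 1" "norm z \<le> 1" "norm y \<le> 1"
    let ?p = "family_pairing U z y"
    have test: "(U, z, y) \<in> family_tests" using * by (simp add: family_tests_def)
    have lin: "bounded_linear ?p" using family_pairing_linear by (simp add: linear_conv_bounded_linear)
    have "((\<lambda>s. - ?p (X' s)) has_integral (- ?p (X T) - - ?p (X t))) {t..T}"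
    proof (rule fundamental_theorem_of_calculus)
      show "t \<le> T" using t by simp
      fix s assume s: "s \<in> {t..T}"
      have "((\<lambda>s. ?p (X s)) has_vector_derivative ?p (X' s)) (at s within {0..T})"
        by (rule bounded_linear.has_vector_derivative[OF lin der]) (use s t in auto)
      then have "((\<lambda>s. ?p (X s)) has_vector_derivative ?p (X' s)) (at s within {t..T})"
        by (rule has_vector_derivative_within_subset) (use t in auto)
      then show "((\<lambda>s. - ?p (X s)) has_vector_derivative - ?p (X' s)) (at s within {t..T})"
        by (rule has_vector_derivative_minus)
    qed
    then have "- ?p (X T) - - ?p (X t) \<le> A * (T - t) + C * integral {t..T} (\<lambda>s. family_norm (X s))"
    proof (rule has_integral_le[OF _ int2])
      fix s assume s: "s \<in> {t..T}"
      have "?p (- X' s) \<le> family_norm (- X' s)" by (rule family_pairing_le_norm[OF test])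
      then have "- ?p (X' s) \<le> family_norm (X' s)"
        by (simp add: linear_neg[OF family_pairing_linear] family_norm_minus)
      also have "\<dots> \<le> A + C * family_norm (X s)" using s t by (intro bound) auto
      finally show "- ?p (X' s) \<le> A + C * family_norm (X s)" .
    qed
    moreover have "?p (X T) \<le> family_norm (X T)" by (rule family_pairing_le_norm[OF test])
    moreover have "A * (T - t) \<le> T * A" using A t by (simp add: algebra_simps)
    ultimately show "?p (X t) \<le> family_norm (X T) + T * A + C * integral {t..T} (\<lambda>s. family_norm (X s))"
      by linarith
  qed
qed

text \<open>Symmetry is included so that this closed convex set carries all that the best responses
  preserve.\<close>

definition invariant_families :: "(real^'n^'n^'n) set" where
  "invariant_families = {M. family_norm M \<le> 3 \<and> symmetric_family M}"

lemma invariant_families_closed: "closed (invariant_families :: (real^'n^'n^'n) set)"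
proof -
  have "closed {M :: real^'n^'n^'n. transpose (M $ i) = M $ i}" for i
    by (intro closed_Collect_eq continuous_intros
      continuous_on_compose2[OF linear_continuous_on[OF bounded_linear_transpose, of UNIV]]) auto
  moreover have "closed {M :: real^'n^'n^'n. family_norm M \<le> 3}"
    by (intro closed_Collect_le family_norm_continuous continuous_on_const)
  ultimately show ?thesis
    unfolding invariant_families_def symmetric_family_def by (intro closed_Collect_conj closed_Collect_all)
qed

lemma invariant_families_convex: "convex (invariant_families :: (real^'n^'n^'n) set)"
proof (rule convexI)
  fix M M' :: "real^'n^'n^'n" and u v :: real
  assume *: "M \<in> invariant_families" "M' \<in> invariant_families" "0 \<le> u" "0 \<le> v" "u + v = 1"
  have "family_norm (u *\<^sub>R M + v *\<^sub>R M') \<le> u * family_norm M + v * family_norm M'"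
    using family_norm_triangle[of "u *\<^sub>R M" "v *\<^sub>R M'"] family_norm_scaleR[of u M] family_norm_scaleR[of v M'] * by simp
  also have "\<dots> \<le> u * 3 + v * 3" using * by (intro add_mono mult_left_mono) (auto simp: invariant_families_def)
  finally have "family_norm (u *\<^sub>R M + v *\<^sub>R M') \<le> 3" using *(5) by (simp add: distrib_right[symmetric])
  then show "u *\<^sub>R M + v *\<^sub>R M' \<in> invariant_families"
    using *(1,2) by (simp add: invariant_families_def symmetric_family_def transpose_simps)
qed

lemma zero_in_invariant_families: "0 \<in> invariant_families"
  by (simp add: invariant_families_def symmetric_family_def transpose_def vec_eq_iff)

text \<open>The smallness conditions in terms of an upper bound \<open>l\<close> of the 2-norm of \<open>L\<close>.\<close>

locale small_horizon =
  fixes L :: "real^'n^'n" and l \<kappa> \<delta> c T :: real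
  assumes bounded_L: "matrix_bounded L l" and symmetric_L: "transpose L = L"
    and nonneg: "0 \<le> \<kappa>" "0 \<le> \<delta>" "0 \<le> c" "0 \<le> T"
    and small_drift: "2 * \<kappa> * l * T \<le> ln 2" and small_cost: "(c + T * \<delta>) * l\<^sup>2 \<le> 1" and small_T: "T \<le> 1/100"
begin

abbreviation field :: "real^'n^'n^'n \<Rightarrow> real^'n^'n^'n \<Rightarrow> real^'n^'n^'n" where
  "field \<equiv> best_response_field L \<kappa> \<delta>"

abbreviation drift :: "real^'n^'n^'n \<Rightarrow> real^'n^'n^'n" where
  "drift M \<equiv> left_mult L M + right_mult M L"

text \<open>The family \<open>X\<close> of simultaneous best responses to the feedback matrices \<open>K\<close>; a solution of
  the coupled Riccati system is a path that is a best response to itself.\<close>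

definition best_response_path :: "(real \<Rightarrow> real^'n^'n^'n) \<Rightarrow> (real \<Rightarrow> real^'n^'n^'n) \<Rightarrow> bool" where
  "best_response_path X K \<longleftrightarrow> X T = c *\<^sub>R laplacian_source L \<and>
    (\<forall>t\<in>{0..T}. symmetric_family (X t) \<and> (X has_vector_derivative field (X t) (K t)) (at t within {0..T}))"

lemma l_nonneg: "0 \<le> l" using bounded_L by (simp add: matrix_bounded_def)

text \<open>The growth factor of the linear part of the vector field over the whole horizon; the
  logarithm in the smallness condition is chosen to make it at most 2.\<close>

lemma exp_drift_le:
  assumes "t \<in> {0..T}"
  shows "exp (2 * \<kappa> * l * (T - t)) \<le> 2"
proof -
  have "2 * \<kappa> * l * (T - t) \<le> 2 * \<kappa> * l * T"
    using assms nonneg l_nonneg by (intro mult_left_mono) auto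
  also have "\<dots> \<le> ln 2" by (rule small_drift)
  finally have "exp (2 * \<kappa> * l * (T - t)) \<le> exp (ln 2)" by (rule iffD2[OF exp_le_cancel_iff])
  then show ?thesis by simp
qed

lemma drift_bound: "family_norm (\<kappa> *\<^sub>R drift M) \<le> 2 * \<kappa> * l * family_norm M"
  using family_norm_scaleR[of \<kappa> "drift M"]
    mult_left_mono[OF family_norm_drift[OF bounded_L symmetric_L, of M] nonneg(1)] nonneg by (simp add: mult_ac)

text \<open>With a quadratic part of size at most \<open>45 = 5 * 3\<^sup>2\<close>, Gronwall's inequality gives \<open>((c + T
  \<delta>) l\<^sup>2 + 45 T) * 2 \<le> (1 + 45/100) * 2 \<le> 3\<close>.\<close>

lemma family_norm_trapped:
  assumes T: "X T = c *\<^sub>R laplacian_source L"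
    and der: "\<And>t. t \<in> {0..T} \<Longrightarrow>
      (X has_vector_derivative (\<kappa> *\<^sub>R drift (X t) + Q t - \<delta> *\<^sub>R laplacian_source L)) (at t within {0..T})"
    and Q: "\<And>t. t \<in> {0..T} \<Longrightarrow> family_norm (Q t) \<le> 45"
    and t: "t \<in> {0..T}"
  shows "family_norm (X t) \<le> 3"
proof -
  have src: "family_norm (r *\<^sub>R laplacian_source L) \<le> r * l\<^sup>2" if "0 \<le> r" for r
    using family_norm_scaleR[of r "laplacian_source L"]
      mult_left_mono[OF family_norm_laplacian_source[OF bounded_L] that] that by simp
  have "family_norm (X t) \<le> (family_norm (X T) + T * (45 + \<delta> * l\<^sup>2)) * exp (2 * \<kappa> * l * (T - t))"
  proof (rule family_norm_gronwall[OF der _ _ _ t])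
    fix s assume s: "s \<in> {0..T}"
    show "family_norm (\<kappa> *\<^sub>R drift (X s) + Q s - \<delta> *\<^sub>R laplacian_source L)
      \<le> 45 + \<delta> * l\<^sup>2 + 2 * \<kappa> * l * family_norm (X s)"
      using family_norm_triangle_diff[of "\<kappa> *\<^sub>R drift (X s) + Q s" "\<delta> *\<^sub>R laplacian_source L"]
        family_norm_triangle[of "\<kappa> *\<^sub>R drift (X s)" "Q s"] Q[OF s] src[OF nonneg(2)] drift_bound[of "X s"]
      by linarith
  qed (use nonneg l_nonneg in auto)
  also have "\<dots> \<le> (c * l\<^sup>2 + T * (45 + \<delta> * l\<^sup>2)) * 2"
    using src[OF nonneg(3)] exp_drift_le[OF t] nonneg T family_norm_nonneg[of "X T"]
    by (intro mult_mono add_mono) auto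
  also have "\<dots> = ((c + T * \<delta>) * l\<^sup>2 + 45 * T) * 2" by (simp add: algebra_simps)
  also have "\<dots> \<le> 3" using small_cost small_T by simp
  finally show ?thesis .
qed

text \<open>The difference between the path and its transpose solves a linear homogeneous equation
  with terminal value zero.\<close>

lemma symmetric_path:
  assumes T: "symmetric_family (X T)"
    and der: "\<And>t. t \<in> {0..T} \<Longrightarrow> (X has_vector_derivative (\<kappa> *\<^sub>R drift (X t) + Q t)) (at t within {0..T})"
    and Q: "\<And>t. t \<in> {0..T} \<Longrightarrow> symmetric_family (Q t)"
    and t: "t \<in> {0..T}"
  shows "symmetric_family (X t)"
proof -
  define tr :: "real^'n^'n^'n \<Rightarrow> real^'n^'n^'n" where "tr = (\<lambda>M. \<chi> i. transpose (M $ i))"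
  have lin: "linear tr" by (rule linearI) (auto simp: tr_def transpose_simps vec_eq_iff transpose_def)
  then have blin: "bounded_linear tr" by (simp add: linear_conv_bounded_linear)
  have sym_iff: "symmetric_family M \<longleftrightarrow> tr M = M" for M
    by (auto simp: symmetric_family_def tr_def vec_eq_iff[where 'a="real^'n^'n"])
  define D where "D = (\<lambda>t. X t - tr (X t))"
  have tr_drift: "tr (drift M) = drift (tr M)" for M
    by (simp add: tr_def left_mult_def right_mult_def vec_eq_iff[where 'a="real^'n^'n"] transpose_simps
        matrix_transpose_mul symmetric_L add.commute)
  have "family_norm (D t) \<le> (family_norm (D T) + T * 0) * exp (2 * \<kappa> * l * (T - t))"
  proof (rule family_norm_gronwall[OF _ _ _ _ t])
    fix s assume s: "s \<in> {0..T}"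
    have "(D has_vector_derivative (\<kappa> *\<^sub>R drift (X s) + Q s) - tr (\<kappa> *\<^sub>R drift (X s) + Q s)) (at s within {0..T})"
      unfolding D_def
      by (intro has_vector_derivative_diff der s bounded_linear.has_vector_derivative[OF blin])
    moreover have "(\<kappa> *\<^sub>R drift (X s) + Q s) - tr (\<kappa> *\<^sub>R drift (X s) + Q s) = \<kappa> *\<^sub>R drift (D s)"
      using Q[OF s] unfolding sym_iff D_def linear_add[OF lin] linear_cmul[OF lin, of \<kappa>]
      by (simp only: tr_drift linear_add[OF lin, symmetric]) (simp add: algebra_simps
          bounded_bilinear.diff_right[OF bounded_bilinear_left_mult]
          bounded_bilinear.diff_left[OF bounded_bilinear_right_mult])
    ultimately show "(D has_vector_derivative \<kappa> *\<^sub>R drift (D s)) (at s within {0..T})" by simp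
    show "family_norm (\<kappa> *\<^sub>R drift (D s)) \<le> 0 + 2 * \<kappa> * l * family_norm (D s)"
      using drift_bound[of "D s"] by simp
  qed (use nonneg l_nonneg in auto)
  moreover have "D T = 0" using T by (simp add: D_def sym_iff)
  ultimately have "norm (D t) \<le> 0" using norm_le_family_norm[of "D t"] family_norm_nonneg[of "D t"] by simp
  then show ?thesis by (simp add: D_def sym_iff)
qed

text \<open>Composing the quadratic part with the projection onto the invariant set makes the vector
  field globally Lipschitz. The linear part is left as it is: only then does its contribution
  enter \<open>family_norm_trapped\<close> as an exponential factor, whereas its size on the ball of radius 3
  would be too large for that estimate. The solution never leaves the invariant set, so the
  projection does not act on it. The map \<open>Kf\<close> is a given path for fictitious play, and the
  identity for the coupled system.\<close>

lemma trapped_path_exists: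
  fixes Kf :: "real \<Rightarrow> real^'n^'n^'n \<Rightarrow> real^'n^'n^'n"
  assumes cont: "continuous_on ({0..T} \<times> invariant_families) (\<lambda>(t, M). Kf t M)"
    and inv: "\<And>t M. t \<in> {0..T} \<Longrightarrow> M \<in> invariant_families \<Longrightarrow> Kf t M \<in> invariant_families"
    and lip: "\<And>t M M'. t \<in> {0..T} \<Longrightarrow> M \<in> invariant_families \<Longrightarrow> M' \<in> invariant_families \<Longrightarrow>
      norm (Kf t M - Kf t M') \<le> norm (M - M')"
  shows "\<exists>X. best_response_path X (\<lambda>t. Kf t (X t)) \<and> (\<forall>t\<in>{0..T}. X t \<in> invariant_families)"
proof -
  let ?S = "invariant_families :: (real^'n^'n^'n) set"
  define \<pi> where "\<pi> = closest_point ?S"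
  have S: "closed ?S" "convex ?S" "?S \<noteq> {}"
    using invariant_families_closed invariant_families_convex zero_in_invariant_families by auto
  have \<pi>S: "\<pi> M \<in> ?S" for M unfolding \<pi>_def by (rule closest_point_in_set[OF S(1,3)])
  have \<pi>_id: "\<pi> M = M" if "M \<in> ?S" for M unfolding \<pi>_def by (rule closest_point_self[OF that])
  have \<pi>_lip: "norm (\<pi> M - \<pi> M') \<le> norm (M - M')" for M M'
    using closest_point_lipschitz[OF S(2,1,3), of M M'] by (simp add: \<pi>_def dist_norm)
  have \<pi>_cont: "continuous_on A \<pi>" for A unfolding \<pi>_def by (rule continuous_on_closest_point[OF S(2,1,3)])
  define Q where "Q = (\<lambda>t M. quadratic_part (\<pi> M) (Kf t (\<pi> M)))"
  define f where "f = (\<lambda>t M. \<kappa> *\<^sub>R drift M + Q t M - \<delta> *\<^sub>R laplacian_source L)"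
  obtain C where C: "C \<ge> 0" "\<And>M :: real^'n^'n^'n. family_norm M \<le> C * norm M"
    using family_norm_le_multiple_norm by blast
  define B where "B = real CARD('n) ^ 3 * ((2 * \<kappa> * l + 30) * C)"
  have "\<exists>X. X T = c *\<^sub>R laplacian_source L \<and>
     (\<forall>t\<in>{0..T}. (X has_vector_derivative f t (X t)) (at t within {0..T}))"
  proof (rule lipschitz_ode_terminal)
    show "0 \<le> T" by (rule nonneg)
    show "0 \<le> B" using C nonneg l_nonneg by (simp add: B_def)
    have K_cont: "continuous_on ({0..T} \<times> UNIV) (\<lambda>x. Kf (fst x) (\<pi> (snd x)))"
    proof -
      have "continuous_on ({0..T} \<times> UNIV) (\<lambda>x::real \<times> (real^'n^'n^'n). (fst x, \<pi> (snd x)))"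
        by (intro continuous_intros continuous_on_compose2[OF \<pi>_cont]) auto
      moreover have "(\<lambda>x. (fst x, \<pi> (snd x))) ` ({0..T} \<times> UNIV) \<subseteq> {0..T} \<times> invariant_families"
        by (rule image_subsetI) (simp add: mem_Times_iff \<pi>S)
      ultimately show ?thesis using continuous_on_compose2[OF cont] by fastforce
    qed
    note own_cont = bounded_linear.continuous_on[OF linear_own_rows[unfolded linear_conv_bounded_linear]]
    note tr_cont = bounded_linear.continuous_on[OF bounded_linear_transpose]
    show "continuous_on ({0..T} \<times> UNIV) (\<lambda>(t, M). f t M)"
      unfolding f_def Q_def quadratic_part_def case_prod_beta
      by (intro continuous_intros bounded_bilinear.continuous_on[OF bounded_bilinear_left_mult]
        bounded_bilinear.continuous_on[OF bounded_bilinear_right_mult]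
        bounded_bilinear.continuous_on[OF bounded_bilinear_cross_term]
        own_cont tr_cont K_cont continuous_on_compose2[OF \<pi>_cont]) auto
    fix t M M' assume t: "t \<in> {0..T}"
    have le3: "family_norm (\<pi> M) \<le> 3" "family_norm (Kf t (\<pi> M)) \<le> 3"
      "family_norm (\<pi> M') \<le> 3" "family_norm (Kf t (\<pi> M')) \<le> 3"
      using \<pi>S inv[OF t \<pi>S] by (auto simp: invariant_families_def)
    have eq: "f t M - f t M' = \<kappa> *\<^sub>R drift (M - M') + (Q t M - Q t M')"
      by (simp add: f_def algebra_simps bounded_bilinear.diff_right[OF bounded_bilinear_left_mult]
          bounded_bilinear.diff_left[OF bounded_bilinear_right_mult])
    have "family_norm (Q t M - Q t M') \<le> 6 * 3 * family_norm (\<pi> M - \<pi> M') + 4 * 3 * family_norm (Kf t (\<pi> M) - Kf t (\<pi> M'))"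
      unfolding Q_def by (rule family_norm_quadratic_part_diff[OF le3])
    also have "\<dots> \<le> 6 * 3 * (C * norm (M - M')) + 4 * 3 * (C * norm (M - M'))"
    proof (intro add_mono mult_left_mono)
      show "family_norm (\<pi> M - \<pi> M') \<le> C * norm (M - M')"
        using C(2)[of "\<pi> M - \<pi> M'"] mult_left_mono[OF \<pi>_lip C(1)] by (rule order_trans)
      have "norm (Kf t (\<pi> M) - Kf t (\<pi> M')) \<le> norm (M - M')"
        using lip[OF t \<pi>S \<pi>S] \<pi>_lip by (rule order_trans)
      then show "family_norm (Kf t (\<pi> M) - Kf t (\<pi> M')) \<le> C * norm (M - M')"
        using C(2)[of "Kf t (\<pi> M) - Kf t (\<pi> M')"] mult_left_mono[OF _ C(1)] by (meson order_trans)
    qed auto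
    finally have Qd: "family_norm (Q t M - Q t M') \<le> 30 * (C * norm (M - M'))" by simp
    have "family_norm (\<kappa> *\<^sub>R drift (M - M')) \<le> 2 * \<kappa> * l * (C * norm (M - M'))"
      using drift_bound[of "M - M'"] mult_left_mono[OF C(2)[of "M - M'"], of "2 * \<kappa> * l"] nonneg l_nonneg by simp
    with Qd have "family_norm (f t M - f t M') \<le> (2 * \<kappa> * l + 30) * C * norm (M - M')"
      unfolding eq using family_norm_triangle[of "\<kappa> *\<^sub>R drift (M - M')" "Q t M - Q t M'"] by (simp add: algebra_simps)
    then have "real CARD('n) ^ 3 * family_norm (f t M - f t M') \<le> real CARD('n) ^ 3 * ((2 * \<kappa> * l + 30) * C * norm (M - M'))"
      by (intro mult_left_mono) auto
    with norm_le_family_norm[of "f t M - f t M'"]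
    have "norm (f t M - f t M') \<le> real CARD('n) ^ 3 * ((2 * \<kappa> * l + 30) * C * norm (M - M'))"
      by (rule order_trans)
    then show "norm (f t M - f t M') \<le> B * norm (M - M')" by (simp add: B_def mult_ac)
  qed
  then obtain X where X: "X T = c *\<^sub>R laplacian_source L"
    "\<And>t. t \<in> {0..T} \<Longrightarrow> (X has_vector_derivative f t (X t)) (at t within {0..T})" by blast
  have inv3: "family_norm (\<pi> M) \<le> 3" "family_norm (Kf t (\<pi> M)) \<le> 3" if "t \<in> {0..T}" for t M
    using \<pi>S inv[OF that \<pi>S] by (auto simp: invariant_families_def)
  have Q45: "family_norm (Q t M) \<le> 45" if "t \<in> {0..T}" for t M
    unfolding Q_def using family_norm_quadratic_part[OF inv3[OF that, of M]] by simp
  have Qsym: "symmetric_family (Q t M)" if "t \<in> {0..T}" for t M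
    unfolding Q_def using \<pi>S inv[OF that \<pi>S] by (intro symmetric_quadratic_part) (auto simp: invariant_families_def)
  have srcsym: "symmetric_family (r *\<^sub>R laplacian_source L)" for r
    using symmetric_laplacian_source[OF symmetric_L] by (simp add: symmetric_family_def transpose_simps)
  have XS: "X t \<in> ?S" if t: "t \<in> {0..T}" for t
  proof -
    have "family_norm (X t) \<le> 3"
      by (rule family_norm_trapped[of X "\<lambda>s. Q s (X s)"]) (use X Q45 t in \<open>auto simp: f_def\<close>)
    moreover have "symmetric_family (X t)"
    proof (rule symmetric_path[of X "\<lambda>s. Q s (X s) - \<delta> *\<^sub>R laplacian_source L"])
      show "symmetric_family (X T)" unfolding X(1) by (rule srcsym)
      fix s assume s: "s \<in> {0..T}"
      show "(X has_vector_derivative \<kappa> *\<^sub>R drift (X s) + (Q s (X s) - \<delta> *\<^sub>R laplacian_source L)) (at s within {0..T})"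
        using X(2)[OF s] by (simp add: f_def algebra_simps)
      show "symmetric_family (Q s (X s) - \<delta> *\<^sub>R laplacian_source L)"
        using Qsym[OF s, of "X s"] srcsym[of \<delta>] by (simp add: symmetric_family_def transpose_simps)
    qed (rule t)
    ultimately show ?thesis by (simp add: invariant_families_def)
  qed
  have "f t (X t) = field (X t) (Kf t (X t))" if "t \<in> {0..T}" for t
    by (simp add: f_def Q_def best_response_field_def \<pi>_id[OF XS[OF that]])
  then show ?thesis
    using X XS by (intro exI[of _ X]) (auto simp: best_response_path_def invariant_families_def)
qed

lemma best_response_exists:
  assumes "continuous_on {0..T} K" "\<And>t. t \<in> {0..T} \<Longrightarrow> K t \<in> invariant_families"
  shows "\<exists>X. best_response_path X K \<and> (\<forall>t\<in>{0..T}. X t \<in> invariant_families)"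
  by (rule trapped_path_exists[of "\<lambda>t M. K t"])
    (use assms in \<open>auto simp: case_prod_beta intro!: continuous_on_compose2[OF assms(1)] continuous_intros\<close>)

lemma riccati_fixed_point_exists:
  "\<exists>G. best_response_path G G \<and> (\<forall>t\<in>{0..T}. G t \<in> invariant_families)"
  by (rule trapped_path_exists[of "\<lambda>t M. M"]) (auto simp: case_prod_beta intro!: continuous_intros)

lemma best_response_path_continuous: "best_response_path X K \<Longrightarrow> continuous_on {0..T} X"
  by (intro continuous_on_vector_derivative) (auto simp: best_response_path_def)

lemma best_response_stability:
  assumes X: "best_response_path X K" and Y: "best_response_path Y J"
    and R: "\<And>t. t \<in> {0..T} \<Longrightarrow> family_norm (X t) \<le> R \<and> family_norm (K t) \<le> R \<and> family_norm (Y t) \<le> R \<and> family_norm (J t) \<le> R"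
    and d: "\<And>t. t \<in> {0..T} \<Longrightarrow> family_norm (K t - J t) \<le> d"
    and t: "t \<in> {0..T}"
  shows "family_norm (X t - Y t) \<le> T * (4 * R * d) * exp ((2 * \<kappa> * l + 6 * R) * (T - t))"
proof -
  have R0: "0 \<le> R" using R[OF t] family_norm_nonneg[of "X t"] by linarith
  have d0: "0 \<le> d" using d[OF t] family_norm_nonneg[of "K t - J t"] by linarith
  have "family_norm (X t - Y t) \<le> (family_norm (X T - Y T) + T * (4 * R * d)) * exp ((2 * \<kappa> * l + 6 * R) * (T - t))"
  proof (rule family_norm_gronwall[OF _ _ _ _ t])
    fix s assume s: "s \<in> {0..T}"
    show "((\<lambda>s. X s - Y s) has_vector_derivative field (X s) (K s) - field (Y s) (J s)) (at s within {0..T})"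
      using X Y s by (intro has_vector_derivative_diff) (auto simp: best_response_path_def)
    have "family_norm (field (X s) (K s) - field (Y s) (J s)) \<le>
        4 * R * family_norm (K s - J s) + (2 * \<kappa> * l + 6 * R) * family_norm (X s - Y s)"
      using R[OF s] by (intro family_norm_field_diff bounded_L symmetric_L nonneg) auto
    also have "4 * R * family_norm (K s - J s) \<le> 4 * R * d" using d[OF s] R0 by (intro mult_left_mono) auto
    finally show "family_norm (field (X s) (K s) - field (Y s) (J s)) \<le>
        4 * R * d + (2 * \<kappa> * l + 6 * R) * family_norm (X s - Y s)" by simp
  qed (use R0 d0 nonneg l_nonneg in auto)
  then show ?thesis using X Y by (simp add: best_response_path_def)
qed

text \<open>Continuity on the compact interval bounds the three paths by some \<open>R\<close>, whatever its size,
  and \<open>best_response_stability\<close> then applies with \<open>d = 0\<close>.\<close>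

lemma best_response_unique:
  assumes X: "best_response_path X K" and Y: "best_response_path Y K" and K: "continuous_on {0..T} K"
    and t: "t \<in> {0..T}"
  shows "X t = Y t"
proof -
  have bd: "\<exists>R. \<forall>t\<in>{0..T}. family_norm (Z t) \<le> R" if "continuous_on {0..T} Z" for Z :: "real \<Rightarrow> real^'n^'n^'n"
  proof -
    have "compact ((\<lambda>t. family_norm (Z t)) ` {0..T})"
      by (intro compact_continuous_image continuous_on_compose2[OF family_norm_continuous that]) auto
    then have "bdd_above ((\<lambda>t. family_norm (Z t)) ` {0..T})"
      by (intro bounded_imp_bdd_above compact_imp_bounded)
    then show ?thesis by (auto simp: bdd_above_def)
  qed
  obtain R1 R2 R3 where "\<And>t. t \<in> {0..T} \<Longrightarrow> family_norm (X t) \<le> R1 \<and> family_norm (Y t) \<le> R2 \<and> family_norm (K t) \<le> R3"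
    using bd[OF best_response_path_continuous[OF X]] bd[OF best_response_path_continuous[OF Y]] bd[OF K] by metis
  then have "family_norm (X t - Y t) \<le> T * (4 * max R1 (max R2 R3) * 0) * exp ((2 * \<kappa> * l + 6 * max R1 (max R2 R3)) * (T - t))"
    by (intro best_response_stability[OF X Y _ _ t]) (auto simp: le_max_iff_disj)
  then have "norm (X t - Y t) \<le> 0"
    using norm_le_family_norm[of "X t - Y t"] family_norm_nonneg[of "X t - Y t"] by simp
  then show ?thesis by simp
qed

text \<open>The factor is \<open>12 T\<close> times an exponential that is at most \<open>2 * 3\<close>, hence at most
  \<open>72/100\<close>.\<close>

lemma best_response_contraction:
  assumes X: "best_response_path X K" and Y: "best_response_path Y J"
    and inv: "\<And>t. t \<in> {0..T} \<Longrightarrow> X t \<in> invariant_families \<and> K t \<in> invariant_families \<and> Y t \<in> invariant_families \<and> J t \<in> invariant_families"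
    and d: "\<And>t. t \<in> {0..T} \<Longrightarrow> family_norm (K t - J t) \<le> d"
    and t: "t \<in> {0..T}"
  shows "family_norm (X t - Y t) \<le> 18/25 * d"
proof -
  have d0: "0 \<le> d" using d[OF t] family_norm_nonneg[of "K t - J t"] by linarith
  have "family_norm (X t - Y t) \<le> T * (4 * 3 * d) * exp ((2 * \<kappa> * l + 6 * 3) * (T - t))"
    by (rule best_response_stability[OF X Y _ d t]) (use inv in \<open>auto simp: invariant_families_def\<close>)
  also have "\<dots> \<le> (1/100 * (4 * 3 * d)) * 6"
  proof (intro mult_mono)
    have "exp ((2 * \<kappa> * l + 6 * 3) * (T - t)) = exp (2 * \<kappa> * l * (T - t)) * exp (18 * (T - t))"
      by (simp add: exp_add[symmetric] algebra_simps)
    also have "\<dots> \<le> 2 * 3"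
    proof (intro mult_mono exp_drift_le t)
      have "exp (18 * (T - t)) \<le> exp 1" using small_T t by simp
      also have "\<dots> \<le> 3" by (rule exp_le)
      finally show "exp (18 * (T - t)) \<le> 3" .
    qed auto
    finally show "exp ((2 * \<kappa> * l + 6 * 3) * (T - t)) \<le> 6" by simp
  qed (use small_T d0 nonneg in auto)
  finally show ?thesis by simp
qed

text \<open>The comparison is with a fixed point that is already known to exist, so the iterates
  converge geometrically without a Cauchy argument.\<close>

theorem best_response_iteration_converges:
  assumes X0: "\<And>t. t \<in> {0..T} \<Longrightarrow> X 0 t = 0"
    and step: "\<And>k. best_response_path (X (Suc k)) (X k)"
    and G: "best_response_path G G" "\<And>t. t \<in> {0..T} \<Longrightarrow> G t \<in> invariant_families"
    and t: "t \<in> {0..T}"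
  shows "(\<lambda>k. X k t) \<longlonglongrightarrow> G t"
proof -
  have cont: "continuous_on {0..T} (X k)" for k
  proof (cases k)
    case 0
    have "continuous_on {0..T} (\<lambda>t. 0 :: real^'n^'n^'n)" by simp
    then show ?thesis using continuous_on_cong[of "{0..T}" "{0..T}" "X 0" "\<lambda>t. 0"] X0 0 by simp
  next
    case (Suc m)
    then show ?thesis using best_response_path_continuous[OF step[of m]] by simp
  qed
  have inv: "\<forall>t\<in>{0..T}. X k t \<in> invariant_families" for k
  proof (induction k)
    case 0
    then show ?case using X0 by (auto intro: zero_in_invariant_families)
  next
    case (Suc k)
    obtain Y where Y: "best_response_path Y (X k)" "\<forall>t\<in>{0..T}. Y t \<in> invariant_families"
      using best_response_exists[OF cont[of k]] Suc by blast
    then show ?case using best_response_unique[OF step[of k] Y(1) cont[of k]] by auto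
  qed
  have rate: "\<forall>t\<in>{0..T}. family_norm (X k t - G t) \<le> (18/25) ^ k * 3" for k
  proof (induction k)
    case 0
    then show ?case using X0 G(2) by (auto simp: invariant_families_def family_norm_minus)
  next
    case (Suc k)
    show ?case
    proof
      fix s assume s: "s \<in> {0..T}"
      have "family_norm (X (Suc k) s - G s) \<le> 18/25 * ((18/25) ^ k * 3)"
        by (rule best_response_contraction[OF step[of k] G(1) _ _ s]) (use inv G(2) Suc in auto)
      then show "family_norm (X (Suc k) s - G s) \<le> (18/25) ^ Suc k * 3" by simp
    qed
  qed
  have "(\<lambda>k. X k t - G t) \<longlonglongrightarrow> 0"
  proof (rule Lim_null_comparison)
    show "\<forall>\<^sub>F k in sequentially. norm (X k t - G t) \<le> real CARD('n) ^ 3 * ((18/25) ^ k * 3)"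
    proof (rule always_eventually, rule allI)
      fix k
      show "norm (X k t - G t) \<le> real CARD('n) ^ 3 * ((18/25) ^ k * 3)"
        using norm_le_family_norm[of "X k t - G t"] rate[of k] t
        by (meson mult_left_mono of_nat_0_le_iff order_trans zero_le_power)
    qed
    have "(\<lambda>k. real CARD('n) ^ 3 * ((18/25) ^ k * 3)) \<longlonglongrightarrow> real CARD('n) ^ 3 * (0 * 3)"
      by (intro tendsto_intros LIMSEQ_power_zero) auto
    then show "(\<lambda>k. real CARD('n) ^ 3 * ((18/25) ^ k * 3)) \<longlonglongrightarrow> 0" by simp
  qed
  then show ?thesis by (rule LIM_zero_cancel)
qed

end

section \<open>Matrix equations of the players\<close>

lemma sum_unit_dyad: "(\<Sum>j\<in>UNIV. unit_dyad j) = (mat 1 :: real^'n::finite^'n)"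
proof -
  have "(\<Sum>j\<in>UNIV. unit_dyad j $ r $ s) = (mat 1 :: real^'n^'n) $ r $ s" for r s
  proof -
    have "(\<Sum>j\<in>UNIV. unit_dyad j $ r $ s) = (\<Sum>j\<in>UNIV. if j = r then (if r = s then 1 else 0) else 0)"
      by (intro sum.cong) (auto simp: unit_dyad_nth)
    then show ?thesis by (simp add: mat_def)
  qed
  then show ?thesis by (simp add: vec_eq_iff)
qed

lemma best_response_field_nth:
  assumes "symmetric_family K"
  shows "best_response_field L \<kappa> \<delta> X K $ i =
    \<kappa> *\<^sub>R (L ** X $ i) + \<kappa> *\<^sub>R (X $ i ** L) + X $ i ** unit_dyad i ** X $ i
    - X $ i ** unit_dyad i ** K $ i - K $ i ** unit_dyad i ** X $ i
    + X $ i ** (\<Sum>j\<in>UNIV. unit_dyad j ** K $ j) + (\<Sum>j\<in>UNIV. K $ j ** unit_dyad j) ** X $ i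
    - \<delta> *\<^sub>R (L ** unit_dyad i ** L)"
  unfolding best_response_field_def quadratic_part_def transpose_own_rows_eq_sum[OF assms]
  by (simp add: left_mult_def right_mult_def cross_term_def laplacian_source_def
      own_rows_eq_sum algebra_simps)

lemma best_response_equation_iff:
  assumes "symmetric_family K"
  shows "F' - X $ i ** unit_dyad i ** X $ i + \<delta> *\<^sub>R (L ** unit_dyad i ** L)
     - \<kappa> *\<^sub>R (L ** X $ i) - \<kappa> *\<^sub>R (X $ i ** L)
     - X $ i ** (\<Sum>j\<in>UNIV - {i}. unit_dyad j ** K $ j)
     - (\<Sum>j\<in>UNIV - {i}. K $ j ** unit_dyad j ** X $ i) = 0
   \<longleftrightarrow> F' = best_response_field L \<kappa> \<delta> X K $ i"
proof -
  have e1: "X $ i ** (\<Sum>j\<in>UNIV - {i}. unit_dyad j ** K $ j)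
      = X $ i ** (\<Sum>j\<in>UNIV. unit_dyad j ** K $ j) - X $ i ** unit_dyad i ** K $ i"
    by (simp add: sum_diff1 matrix_mult_simps matrix_mul_assoc)
  have e2: "(\<Sum>j\<in>UNIV - {i}. K $ j ** unit_dyad j ** X $ i)
      = (\<Sum>j\<in>UNIV. K $ j ** unit_dyad j) ** X $ i - K $ i ** unit_dyad i ** X $ i"
    by (simp add: sum_diff1 bounded_bilinear.sum_left[OF bounded_bilinear_matrix_mult])
  show ?thesis
    unfolding best_response_field_nth[OF assms] e1 e2 by (auto simp: algebra_simps)
qed

lemma riccati_equation_iff:
  assumes "symmetric_family X"
  shows "F' + (\<Sum>j\<in>UNIV. (- (\<kappa> *\<^sub>R L) - X $ j) ** unit_dyad j ** X $ i)
     + (\<Sum>j\<in>UNIV. X $ i ** unit_dyad j ** (- (\<kappa> *\<^sub>R L) - X $ j))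
     + \<delta> *\<^sub>R (L ** unit_dyad i ** L) + X $ i ** unit_dyad i ** X $ i = 0
   \<longleftrightarrow> F' = best_response_field L \<kappa> \<delta> X X $ i"
proof -
  have e1: "(\<Sum>j\<in>UNIV. (- (\<kappa> *\<^sub>R L) - X $ j) ** unit_dyad j ** X $ i)
      = - (\<kappa> *\<^sub>R (L ** X $ i)) - (\<Sum>j\<in>UNIV. X $ j ** unit_dyad j) ** X $ i"
  proof -
    have "(\<Sum>j\<in>UNIV. (\<kappa> *\<^sub>R L) ** unit_dyad j ** X $ i) = (\<kappa> *\<^sub>R L) ** (\<Sum>j\<in>UNIV. unit_dyad j) ** X $ i"
      by (simp only: bounded_bilinear.sum_left[OF bounded_bilinear_matrix_mult]
        bounded_bilinear.sum_right[OF bounded_bilinear_matrix_mult])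
    then show ?thesis
      by (simp add: sum_unit_dyad matrix_mult_simps sum_subtractf sum_negf
        bounded_bilinear.sum_left[OF bounded_bilinear_matrix_mult])
  qed
  have e2: "(\<Sum>j\<in>UNIV. X $ i ** unit_dyad j ** (- (\<kappa> *\<^sub>R L) - X $ j))
      = - (\<kappa> *\<^sub>R (X $ i ** L)) - X $ i ** (\<Sum>j\<in>UNIV. unit_dyad j ** X $ j)"
  proof -
    have "(\<Sum>j\<in>UNIV. X $ i ** unit_dyad j ** (\<kappa> *\<^sub>R L)) = X $ i ** (\<Sum>j\<in>UNIV. unit_dyad j) ** (\<kappa> *\<^sub>R L)"
      by (simp only: bounded_bilinear.sum_left[OF bounded_bilinear_matrix_mult]
        bounded_bilinear.sum_right[OF bounded_bilinear_matrix_mult])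
    then show ?thesis
      by (simp add: sum_unit_dyad matrix_mult_simps sum_subtractf sum_negf matrix_mul_assoc
        bounded_bilinear.sum_right[OF bounded_bilinear_matrix_mult])
  qed
  show ?thesis
    unfolding best_response_field_nth[OF assms] e1 e2 by (auto simp: algebra_simps)
qed

lemma (in small_horizon) fictitious_play_best_response:
  assumes F: "fictitious_play_from_zero L T a q \<epsilon> c F" and eq: "\<kappa> = a + q" "\<delta> = \<epsilon> - q\<^sup>2"
  shows "best_response_path (\<lambda>t. \<chi> i. F i (Suc k) t) (\<lambda>t. \<chi> i. F i k t)"
proof -
  have fp: "fictitious_play L T a q \<epsilon> c F" and zero: "\<And>i t. t \<in> {0..T} \<Longrightarrow> F i 0 t = 0"
    using F by (auto simp: fictitious_play_from_zero_def)
  have sym: "symmetric_family (\<chi> i. F i k t)" if "t \<in> {0..T}" for k t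
  proof (cases k)
    case 0
    then show ?thesis using zero[OF that] by (simp add: symmetric_family_def transpose_def vec_eq_iff)
  next
    case (Suc m)
    then show ?thesis using fp that by (simp add: symmetric_family_def fictitious_play_def)
  qed
  show ?thesis
    unfolding best_response_path_def
  proof (intro conjI ballI)
    show "(\<chi> i. F i (Suc k) T) = c *\<^sub>R laplacian_source L"
      using fp by (simp add: fictitious_play_def laplacian_source_def vec_eq_iff)
    fix t assume t: "t \<in> {0..T}"
    show "symmetric_family (\<chi> i. F i (Suc k) t)" by (rule sym[OF t])
    show "((\<lambda>t. \<chi> i. F i (Suc k) t) has_vector_derivative field (\<chi> i. F i (Suc k) t) (\<chi> i. F i k t)) (at t within {0..T})"
    proof (rule has_vector_derivative_vecI)
      fix i
      obtain F' where F': "(F i (Suc k) has_vector_derivative F') (at t within {0..T})"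
        "F' - F i (Suc k) t ** unit_dyad i ** F i (Suc k) t
             + (\<epsilon> - q\<^sup>2) *\<^sub>R (L ** unit_dyad i ** L)
             - (a + q) *\<^sub>R (L ** F i (Suc k) t)
             - (a + q) *\<^sub>R (F i (Suc k) t ** L)
             - F i (Suc k) t ** (\<Sum>j\<in>UNIV - {i}. unit_dyad j ** F j k t)
             - (\<Sum>j\<in>UNIV - {i}. F j k t ** unit_dyad j ** F i (Suc k) t) = 0"
        using fp t unfolding fictitious_play_def by blast
      have "F' = field (\<chi> i. F i (Suc k) t) (\<chi> i. F i k t) $ i"
        using F'(2) best_response_equation_iff[OF sym[OF t, of k], of F' "\<chi> i. F i (Suc k) t" i \<delta> L \<kappa>]
        by (simp add: eq)
      with F'(1) show "((\<lambda>t. (\<chi> i. F i (Suc k) t) $ i) has_vector_derivative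
          field (\<chi> i. F i (Suc k) t) (\<chi> i. F i k t) $ i) (at t within {0..T})" by simp
    qed
  qed
qed

lemma (in small_horizon) fictitious_play_exists:
  assumes eq: "\<kappa> = a + q" "\<delta> = \<epsilon> - q\<^sup>2"
  shows "\<exists>F. fictitious_play_from_zero L T a q \<epsilon> c F"
proof -
  \<comment> \<open>Only the zeroth stage is prescribed; the conjunct for \<open>k = 0\<close> carries this through the
    choice of the sequence.\<close>
  let ?P = "\<lambda>k (X :: real \<Rightarrow> real^'n^'n^'n). continuous_on {0..T} X \<and> (\<forall>t\<in>{0..T}. X t \<in> invariant_families) \<and> (k = 0 \<longrightarrow> X = (\<lambda>t. 0))"
  have "\<exists>X. \<forall>k. ?P k (X k) \<and> best_response_path (X (Suc k)) (X k)"
  proof (rule dependent_nat_choice)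
    show "\<exists>X. ?P 0 X" by (intro exI[of _ "\<lambda>t. 0"]) (auto intro: zero_in_invariant_families)
    fix X :: "real \<Rightarrow> real^'n^'n^'n" and k :: nat
    assume "?P k X"
    then obtain Y where "best_response_path Y X" "\<forall>t\<in>{0..T}. Y t \<in> invariant_families"
      using best_response_exists[of X] by blast
    then show "\<exists>Y. ?P (Suc k) Y \<and> best_response_path Y X"
      using best_response_path_continuous by blast
  qed
  then obtain X where X: "\<And>k. ?P k (X k)" "\<And>k. best_response_path (X (Suc k)) (X k)" by blast
  have "fictitious_play_from_zero L T a q \<epsilon> c (\<lambda>i k t. X k t $ i)"
    unfolding fictitious_play_from_zero_def fictitious_play_def
  proof (intro conjI allI ballI)
    fix i t
    show "X 0 t $ i = 0" using X(1)[of 0] by simp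
  next
    fix k i
    show "X (Suc k) T $ i = c *\<^sub>R (L ** unit_dyad i ** L)"
      using X(2)[of k] by (simp add: best_response_path_def laplacian_source_def)
    fix t assume t: "t \<in> {0..T}"
    show "transpose (X (Suc k) t $ i) = X (Suc k) t $ i"
      using X(1)[of "Suc k"] t by (simp add: invariant_families_def symmetric_family_def)
    have "symmetric_family (X k t)" using X(1)[of k] t by (simp add: invariant_families_def)
    from best_response_equation_iff[OF this, of "field (X (Suc k) t) (X k t) $ i" "X (Suc k) t" i \<delta> L \<kappa>]
    have "field (X (Suc k) t) (X k t) $ i - X (Suc k) t $ i ** unit_dyad i ** X (Suc k) t $ i
             + (\<epsilon> - q\<^sup>2) *\<^sub>R (L ** unit_dyad i ** L)
             - (a + q) *\<^sub>R (L ** X (Suc k) t $ i)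
             - (a + q) *\<^sub>R (X (Suc k) t $ i ** L)
             - X (Suc k) t $ i ** (\<Sum>j\<in>UNIV - {i}. unit_dyad j ** X k t $ j)
             - (\<Sum>j\<in>UNIV - {i}. X k t $ j ** unit_dyad j ** X (Suc k) t $ i) = 0"
      by (simp add: eq)
    moreover have "((\<lambda>t. X (Suc k) t $ i) has_vector_derivative field (X (Suc k) t) (X k t) $ i) (at t within {0..T})"
      using X(2)[of k] t by (intro has_vector_derivative_vecD) (simp add: best_response_path_def)
    ultimately show "\<exists>F'. ((\<lambda>t. X (Suc k) t $ i) has_vector_derivative F') (at t within {0..T}) \<and>
          F' - X (Suc k) t $ i ** unit_dyad i ** X (Suc k) t $ i
             + (\<epsilon> - q\<^sup>2) *\<^sub>R (L ** unit_dyad i ** L)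
             - (a + q) *\<^sub>R (L ** X (Suc k) t $ i)
             - (a + q) *\<^sub>R (X (Suc k) t $ i ** L)
             - X (Suc k) t $ i ** (\<Sum>j\<in>UNIV - {i}. unit_dyad j ** X k t $ j)
             - (\<Sum>j\<in>UNIV - {i}. X k t $ j ** unit_dyad j ** X (Suc k) t $ i) = 0"
      by blast
  qed
  then show ?thesis by blast
qed

lemma (in small_horizon) riccati_system_of_fixed_point:
  assumes G: "best_response_path G G" and eq: "\<kappa> = a + q" "\<delta> = \<epsilon> - q\<^sup>2"
  shows "riccati_system L T a q \<epsilon> c (\<lambda>i t. G t $ i)"
  unfolding riccati_system_def
proof (intro allI conjI ballI)
  fix i
  show "G T $ i = c *\<^sub>R (L ** unit_dyad i ** L)"
    using G by (simp add: best_response_path_def laplacian_source_def)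
  fix t assume t: "t \<in> {0..T}"
  have sym: "symmetric_family (G t)" using G t by (simp add: best_response_path_def)
  then show "transpose (G t $ i) = G t $ i" by (simp add: symmetric_family_def)
  have "((\<lambda>t. G t $ i) has_vector_derivative field (G t) (G t) $ i) (at t within {0..T})"
    using G t by (intro has_vector_derivative_vecD) (simp add: best_response_path_def)
  with riccati_equation_iff[OF sym, of "field (G t) (G t) $ i" \<kappa> L i \<delta>]
  show "\<exists>F'. ((\<lambda>t. G t $ i) has_vector_derivative F') (at t within {0..T}) \<and>
          F' + (\<Sum>j\<in>UNIV. (- ((a + q) *\<^sub>R L) - G t $ j) ** unit_dyad j ** G t $ i)
             + (\<Sum>j\<in>UNIV. G t $ i ** unit_dyad j ** (- ((a + q) *\<^sub>R L) - G t $ j))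
             + (\<epsilon> - q\<^sup>2) *\<^sub>R (L ** unit_dyad i ** L)
             + G t $ i ** unit_dyad i ** G t $ i = 0"
    by (auto simp: eq)
qed

section \<open>Primitives of integrable functions\<close>

text \<open>Absolute continuity on \<open>{0..T}\<close>. A control is only square integrable in time, so the
  states that it produces need not be differentiable at any given time.\<close>

definition primitive_on :: "real \<Rightarrow> (real \<Rightarrow> 'a::euclidean_space) \<Rightarrow> (real \<Rightarrow> 'a) \<Rightarrow> bool" where
  "primitive_on T f f' \<longleftrightarrow> set_integrable lborel {0..T} f' \<and>
     (\<forall>t\<in>{0..T}. f t = f 0 + (LINT s:{0..t}|lborel. f' s))"

lemma primitive_on_derivative:
  fixes f :: "real \<Rightarrow> 'a::euclidean_space"
  assumes der: "\<And>t. t \<in> {0..T} \<Longrightarrow> (f has_vector_derivative f' t) (at t within {0..T})"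
    and cont: "continuous_on {0..T} f'"
  shows "primitive_on T f f'"
  unfolding primitive_on_def
proof (intro conjI ballI)
  show "set_integrable lborel {0..T} f'" by (rule borel_integrable_atLeastAtMost'[OF cont])
  fix t assume t: "t \<in> {0..T}"
  have "(f' has_integral (f t - f 0)) {0..t}"
    using t by (intro fundamental_theorem_of_calculus has_vector_derivative_within_subset[OF der]) auto
  moreover have "set_integrable lborel {0..t} f'"
    using t by (intro borel_integrable_atLeastAtMost' continuous_on_subset[OF cont]) auto
  ultimately show "f t = f 0 + (LINT s:{0..t}|lborel. f' s)"
    by (simp add: set_borel_integral_eq_integral integral_unique)
qed

lemma borel_measurable_bounded_bilinear:
  fixes prod :: "'a::euclidean_space \<Rightarrow> 'b::euclidean_space \<Rightarrow> 'c::euclidean_space"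
  assumes bil: "bounded_bilinear prod" and u: "u \<in> borel_measurable N" and v: "v \<in> borel_measurable N"
  shows "(\<lambda>x. prod (u x) (v x)) \<in> borel_measurable N"
proof -
  have "continuous_on UNIV (\<lambda>p. prod (fst p) (snd p))"
    by (rule bounded_bilinear.continuous_on[OF bil continuous_on_fst[OF continuous_on_id] continuous_on_snd[OF continuous_on_id]])
  then show ?thesis by (rule borel_measurable_continuous_Pair[OF u v])
qed

lemma set_integrable_bilinear_continuous:
  fixes prod :: "'a::euclidean_space \<Rightarrow> 'b::euclidean_space \<Rightarrow> 'c::euclidean_space"
  assumes bil: "bounded_bilinear prod" and f: "set_integrable lborel {0..T::real} f" and h: "continuous_on {0..T} h"
  shows "set_integrable lborel {0..T} (\<lambda>s. prod (f s) (h s))"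
proof -
  obtain K where K: "0 < K" "\<And>a b. norm (prod a b) \<le> norm a * norm b * K"
    using bounded_bilinear.pos_bounded[OF bil] by blast
  obtain H where H: "\<And>s. s \<in> {0..T} \<Longrightarrow> norm (h s) \<le> H"
    using compact_imp_bounded[OF compact_continuous_image[OF h compact_Icc]] unfolding bounded_iff by blast
  define fi where "fi = (\<lambda>s. indicator {0..T} s *\<^sub>R f s)"
  define hi where "hi = (\<lambda>s. indicator {0..T} s *\<^sub>R h s)"
  have fi: "integrable lborel fi" using f by (simp add: set_integrable_def fi_def)
  have hi: "hi \<in> borel_measurable lborel"
    using borel_measurable_continuous_on_indicator[OF _ h] by (simp add: hi_def)
  have eq: "indicator {0..T} s *\<^sub>R prod (f s) (h s) = prod (fi s) (hi s)" for s
    by (simp add: fi_def hi_def bounded_bilinear.scaleR_left[OF bil] bounded_bilinear.scaleR_right[OF bil] indicator_def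
      bounded_bilinear.zero_left[OF bil])
  have "integrable lborel (\<lambda>s. prod (fi s) (hi s))"
  proof (rule Bochner_Integration.integrable_bound)
    show "integrable lborel (\<lambda>s. K * max H 0 * norm (fi s))" using fi by simp
    show "(\<lambda>s. prod (fi s) (hi s)) \<in> borel_measurable lborel"
      using fi hi by (intro borel_measurable_bounded_bilinear[OF bil]) auto
    show "AE s in lborel. norm (prod (fi s) (hi s)) \<le> norm (K * max H 0 * norm (fi s))"
    proof (rule AE_I2)
      fix s
      have "norm (hi s) \<le> max H 0" using H[of s] by (auto simp: hi_def indicator_def le_max_iff_disj)
      then have "norm (fi s) * norm (hi s) * K \<le> norm (fi s) * max H 0 * K"
        using K(1) by (intro mult_right_mono mult_left_mono) auto
      with K(2)[of "fi s" "hi s"] have "norm (prod (fi s) (hi s)) \<le> norm (fi s) * max H 0 * K" by linarith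
      also have "\<dots> \<le> norm (K * max H 0 * norm (fi s))" using K(1) by (simp add: mult_ac abs_mult)
      finally show "norm (prod (fi s) (hi s)) \<le> norm (K * max H 0 * norm (fi s))" .
    qed
  qed
  then show ?thesis by (simp add: set_integrable_def eq)
qed

lemma primitive_on_continuous:
  assumes "primitive_on T f f'"
  shows "continuous_on {0..T} f"
proof -
  have int: "f' integrable_on {0..T}" and "set_integrable lborel {0..T} f'"
    using assms set_borel_integral_eq_integral(1) by (auto simp: primitive_on_def)
  have eq: "f t = f 0 + integral {0..t} f'" if "t \<in> {0..T}" for t
  proof -
    have "set_integrable lborel {0..t} f'"
      using \<open>set_integrable lborel {0..T} f'\<close> by (rule set_integrable_subset) (use that in auto)
    moreover have "f t = f 0 + (LINT s:{0..t}|lborel. f' s)"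
      using assms that unfolding primitive_on_def by blast
    ultimately show ?thesis by (simp only: set_borel_integral_eq_integral(2))
  qed
  have "continuous_on {0..T} (\<lambda>t. f 0 + integral {0..t} f')"
    by (intro continuous_intros indefinite_integral_continuous_1 int)
  then show ?thesis by (rule continuous_on_eq) (rule eq[symmetric])
qed

text \<open>The product rule. By Fubini's theorem the integral of \<open>prod (f' s) (g' r)\<close> over the square
  \<open>{0..t} \<times> {0..t}\<close> is \<open>prod (f t - f 0) (g t - g 0)\<close>; the two triangles below and above the
  diagonal give the two terms of the product rule.\<close>

lemma primitive_on_bilinear:
  fixes prod :: "'a::euclidean_space \<Rightarrow> 'b::euclidean_space \<Rightarrow> 'c::euclidean_space"
  assumes bil: "bounded_bilinear prod" and f: "primitive_on T f f'" and g: "primitive_on T g g'"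
  shows "primitive_on T (\<lambda>t. prod (f t) (g t)) (\<lambda>t. prod (f' t) (g t) + prod (f t) (g' t))"
  unfolding primitive_on_def
proof (intro conjI ballI)
  have f': "set_integrable lborel {0..T} f'" and g': "set_integrable lborel {0..T} g'"
    using f g by (auto simp: primitive_on_def)
  have fg: "set_integrable lborel {0..T} (\<lambda>t. prod (f' t) (g t))" "set_integrable lborel {0..T} (\<lambda>t. prod (f t) (g' t))"
    using set_integrable_bilinear_continuous[OF bil f' primitive_on_continuous[OF g]]
      set_integrable_bilinear_continuous[OF bounded_bilinear.flip[OF bil] g' primitive_on_continuous[OF f]]
    by auto
  show "set_integrable lborel {0..T} (\<lambda>t. prod (f' t) (g t) + prod (f t) (g' t))"
    using fg by (rule set_integral_add(1))
  fix t assume t: "t \<in> {0..T}"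
  define fi where "fi = (\<lambda>s. indicator {0..t} s *\<^sub>R f' s)"
  define gi where "gi = (\<lambda>s. indicator {0..t} s *\<^sub>R g' s)"
  have sub: "set_integrable lborel {0..s} f'" "set_integrable lborel {0..s} g'" if "s \<le> t" for s
    by (rule set_integrable_subset[OF f'], use t that in auto) (rule set_integrable_subset[OF g'], use t that in auto)
  have fi: "integrable lborel fi" and gi: "integrable lborel gi"
    using sub[of t] by (simp_all add: set_integrable_def fi_def gi_def)
  have [measurable]: "fi \<in> borel_measurable lborel" "gi \<in> borel_measurable lborel"
    using borel_measurable_integrable[OF fi] borel_measurable_integrable[OF gi] by simp_all
  have prod_meas: "(\<lambda>x. prod (u x) (v x)) \<in> borel_measurable N"
    if "u \<in> borel_measurable N" "v \<in> borel_measurable N" for u :: "'z \<Rightarrow> 'a" and v :: "'z \<Rightarrow> 'b" and N :: "'z measure"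
    using that by (rule borel_measurable_bounded_bilinear[OF bil])
  obtain K where K: "0 < K" "\<And>a b. norm (prod a b) \<le> norm a * norm b * K"
    using bounded_bilinear.pos_bounded[OF bil] by blast
  define h where "h = (\<lambda>(s, r). prod (fi s) (gi r))"
  have h_meas [measurable]: "h \<in> borel_measurable (lborel \<Otimes>\<^sub>M lborel)"
    unfolding h_def case_prod_beta by (intro prod_meas) measurable
  have int_right: "(LINT r|lborel. prod a (v r)) = prod a (LINT r|lborel. v r)" if "integrable lborel v" for a v
    using integral_bounded_linear[OF bounded_bilinear.bounded_linear_right[OF bil] that] .
  have int_left: "(LINT s|lborel. prod (u s) b) = prod (LINT s|lborel. u s) b" if "integrable lborel u" for u b
    using integral_bounded_linear[OF bounded_bilinear.bounded_linear_left[OF bil] that] .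
  have h_int: "integrable (lborel \<Otimes>\<^sub>M lborel) h"
  proof (rule Bochner_Integration.integrable_bound)
    show "integrable (lborel \<Otimes>\<^sub>M lborel) (\<lambda>(s, r). norm (fi s) * norm (gi r) * K)"
    proof (rule lborel_pair.Fubini_integrable)
      show "integrable lborel (\<lambda>s. LINT r|lborel. norm (case (s, r) of (s, r) \<Rightarrow> norm (fi s) * norm (gi r) * K))"
        using fi gi K(1) by (simp add: abs_mult)
    qed (use gi in auto)
    show "AE x in lborel \<Otimes>\<^sub>M lborel. norm (h x) \<le> norm (case x of (s, r) \<Rightarrow> norm (fi s) * norm (gi r) * K)"
      using K by (intro AE_I2) (auto simp: h_def abs_mult)
  qed (rule h_meas)
  define h1 where "h1 = (\<lambda>x. indicator {x. snd x \<le> fst x} x *\<^sub>R h x)"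
  define h2 where "h2 = (\<lambda>x. indicator {x. fst x < snd x} x *\<^sub>R h x)"
  have sets: "{x::real \<times> real. snd x \<le> fst x} \<in> sets (lborel \<Otimes>\<^sub>M lborel)"
    "{x::real \<times> real. fst x < snd x} \<in> sets (lborel \<Otimes>\<^sub>M lborel)"
  proof -
    have "{x\<in>space (lborel \<Otimes>\<^sub>M lborel). snd x \<le> fst x} \<in> sets (lborel \<Otimes>\<^sub>M (lborel :: real measure))"
      "{x\<in>space (lborel \<Otimes>\<^sub>M lborel). fst x < snd x} \<in> sets (lborel \<Otimes>\<^sub>M (lborel :: real measure))"
      by measurable
    then show "{x::real \<times> real. snd x \<le> fst x} \<in> sets (lborel \<Otimes>\<^sub>M lborel)"
      "{x::real \<times> real. fst x < snd x} \<in> sets (lborel \<Otimes>\<^sub>M lborel)"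
      by (simp_all add: space_pair_measure)
  qed
  have h12: "integrable (lborel \<Otimes>\<^sub>M lborel) h1" "integrable (lborel \<Otimes>\<^sub>M lborel) h2"
    unfolding h1_def h2_def
    by (rule integrable_mult_indicator[OF sets(1) h_int], rule integrable_mult_indicator[OF sets(2) h_int])
  have start: "f s = f 0 + (LINT r|lborel. indicator {0..s} r *\<^sub>R f' r)"
    "g s = g 0 + (LINT r|lborel. indicator {0..s} r *\<^sub>R g' r)" if "s \<in> {0..T}" for s
    using f g that unfolding primitive_on_def set_lebesgue_integral_def by blast+
  have total: "integral\<^sup>L (lborel \<Otimes>\<^sub>M lborel) h = prod (f t - f 0) (g t - g 0)"
  proof -
    have "integral\<^sup>L (lborel \<Otimes>\<^sub>M lborel) h = (LINT s|lborel. LINT r|lborel. h (s, r))"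
      by (rule lborel_pair.integral_fst'[OF h_int, symmetric])
    also have "\<dots> = (LINT s|lborel. prod (fi s) (g t - g 0))"
      unfolding h_def using start(2)[OF t] by (simp add: int_right[OF gi]) (simp add: gi_def)
    also have "\<dots> = prod (f t - f 0) (g t - g 0)"
      using start(1)[OF t] by (simp add: int_left[OF fi]) (simp add: fi_def)
    finally show ?thesis .
  qed
  have part1: "integral\<^sup>L (lborel \<Otimes>\<^sub>M lborel) h1 = (LINT s:{0..t}|lborel. prod (f' s) (g s - g 0))"
  proof -
    have "(LINT r|lborel. h1 (s, r)) = indicator {0..t} s *\<^sub>R prod (f' s) (g s - g 0)" for s
    proof (cases "s \<in> {0..t}")
      case True
      have "(LINT r|lborel. h1 (s, r)) = (LINT r|lborel. prod (fi s) (indicator {0..s} r *\<^sub>R g' r))"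
      proof (rule Bochner_Integration.integral_cong[OF refl])
        fix r
        show "h1 (s, r) = prod (fi s) (indicator {0..s} r *\<^sub>R g' r)"
        proof -
          have "indicator {x. snd x \<le> fst x} (s, r) * indicator {0..t} r = (indicator {0..s} r :: real)"
            using True by (auto split: split_indicator)
          then show ?thesis
            by (simp add: h1_def h_def gi_def bounded_bilinear.scaleR_right[OF bil])
        qed
      qed
      also have "\<dots> = prod (fi s) (g s - g 0)"
        using start(2)[of s] True t sub(2)[of s] by (subst int_right) (auto simp: set_integrable_def)
      finally show ?thesis using True by (simp add: fi_def)
    next
      case False
      then show ?thesis by (simp add: h1_def h_def fi_def bounded_bilinear.zero_left[OF bil])
    qed
    then show ?thesis
      using lborel_pair.integral_fst'[OF h12(1)] by (simp add: set_lebesgue_integral_def)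
  qed
  have part2: "integral\<^sup>L (lborel \<Otimes>\<^sub>M lborel) h2 = (LINT r:{0..t}|lborel. prod (f r - f 0) (g' r))"
  proof -
    have "(LINT s|lborel. h2 (s, r)) = indicator {0..t} r *\<^sub>R prod (f r - f 0) (g' r)" for r
    proof (cases "r \<in> {0..t}")
      case True
      have "(LINT s|lborel. h2 (s, r)) = (LINT s|lborel. prod (indicator {0..r} s *\<^sub>R f' s) (gi r))"
      proof (rule integral_cong_AE)
        show "(\<lambda>s. h2 (s, r)) \<in> borel_measurable lborel"
          using measurable_compose[OF measurable_Pair2' borel_measurable_integrable[OF h12(2)]] by simp
        show "(\<lambda>s. prod (indicator {0..r} s *\<^sub>R f' s) (gi r)) \<in> borel_measurable lborel"
          using sub(1)[of r] True by (intro prod_meas) (auto simp: set_integrable_def)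
        show "AE s in lborel. h2 (s, r) = prod (indicator {0..r} s *\<^sub>R f' s) (gi r)"
          using AE_lborel_singleton[of r]
        proof eventually_elim
          fix s assume "s \<noteq> r"
          then show "h2 (s, r) = prod (indicator {0..r} s *\<^sub>R f' s) (gi r)"
          proof -
            have "indicator {x. fst x < snd x} (s, r) * indicator {0..t} s = (indicator {0..r} s :: real)"
              using True \<open>s \<noteq> r\<close> by (auto split: split_indicator)
            then show ?thesis
              by (simp add: h2_def h_def fi_def bounded_bilinear.scaleR_left[OF bil])
          qed
        qed
      qed
      also have "\<dots> = prod (f r - f 0) (gi r)"
        using start(1)[of r] True t sub(1)[of r] by (subst int_left) (auto simp: set_integrable_def)
      finally show ?thesis using True by (simp add: gi_def)
    next
      case False
      then show ?thesis by (simp add: h2_def h_def gi_def bounded_bilinear.zero_right[OF bil])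
    qed
    then show ?thesis
      using lborel_pair.integral_snd[of "\<lambda>s r. h2 (s, r)"] h12(2) by (simp add: set_lebesgue_integral_def)
  qed
  have "h = (\<lambda>x. h1 x + h2 x)"
    by (auto simp: h1_def h2_def fun_eq_iff indicator_def)
  then have split: "prod (f t - f 0) (g t - g 0) = (LINT s:{0..t}|lborel. prod (f' s) (g s - g 0)) + (LINT r:{0..t}|lborel. prod (f r - f 0) (g' r))"
    using Bochner_Integration.integral_add[OF h12] total part1 part2 by simp
  have sub2: "set_integrable lborel {0..t} (\<lambda>s. prod (f' s) (g s))" "set_integrable lborel {0..t} (\<lambda>s. prod (f s) (g' s))"
    by (rule set_integrable_subset[OF fg(1)], use t in auto) (rule set_integrable_subset[OF fg(2)], use t in auto)
  have const: "set_integrable lborel {0..t} (\<lambda>s. prod (f' s) b)" "(LINT s:{0..t}|lborel. prod (f' s) b) = prod (f t - f 0) b" for b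
  proof -
    have eq: "indicator {0..t} s *\<^sub>R prod (f' s) b = prod (fi s) b" for s
      by (simp add: fi_def bounded_bilinear.scaleR_left[OF bil])
    show "set_integrable lborel {0..t} (\<lambda>s. prod (f' s) b)"
      unfolding set_integrable_def eq by (rule integrable_bounded_linear[OF bounded_bilinear.bounded_linear_left[OF bil] fi])
    show "(LINT s:{0..t}|lborel. prod (f' s) b) = prod (f t - f 0) b"
      unfolding set_lebesgue_integral_def eq int_left[OF fi] using start(1)[OF t] by (simp add: fi_def)
  qed
  have const2: "set_integrable lborel {0..t} (\<lambda>s. prod b (g' s))" "(LINT s:{0..t}|lborel. prod b (g' s)) = prod b (g t - g 0)" for b
  proof -
    have eq: "indicator {0..t} s *\<^sub>R prod b (g' s) = prod b (gi s)" for s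
      by (simp add: gi_def bounded_bilinear.scaleR_right[OF bil])
    show "set_integrable lborel {0..t} (\<lambda>s. prod b (g' s))"
      unfolding set_integrable_def eq by (rule integrable_bounded_linear[OF bounded_bilinear.bounded_linear_right[OF bil] gi])
    show "(LINT s:{0..t}|lborel. prod b (g' s)) = prod b (g t - g 0)"
      unfolding set_lebesgue_integral_def eq int_right[OF gi] using start(2)[OF t] by (simp add: gi_def)
  qed
  \<comment> \<open>The initial values are split off, which turns the two triangles into the product rule.\<close>
  have e1: "(LINT s:{0..t}|lborel. prod (f' s) (g s - g 0)) = (LINT s:{0..t}|lborel. prod (f' s) (g s)) - prod (f t - f 0) (g 0)"
    unfolding bounded_bilinear.diff_right[OF bil]
    by (subst set_integral_diff(2)[OF sub2(1) const(1)]) (simp only: const(2) bounded_bilinear.diff_right[OF bil])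
  have e2: "(LINT s:{0..t}|lborel. prod (f s - f 0) (g' s)) = (LINT s:{0..t}|lborel. prod (f s) (g' s)) - prod (f 0) (g t - g 0)"
    unfolding bounded_bilinear.diff_left[OF bil]
    by (subst set_integral_diff(2)[OF sub2(2) const2(1)]) (simp only: const2(2) bounded_bilinear.diff_left[OF bil])
  have e3: "(LINT s:{0..t}|lborel. prod (f' s) (g s) + prod (f s) (g' s))
      = (LINT s:{0..t}|lborel. prod (f' s) (g s)) + (LINT s:{0..t}|lborel. prod (f s) (g' s))"
    by (rule set_integral_add(2)[OF sub2])
  show "prod (f t) (g t) = prod (f 0) (g 0) + (LINT s:{0..t}|lborel. prod (f' s) (g s) + prod (f s) (g' s))"
    using split unfolding e1 e2 e3 by (simp add: bounded_bilinear.diff_left[OF bil] bounded_bilinear.diff_right[OF bil] algebra_simps)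
qed

section \<open>Pathwise comparison with the equilibrium\<close>

text \<open>The closed-loop drift when the players in \<open>S\<close> use the equilibrium feedback; the controls
  of the other players are added separately.\<close>

definition game_drift ::
  "real^'n^'n \<Rightarrow> real \<Rightarrow> real \<Rightarrow> ('n::finite \<Rightarrow> real \<Rightarrow> real^'n^'n) \<Rightarrow> 'n set \<Rightarrow> real \<Rightarrow> real^'n^'n" where
  "game_drift L a q G S t = - (a *\<^sub>R L) - (\<Sum>j\<in>S. unit_dyad j ** (G j t + q *\<^sub>R L))"

definition running_cost :: "real^'n^'n \<Rightarrow> real \<Rightarrow> real \<Rightarrow> 'n::finite \<Rightarrow> real \<Rightarrow> real^'n \<Rightarrow> real" where
  "running_cost L q \<epsilon> i u x = 1/2 * u\<^sup>2 + q * u * (L *v x) $ i + \<epsilon>/2 * ((L *v x) $ i)\<^sup>2"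

lemma unit_dyad_mult_vector: "(unit_dyad j ** M) *v x = ((M *v x) $ j) *\<^sub>R axis j 1"
  using sandwich_unit_dyad_vector[of "mat 1" j M x] by (simp add: matrix_mul_lid matrix_vector_mul_lid)

lemma sum_matrix_vector_mult: "(\<Sum>j\<in>S. M j) *v x = (\<Sum>j\<in>S. M j *v x)" for M :: "'i \<Rightarrow> real^'n^'m"
  by (rule bounded_bilinear.sum_left[OF bounded_bilinear_matrix_vector_mult])

lemma game_drift_vector_nth:
  "(game_drift L a q G S t *v x) $ j =
    - a * (L *v x) $ j + (if j \<in> S then - q * (L *v x) $ j - (G j t *v x) $ j else 0)"
proof -
  have "(\<Sum>k\<in>S. ((G k t *v x + q *\<^sub>R (L *v x)) $ k * axis k 1 $ j)) =
      (\<Sum>k\<in>S. if k = j then (G j t *v x + q *\<^sub>R (L *v x)) $ j else 0)"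
    by (intro sum.cong) (auto simp: axis_def)
  then show ?thesis
    by (simp add: game_drift_def matrix_vector_simps sum_matrix_vector_mult unit_dyad_mult_vector)
qed

lemma game_drift_remove:
  assumes "i \<in> S"
  shows "game_drift L a q G S t *v x =
    game_drift L a q G (S - {i}) t *v x + (- q * (L *v x) $ i - (G i t *v x) $ i) *\<^sub>R axis i 1"
  using assms by (auto simp: vec_eq_iff game_drift_vector_nth axis_def)

lemma continuous_on_game_drift:
  assumes "\<And>j. continuous_on A (G j)"
  shows "continuous_on A (game_drift L a q G S)"
  unfolding game_drift_def by (intro continuous_intros assms)

lemma continuous_on_best_response_field:
  fixes F K :: "real \<Rightarrow> real^'n^'n^'n"
  assumes F: "continuous_on A F" and K: "continuous_on A K"
  shows "continuous_on A (\<lambda>t. best_response_field L \<kappa> \<delta> (F t) (K t))"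
proof -
  have own: "continuous_on A (\<lambda>t. own_rows (K t))"
    by (rule bounded_linear.continuous_on[OF linear_own_rows[unfolded linear_conv_bounded_linear] K])
  show ?thesis
    unfolding best_response_field_def quadratic_part_def
    by (intro continuous_intros F K own bounded_linear.continuous_on[OF bounded_linear_transpose]
        bounded_bilinear.continuous_on[OF bounded_bilinear_left_mult]
        bounded_bilinear.continuous_on[OF bounded_bilinear_right_mult]
        bounded_bilinear.continuous_on[OF bounded_bilinear_cross_term])
qed

lemma symmetric_best_response_field:
  assumes "transpose L = L" "symmetric_family F" "symmetric_family K"
  shows "symmetric_family (best_response_field L \<kappa> \<delta> F K)"
proof -
  have "transpose (quadratic_part F K $ i) = quadratic_part F K $ i"
    "transpose (laplacian_source L $ i) = laplacian_source L $ i" "transpose (F $ i) = F $ i" for i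
    using symmetric_quadratic_part[OF assms(2,3)] symmetric_laplacian_source[OF assms(1)] assms(2)
    by (auto simp: symmetric_family_def)
  then show ?thesis
    by (simp add: symmetric_family_def best_response_field_def left_mult_def right_mult_def transpose_simps
      matrix_transpose_mul assms(1))
qed

lemma set_integral_lborel_singleton [simp]: "(LINT s:{r::real}|lborel. f s) = 0"
  unfolding set_lebesgue_integral_def
  by (rule integral_eq_zero_AE, use AE_lborel_singleton[of r] in eventually_elim) simp

locale riccati_game =
  fixes L :: "real^'n^'n" and T a q \<epsilon> c :: real and G :: "'n::finite \<Rightarrow> real \<Rightarrow> real^'n^'n"
  assumes riccati: "riccati_system L T a q \<epsilon> c G"
    and symmetric_L: "transpose L = L"
    and T_pos: "0 < T" and q_le: "q\<^sup>2 \<le> \<epsilon>" and c_nonneg: "0 \<le> c"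
begin

abbreviation equilibrium :: "'n \<Rightarrow> real \<Rightarrow> real^'n \<Rightarrow> real" where
  "equilibrium i t x \<equiv> - q * (L *v x) $ i - (G i t *v x) $ i"

abbreviation closed_drift :: "real \<Rightarrow> real^'n^'n" where
  "closed_drift \<equiv> game_drift L a q G UNIV"

abbreviation deviation_drift :: "'n \<Rightarrow> real \<Rightarrow> real^'n^'n" where
  "deviation_drift i \<equiv> game_drift L a q G (UNIV - {i})"

text \<open>The time derivative of \<open>G i\<close>, as a continuous function of time; the Riccati system only
  asserts the existence of a derivative at each time.\<close>

definition G_rate :: "'n \<Rightarrow> real \<Rightarrow> real^'n^'n" where
  "G_rate i t = best_response_field L (a + q) (\<epsilon> - q\<^sup>2) (\<chi> j. G j t) (\<chi> j. G j t) $ i"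

lemma G_symmetric: "t \<in> {0..T} \<Longrightarrow> transpose (G i t) = G i t"
  using riccati by (simp add: riccati_system_def)

lemma G_family_symmetric: "t \<in> {0..T} \<Longrightarrow> symmetric_family (\<chi> j. G j t)"
  using G_symmetric by (simp add: symmetric_family_def)

lemma G_terminal: "G i T = c *\<^sub>R (L ** unit_dyad i ** L)"
  using riccati by (simp add: riccati_system_def)

lemma G_derivative:
  assumes t: "t \<in> {0..T}"
  shows "(G i has_vector_derivative G_rate i t) (at t within {0..T})"
proof -
  obtain F' where F': "(G i has_vector_derivative F') (at t within {0..T})"
    "F' + (\<Sum>j\<in>UNIV. (- ((a + q) *\<^sub>R L) - G j t) ** unit_dyad j ** G i t)
       + (\<Sum>j\<in>UNIV. G i t ** unit_dyad j ** (- ((a + q) *\<^sub>R L) - G j t))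
       + (\<epsilon> - q\<^sup>2) *\<^sub>R (L ** unit_dyad i ** L) + G i t ** unit_dyad i ** G i t = 0"
    using riccati t unfolding riccati_system_def by blast
  have "F' = G_rate i t"
    using F'(2) riccati_equation_iff[OF G_family_symmetric[OF t], of F' "a + q" L i "\<epsilon> - q\<^sup>2"]
    by (simp add: G_rate_def)
  with F'(1) show ?thesis by simp
qed

lemma G_continuous: "continuous_on {0..T} (G i)"
  using G_derivative by (intro continuous_on_vector_derivative) auto

lemma G_rate_continuous: "continuous_on {0..T} (G_rate i)"
  unfolding G_rate_def
  by (intro continuous_on_component continuous_on_best_response_field continuous_on_vec_lambda G_continuous)

lemma G_rate_symmetric:
  assumes "t \<in> {0..T}"
  shows "transpose (G_rate i t) = G_rate i t"
  using symmetric_best_response_field[OF symmetric_L G_family_symmetric[OF assms] G_family_symmetric[OF assms]]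
  by (simp add: G_rate_def symmetric_family_def)

text \<open>The Riccati equation of player \<open>i\<close> with the drift terms collected: the drift that remains
  when player \<open>i\<close> deviates multiplies \<open>G i t\<close> from the left, the closed-loop drift of all
  players from the right.\<close>

lemma value_equation:
  assumes t: "t \<in> {0..T}"
  shows "G_rate i t + transpose (deviation_drift i t) ** G i t + G i t ** closed_drift t
    = q *\<^sub>R (L ** unit_dyad i ** G i t) - (\<epsilon> - q\<^sup>2) *\<^sub>R (L ** unit_dyad i ** L)"
proof -
  have qL: "(\<Sum>j\<in>UNIV. unit_dyad j ** (q *\<^sub>R L)) = q *\<^sub>R L"
    using bounded_bilinear.sum_left[OF bounded_bilinear_matrix_mult, of unit_dyad UNIV "q *\<^sub>R L"]
    by (simp add: sum_unit_dyad matrix_mul_lid)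
  have closed: "closed_drift t = - ((a + q) *\<^sub>R L) - (\<Sum>j\<in>UNIV. unit_dyad j ** G j t)"
    unfolding game_drift_def by (simp add: matrix_add_ldistrib sum.distrib qL algebra_simps)
  have dev: "deviation_drift i t = - ((a + q) *\<^sub>R L) - (\<Sum>j\<in>UNIV. unit_dyad j ** G j t) + unit_dyad i ** (G i t + q *\<^sub>R L)"
    unfolding closed[symmetric] game_drift_def by (simp add: sum_diff1)
  have tdev: "transpose (deviation_drift i t) =
    - ((a + q) *\<^sub>R L) - (\<Sum>j\<in>UNIV. G j t ** unit_dyad j) + (G i t + q *\<^sub>R L) ** unit_dyad i"
    unfolding dev by (simp add: transpose_simps matrix_transpose_mul symmetric_L G_symmetric[OF t])
  show ?thesis
    unfolding G_rate_def best_response_field_nth[OF G_family_symmetric[OF t]] closed tdev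
    by (simp add: matrix_mult_simps matrix_mul_assoc algebra_simps)
qed

text \<open>The time derivative of \<open>G\<^sup>i (y - x)\<close> along a deviation \<open>y\<close> from the equilibrium state \<open>x\<close>,
  as a function of the current control \<open>u\<close> and the two states.\<close>

definition adjoint_rate :: "'n \<Rightarrow> real \<Rightarrow> real \<Rightarrow> real^'n \<Rightarrow> real^'n \<Rightarrow> real^'n" where
  "adjoint_rate i t u x y = G_rate i t *v (y - x)
     + G i t *v (deviation_drift i t *v (y - x) + (u - equilibrium i t x) *\<^sub>R axis i 1)"

text \<open>The first-order optimality of the equilibrium feedback. The coefficient of the deviation
  \<open>u - equilibrium i t x\<close> vanishes by the choice of the feedback, and the remaining bilinear
  form in \<open>x\<close> and \<open>y - x\<close> vanishes by \<open>value_equation\<close>.\<close>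

lemma cost_variation_pointwise:
  assumes t: "t \<in> {0..T}"
  shows "adjoint_rate i t u x y \<bullet> x + (G i t *v (y - x)) \<bullet> (closed_drift t *v x)
    + equilibrium i t x * (u - equilibrium i t x)
    + q * ((u - equilibrium i t x) * (L *v x) $ i + equilibrium i t x * (L *v (y - x)) $ i)
    + \<epsilon> * (L *v x) $ i * (L *v (y - x)) $ i = 0"
proof -
  define z where "z = y - x"
  define \<eta> where "\<eta> = u - equilibrium i t x"
  note Gs = G_symmetric[OF t, of i]
  have swap: "(M *v v) \<bullet> w = v \<bullet> (M *v w)" if "transpose M = M" for M :: "real^'n^'n" and v w
    using transpose_matrix_inner[of M v w] that by simp
  have Lax: "v \<bullet> (L *v axis i 1) = (L *v v) $ i" for v
    using swap[OF symmetric_L, of v "axis i 1"] by (simp add: inner_axis)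
  have "z \<bullet> ((G_rate i t + transpose (deviation_drift i t) ** G i t + G i t ** closed_drift t) *v x)
    = z \<bullet> ((q *\<^sub>R (L ** unit_dyad i ** G i t) - (\<epsilon> - q\<^sup>2) *\<^sub>R (L ** unit_dyad i ** L)) *v x)"
    by (simp only: value_equation[OF t])
  then have id: "z \<bullet> (G_rate i t *v x) + (deviation_drift i t *v z) \<bullet> (G i t *v x) + z \<bullet> (G i t *v (closed_drift t *v x))
    = q * ((G i t *v x) $ i * (L *v z) $ i) - (\<epsilon> - q\<^sup>2) * ((L *v x) $ i * (L *v z) $ i)"
  proof -
    have h1: "z \<bullet> ((transpose (deviation_drift i t) ** G i t) *v x) = (deviation_drift i t *v z) \<bullet> (G i t *v x)"
      by (metis transpose_matrix_inner inner_commute matrix_vector_mul_assoc)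
    have h2: "z \<bullet> ((G i t ** closed_drift t) *v x) = z \<bullet> (G i t *v (closed_drift t *v x))"
      by (simp only: matrix_vector_mul_assoc)
    have h3: "z \<bullet> ((L ** unit_dyad i ** M) *v x) = (M *v x) $ i * (L *v z) $ i" for M
      by (simp add: sandwich_unit_dyad_vector Lax)
    show ?thesis
      using \<open>z \<bullet> ((G_rate i t + _ + _) *v x) = _\<close>
      by (simp only: matrix_vector_simps inner_add_right inner_diff_right inner_scaleR_right h1 h2 h3)
  qed
  have "adjoint_rate i t u x y \<bullet> x = z \<bullet> (G_rate i t *v x) + (deviation_drift i t *v z) \<bullet> (G i t *v x) + \<eta> * (G i t *v x) $ i"
    unfolding adjoint_rate_def z_def[symmetric] \<eta>_def[symmetric]
    by (simp add: inner_add_left matrix_vector_simps swap[OF G_rate_symmetric[OF t]] swap[OF Gs] inner_axis')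
  moreover have "(G i t *v z) \<bullet> (closed_drift t *v x) = z \<bullet> (G i t *v (closed_drift t *v x))"
    by (rule swap[OF Gs])
  ultimately show ?thesis
    using id unfolding z_def[symmetric] \<eta>_def[symmetric] by (simp add: algebra_simps power2_eq_square)
qed

text \<open>The remainder is \<open>((u - v) + q p)\<^sup>2 / 2 + (\<epsilon> - q\<^sup>2) p\<^sup>2 / 2\<close>; this is the convexity of the
  running cost, which comes from \<open>q\<^sup>2 \<le> \<epsilon>\<close>.\<close>

lemma running_cost_expand:
  "running_cost L q \<epsilon> i u y - running_cost L q \<epsilon> i v x \<ge>
    v * (u - v) + q * ((u - v) * (L *v x) $ i + v * (L *v (y - x)) $ i) + \<epsilon> * (L *v x) $ i * (L *v (y - x)) $ i"
proof -
  define r where "r = (L *v x) $ i"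
  define p where "p = (L *v (y - x)) $ i"
  have y: "(L *v y) $ i = r + p" by (simp add: r_def p_def matrix_vector_simps)
  have "running_cost L q \<epsilon> i u y - running_cost L q \<epsilon> i v x
     - (v * (u - v) + q * ((u - v) * r + v * p) + \<epsilon> * r * p)
    = 1/2 * ((u - v) + q * p)\<^sup>2 + (\<epsilon> - q\<^sup>2) / 2 * p\<^sup>2"
    unfolding running_cost_def y r_def[symmetric] by (simp add: power2_eq_square field_simps)
  also have "\<dots> \<ge> 0" using q_le by simp
  finally show ?thesis by (simp add: r_def p_def)
qed

lemma terminal_cost_expand:
  "c/2 * ((L *v y) $ i)\<^sup>2 - c/2 * ((L *v x) $ i)\<^sup>2 \<ge> (G i T *v (y - x)) \<bullet> x"
proof -
  define r where "r = (L *v x) $ i"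
  define p where "p = (L *v (y - x)) $ i"
  have y: "(L *v y) $ i = r + p" by (simp add: r_def p_def matrix_vector_simps)
  have "(L *v axis i 1) \<bullet> x = r"
    using transpose_matrix_inner[of L "axis i 1" x] symmetric_L by (simp add: r_def inner_axis')
  then have G: "(G i T *v (y - x)) \<bullet> x = c * (p * r)"
    by (simp add: G_terminal matrix_vector_simps(7) sandwich_unit_dyad_vector p_def)
  have "c/2 * ((L *v y) $ i)\<^sup>2 - c/2 * ((L *v x) $ i)\<^sup>2 - (G i T *v (y - x)) \<bullet> x = c/2 * p\<^sup>2"
    unfolding y G r_def[symmetric] by (simp add: power2_eq_square algebra_simps)
  also have "\<dots> \<ge> 0" using c_nonneg by simp
  finally show ?thesis by simp
qed

text \<open>For a fixed noise path \<open>w\<close>, neither \<open>z = y - x\<close> nor \<open>x - w\<close> has a noise term in its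
  equation, so both are absolutely continuous. The product rule for \<open>(G z) \<bullet> (x - w)\<close>, completed
  by \<open>(G z) \<bullet> w\<close> at the final time, expresses the linear part of the terminal cost by an
  integral that cancels the linear part of the running cost except for the term with \<open>w T - w
  s\<close>.\<close>

theorem pathwise_comparison:
  fixes x y w :: "real \<Rightarrow> real^'n" and \<alpha> :: "real \<Rightarrow> real"
  assumes x: "continuous_on {0..T} x" and y: "continuous_on {0..T} y" and w: "continuous_on {0..T} w"
    and \<alpha>: "set_integrable lborel {0..T} \<alpha>" and \<alpha>2: "set_integrable lborel {0..T} (\<lambda>t. (\<alpha> t)\<^sup>2)"
    and X: "\<And>t. t \<in> {0..T} \<Longrightarrow> x t = x0 + (LINT s:{0..t}|lborel. closed_drift s *v x s) + w t"
    and Y: "\<And>t. t \<in> {0..T} \<Longrightarrow> y t = x0 + (LINT s:{0..t}|lborel. deviation_drift i s *v y s + \<alpha> s *\<^sub>R axis i 1) + w t"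
  shows "set_integrable lborel {0..T} (\<lambda>s. adjoint_rate i s (\<alpha> s) (x s) (y s) \<bullet> (w T - w s))"
    and "(LINT t:{0..T}|lborel. running_cost L q \<epsilon> i (equilibrium i t (x t)) (x t)) + c/2 * ((L *v x T) $ i)\<^sup>2
        + (LINT s:{0..T}|lborel. adjoint_rate i s (\<alpha> s) (x s) (y s) \<bullet> (w T - w s))
      \<le> (LINT t:{0..T}|lborel. running_cost L q \<epsilon> i (\<alpha> t) (y t)) + c/2 * ((L *v y T) $ i)\<^sup>2"
proof -
  note drift_cont = continuous_on_game_drift[of "{0..T}" G, OF G_continuous]
  define z where "z = (\<lambda>t. y t - x t)"
  define u where "u = (\<lambda>t. equilibrium i t (x t))"
  define z' where "z' = (\<lambda>t. deviation_drift i t *v z t + (\<alpha> t - u t) *\<^sub>R axis i 1)"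
  define \<rho> where "\<rho> = (\<lambda>s. adjoint_rate i s (\<alpha> s) (x s) (y s))"
  have u_cont: "continuous_on {0..T} u"
    unfolding u_def by (intro continuous_intros x G_continuous)
  have ax_int: "set_integrable lborel {0..T} (\<lambda>t. \<alpha> t *\<^sub>R axis i (1::real))"
    by (rule set_integrable_bilinear_continuous[OF bounded_bilinear_scaleR \<alpha>]) simp
  have ix: "set_integrable lborel {0..T} (\<lambda>s. closed_drift s *v x s)"
    by (intro borel_integrable_atLeastAtMost' continuous_intros drift_cont x)
  have iy: "set_integrable lborel {0..T} (\<lambda>s. deviation_drift i s *v y s + \<alpha> s *\<^sub>R axis i 1)"
    by (intro set_integral_add(1) ax_int borel_integrable_atLeastAtMost' continuous_intros drift_cont y)
  have z'_eq: "z' s = (deviation_drift i s *v y s + \<alpha> s *\<^sub>R axis i 1) - closed_drift s *v x s" for s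
    unfolding z'_def z_def u_def game_drift_remove[of i UNIV, simplified]
    by (simp add: matrix_vector_simps scaleR_left_diff_distrib)
  have prim_z: "primitive_on T z z'"
    unfolding primitive_on_def
  proof (intro conjI ballI)
    show "set_integrable lborel {0..T} z'" unfolding z'_eq by (rule set_integral_diff(1)[OF iy ix])
    fix t assume t: "t \<in> {0..T}"
    have sub: "set_integrable lborel {0..t} (\<lambda>s. closed_drift s *v x s)"
      "set_integrable lborel {0..t} (\<lambda>s. deviation_drift i s *v y s + \<alpha> s *\<^sub>R axis i 1)"
      by (rule set_integrable_subset[OF ix], use t in auto) (rule set_integrable_subset[OF iy], use t in auto)
    have "z 0 = 0" using X[of 0] Y[of 0] T_pos by (simp add: z_def)
    moreover have "z t = (LINT s:{0..t}|lborel. z' s)"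
      unfolding z'_eq set_integral_diff(2)[OF sub(2) sub(1)] z_def using X[OF t] Y[OF t] by simp
    ultimately show "z t = z 0 + (LINT s:{0..t}|lborel. z' s)" by simp
  qed
  have z0: "z 0 = 0" using X[of 0] Y[of 0] T_pos by (simp add: z_def)
  have prim_\<zeta>: "primitive_on T (\<lambda>t. G i t *v z t) \<rho>"
  proof -
    have "primitive_on T (\<lambda>t. G i t *v z t) (\<lambda>t. G_rate i t *v z t + G i t *v z' t)"
      by (rule primitive_on_bilinear[OF bounded_bilinear_matrix_vector_mult
            primitive_on_derivative[OF G_derivative G_rate_continuous] prim_z])
    then show ?thesis by (simp add: \<rho>_def adjoint_rate_def z'_def z_def u_def)
  qed
  then have \<rho>_int: "set_integrable lborel {0..T} \<rho>" by (simp add: primitive_on_def)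
  have prim_U: "primitive_on T (\<lambda>t. x t - w t) (\<lambda>s. closed_drift s *v x s)"
    unfolding primitive_on_def
  proof (intro conjI ballI ix)
    fix t assume t: "t \<in> {0..T}"
    have "x 0 - w 0 = x0" using X[of 0] T_pos by simp
    then show "x t - w t = x 0 - w 0 + (LINT s:{0..t}|lborel. closed_drift s *v x s)"
      using X[OF t] by simp
  qed
  note prim_prod = primitive_on_bilinear[OF bounded_bilinear_inner prim_\<zeta> prim_U]
  have TT: "T \<in> {0..T}" using T_pos by simp
  define P where "P = (\<lambda>s. \<rho> s \<bullet> (x s - w s) + (G i s *v z s) \<bullet> (closed_drift s *v x s))"
  have P: "set_integrable lborel {0..T} P" "(G i T *v z T) \<bullet> (x T - w T) = (LINT s:{0..T}|lborel. P s)"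
    using prim_prod TT unfolding primitive_on_def P_def by (auto simp: z0 matrix_vector_mult_0_right)
  have wT: "set_integrable lborel {0..T} (\<lambda>s. \<rho> s \<bullet> w T)" "(G i T *v z T) \<bullet> w T = (LINT s:{0..T}|lborel. \<rho> s \<bullet> w T)"
  proof -
    show "set_integrable lborel {0..T} (\<lambda>s. \<rho> s \<bullet> w T)"
      by (rule set_integrable_bilinear_continuous[OF bounded_bilinear_inner \<rho>_int]) simp
    have "G i T *v z T = (LINT s:{0..T}|lborel. \<rho> s)"
      using prim_\<zeta> TT unfolding primitive_on_def by (auto simp: z0 matrix_vector_mult_0_right)
    then show "(G i T *v z T) \<bullet> w T = (LINT s:{0..T}|lborel. \<rho> s \<bullet> w T)"
      using integral_bounded_linear[OF bounded_linear_inner_left, of lborel "\<lambda>s. indicator {0..T} s *\<^sub>R \<rho> s" "w T"] \<rho>_int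
      by (simp add: set_lebesgue_integral_def set_integrable_def)
  qed
  have \<rho>w: "set_integrable lborel {0..T} (\<lambda>s. \<rho> s \<bullet> (w T - w s))"
    by (rule set_integrable_bilinear_continuous[OF bounded_bilinear_inner \<rho>_int]) (intro continuous_intros w)
  then show "set_integrable lborel {0..T} (\<lambda>s. adjoint_rate i s (\<alpha> s) (x s) (y s) \<bullet> (w T - w s))"
    by (simp add: \<rho>_def)
  define V where "V = (\<lambda>s. u s * (\<alpha> s - u s) + q * ((\<alpha> s - u s) * (L *v x s) $ i + u s * (L *v z s) $ i)
     + \<epsilon> * (L *v x s) $ i * (L *v z s) $ i)"
  \<comment> \<open>\<open>V\<close> is the linear part of the running cost; this is \<open>cost_variation_pointwise\<close> with \<open>x\<close>
    split into \<open>x - w\<close> and \<open>w\<close>.\<close>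
  have balance: "P s + \<rho> s \<bullet> w T = \<rho> s \<bullet> (w T - w s) - V s" if "s \<in> {0..T}" for s
    using cost_variation_pointwise[OF that, of i "\<alpha> s" "x s" "y s"]
    by (simp add: P_def V_def \<rho>_def z_def u_def inner_diff_right)
  have costs: "set_integrable lborel {0..T} (\<lambda>t. running_cost L q \<epsilon> i (u t) (x t))"
    "set_integrable lborel {0..T} (\<lambda>t. running_cost L q \<epsilon> i (\<alpha> t) (y t))"
  proof -
    show "set_integrable lborel {0..T} (\<lambda>t. running_cost L q \<epsilon> i (u t) (x t))"
      unfolding running_cost_def
      by (intro borel_integrable_atLeastAtMost' continuous_intros u_cont x)
    have "set_integrable lborel {0..T} (\<lambda>t. \<alpha> t * (q * (L *v y t) $ i))"
      by (rule set_integrable_bilinear_continuous[OF bounded_bilinear_mult \<alpha>]) (intro continuous_intros y)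
    moreover have "set_integrable lborel {0..T} (\<lambda>t. \<epsilon>/2 * ((L *v y t) $ i)\<^sup>2)"
      by (intro borel_integrable_atLeastAtMost' continuous_intros y)
    ultimately have "set_integrable lborel {0..T} (\<lambda>t. (1/2 * (\<alpha> t)\<^sup>2 + \<alpha> t * (q * (L *v y t) $ i)) + \<epsilon>/2 * ((L *v y t) $ i)\<^sup>2)"
      using \<alpha>2 by (intro set_integral_add(1) set_integrable_mult_right) auto
    then show "set_integrable lborel {0..T} (\<lambda>t. running_cost L q \<epsilon> i (\<alpha> t) (y t))"
      by (simp add: running_cost_def mult_ac)
  qed
  have Vint: "set_integrable lborel {0..T} V"
  proof -
    have "set_integrable lborel {0..T} (\<lambda>s. \<rho> s \<bullet> (w T - w s) - (P s + \<rho> s \<bullet> w T))"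
      by (intro set_integral_diff(1) set_integral_add(1) \<rho>w P(1) wT(1))
    then show ?thesis
      by (rule set_integrable_cong[THEN iffD1, rotated -1]) (use balance in auto)
  qed
  have "(LINT s:{0..T}|lborel. P s) + (LINT s:{0..T}|lborel. \<rho> s \<bullet> w T)
      = (LINT s:{0..T}|lborel. \<rho> s \<bullet> (w T - w s)) - (LINT s:{0..T}|lborel. V s)"
    unfolding set_integral_add(2)[OF P(1) wT(1), symmetric] set_integral_diff(2)[OF \<rho>w Vint, symmetric]
    by (rule set_lebesgue_integral_cong) (use balance in auto)
  moreover have "(LINT s:{0..T}|lborel. V s) \<le>
      (LINT t:{0..T}|lborel. running_cost L q \<epsilon> i (\<alpha> t) (y t)) - (LINT t:{0..T}|lborel. running_cost L q \<epsilon> i (u t) (x t))"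
    unfolding set_integral_diff(2)[OF costs(2,1), symmetric]
    by (rule set_integral_mono[OF Vint set_integral_diff(1)[OF costs(2,1)]])
      (simp add: V_def z_def running_cost_expand)
  moreover have "(G i T *v z T) \<bullet> x T \<le> c/2 * ((L *v y T) $ i)\<^sup>2 - c/2 * ((L *v x T) $ i)\<^sup>2"
    unfolding z_def by (rule terminal_cost_expand)
  ultimately have "(LINT t:{0..T}|lborel. running_cost L q \<epsilon> i (u t) (x t)) + c/2 * ((L *v x T) $ i)\<^sup>2
        + (LINT s:{0..T}|lborel. \<rho> s \<bullet> (w T - w s))
      \<le> (LINT t:{0..T}|lborel. running_cost L q \<epsilon> i (\<alpha> t) (y t)) + c/2 * ((L *v y T) $ i)\<^sup>2"
    using P(2) wT(2) by (simp add: inner_diff_right)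
  then show "(LINT t:{0..T}|lborel. running_cost L q \<epsilon> i (equilibrium i t (x t)) (x t)) + c/2 * ((L *v x T) $ i)\<^sup>2
        + (LINT s:{0..T}|lborel. adjoint_rate i s (\<alpha> s) (x s) (y s) \<bullet> (w T - w s))
      \<le> (LINT t:{0..T}|lborel. running_cost L q \<epsilon> i (\<alpha> t) (y t)) + c/2 * ((L *v y T) $ i)\<^sup>2"
    by (simp only: u_def \<rho>_def)
qed

end

section \<open>Brownian increments and the generated filtration\<close>

locale brownian_noise = prob_space M for M :: "'w measure" +
  fixes T :: real and W :: "'n::finite \<Rightarrow> real \<Rightarrow> 'w \<Rightarrow> real"
  assumes horizon: "0 < T" and noise: "independent_brownian_motions T M W"
begin

abbreviation filtration :: "real \<Rightarrow> 'w measure" where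
  "filtration \<equiv> generated_filtration M W"

lemma brownian: "brownian_motion_on T M (W i)"
  using noise by (simp add: independent_brownian_motions_def)

lemma W_measurable: "t \<in> {0..T} \<Longrightarrow> W i t \<in> borel_measurable M"
  using brownian[of i] by (simp add: brownian_motion_on_def)

lemma W_start: "AE \<omega> in M. W i 0 \<omega> = 0"
  using brownian[of i] by (simp add: brownian_motion_on_def)

lemma W_continuous: "\<omega> \<in> space M \<Longrightarrow> continuous_on {0..T} (\<lambda>t. W i t \<omega>)"
  using brownian[of i] by (simp add: brownian_motion_on_def)

lemma filtration_generators:
  "{W i s -` A \<inter> space M | i s A. s \<in> {0..t} \<and> A \<in> sets borel} \<subseteq> Pow (space M)" by auto

lemma space_filtration [simp]: "space (filtration t) = space M"
  unfolding generated_filtration_def by (rule space_measure_of[OF filtration_generators])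

lemma sets_filtration: "sets (filtration t) =
    sigma_sets (space M) {W i s -` A \<inter> space M | i s A. s \<in> {0..t} \<and> A \<in> sets borel}"
  unfolding generated_filtration_def by (rule sets_measure_of[OF filtration_generators])

lemma filtration_subset: "t \<le> T \<Longrightarrow> sets (filtration t) \<subseteq> sets M"
  unfolding sets_filtration
  by (rule sets.sigma_sets_subset) (auto intro!: measurable_sets[OF W_measurable])

lemma W_adapted:
  assumes "s \<in> {0..t}"
  shows "W i s \<in> borel_measurable (filtration t)"
proof (rule measurableI)
  fix A :: "real set" assume "A \<in> sets borel"
  then show "W i s -` A \<inter> space (filtration t) \<in> sets (filtration t)"
    unfolding sets_filtration space_filtration using assms by (intro sigma_sets.Basic) blast
qed simp

definition cylinder :: "('n \<times> real) set \<Rightarrow> ('n \<times> real \<Rightarrow> real set) \<Rightarrow> 'w set" where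
  "cylinder J A = {\<omega> \<in> space M. \<forall>p\<in>J. W (fst p) (snd p) \<omega> \<in> A p}"

text \<open>Independence of increments is given along increasing grids; a finite set of observation
  times is completed to such a grid that starts in 0 and ends with the step from \<open>t\<close> to \<open>T\<close>.\<close>

lemma sorted_grid:
  fixes t :: real and J :: "real set"
  assumes J: "finite J" "J \<subseteq> {0..t}" and t: "0 \<le> t" "t < T"
  obtains n and \<tau> :: "nat \<Rightarrow> real" where "\<tau> 0 = 0" "\<And>k. k < Suc n \<Longrightarrow> \<tau> k < \<tau> (Suc k)" "\<tau> n = t" "\<tau> (Suc n) = T"
    "\<And>s. s \<in> J \<Longrightarrow> \<exists>m\<le>n. \<tau> m = s"
proof -
  define xs where "xs = sorted_list_of_set (J \<union> {0, t})"
  have fin: "finite (J \<union> {0, t})" using J by simp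
  have set_xs: "set xs = J \<union> {0, t}" unfolding xs_def by (rule set_sorted_list_of_set[OF fin])
  have strict: "sorted_wrt (<) xs" unfolding xs_def by (simp add: strict_sorted_iff)
  have len: "0 < length xs" using set_xs by (cases xs) auto
  define n where "n = length xs - 1"
  have Suc_n: "length xs = Suc n" using len by (simp add: n_def)
  define \<tau> where "\<tau> = (\<lambda>k. if k \<le> n then xs ! k else T)"
  have le: "xs ! k \<le> xs ! m" if "k \<le> m" "m \<le> n" for k m
    using that strict Suc_n by (cases "k = m") (auto simp: sorted_wrt_iff_nth_less less_imp_le)
  have nth_in: "xs ! k \<in> {0..t}" if "k \<le> n" for k
    using nth_mem[of k xs] that Suc_n set_xs J t by auto
  have ex: "\<exists>m\<le>n. xs ! m = s" if "s \<in> J \<union> {0, t}" for s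
    using that unfolding set_xs[symmetric] in_set_conv_nth Suc_n less_Suc_eq_le by blast
  obtain m0 mt where m: "m0 \<le> n" "xs ! m0 = 0" "mt \<le> n" "xs ! mt = t"
    using ex[of 0] ex[of t] by auto
  have first: "xs ! 0 = 0" using le[of 0 m0] m nth_in[of 0] by auto
  have last: "xs ! n = t" using le[of mt n] m nth_in[of n] by auto
  show ?thesis
  proof
    show "\<tau> 0 = 0" "\<tau> n = t" "\<tau> (Suc n) = T" using first last by (auto simp: \<tau>_def)
    show "\<tau> k < \<tau> (Suc k)" if "k < Suc n" for k
      using that strict Suc_n last t by (cases "k = n") (auto simp: \<tau>_def sorted_wrt_iff_nth_less)
    show "\<exists>m\<le>n. \<tau> m = s" if "s \<in> J" for s
      using ex[of s] that by (auto simp: \<tau>_def)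
  qed
qed

text \<open>The values at the observation times are partial sums of the increments along the grid, up
  to the null set on which the motion does not start in 0. This null set is handled by comparing
  probabilities rather than events.\<close>

lemma single_increment_independent:
  assumes t: "0 \<le> t" "t < T" and J: "finite J" "J \<subseteq> {0..t}"
    and A: "\<And>s. s \<in> J \<Longrightarrow> A s \<in> sets borel" and D: "D \<in> sets borel"
  shows "prob {\<omega> \<in> space M. (\<forall>s\<in>J. W i s \<omega> \<in> A s) \<and> W i T \<omega> - W i t \<omega> \<in> D}
    = prob {\<omega> \<in> space M. \<forall>s\<in>J. W i s \<omega> \<in> A s} * prob {\<omega> \<in> space M. W i T \<omega> - W i t \<omega> \<in> D}"
proof -
  obtain n \<tau> where \<tau>: "\<tau> 0 = 0" "\<And>k. k < Suc n \<Longrightarrow> \<tau> k < \<tau> (Suc k)" "\<tau> n = t" "\<tau> (Suc n) = T"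
    and grid: "\<And>s. s \<in> J \<Longrightarrow> \<exists>m\<le>n. \<tau> m = s"
    using sorted_grid[OF J t] by metis
  obtain m where m: "\<And>s. s \<in> J \<Longrightarrow> m s \<le> n \<and> \<tau> (m s) = s" using grid by metis
  define X where "X = (\<lambda>k \<omega>. W i (\<tau> (Suc k)) \<omega> - W i (\<tau> k) \<omega>)"
  have indep: "indep_vars (\<lambda>_. borel) X {..<Suc n}"
    using brownian[of i] \<tau> unfolding brownian_motion_on_def X_def by auto
  have split: "indep_var (PiM {..<n} (\<lambda>_. borel)) (\<lambda>\<omega>. restrict (\<lambda>k. X k \<omega>) {..<n})
      (PiM {n} (\<lambda>_. borel)) (\<lambda>\<omega>. restrict (\<lambda>k. X k \<omega>) {n})"
    by (rule indep_var_restrict[OF indep]) auto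
  have rv: "(\<lambda>\<omega>. restrict (\<lambda>k. X k \<omega>) {..<n}) \<in> M \<rightarrow>\<^sub>M PiM {..<n} (\<lambda>_. borel)"
    using split by (simp add: indep_var_eq)
  define C where "C = {v \<in> space (PiM {..<n} (\<lambda>_. borel :: real measure)). \<forall>s\<in>J. (\<Sum>k<m s. v k) \<in> A s}"
  define C' where "C' = {v \<in> space (PiM {n} (\<lambda>_. borel :: real measure)). v n \<in> D}"
  have C: "C \<in> sets (PiM {..<n} (\<lambda>_. borel))"
    unfolding C_def
  proof (rule sets.sets_Collect_finite_All[OF _ J(1)])
    fix s assume s: "s \<in> J"
    have "(\<lambda>v. \<Sum>k<m s. v k) \<in> borel_measurable (PiM {..<n} (\<lambda>_. borel :: real measure))"
      using m[OF s] by (intro borel_measurable_sum measurable_component_singleton) auto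
    from measurable_sets[OF this A[OF s]]
    show "{v \<in> space (PiM {..<n} (\<lambda>_. borel)). (\<Sum>k<m s. v k) \<in> A s} \<in> sets (PiM {..<n} (\<lambda>_. borel))"
      by (simp add: vimage_def Int_def conj_commute)
  qed
  have C': "C' \<in> sets (PiM {n} (\<lambda>_. borel))"
    unfolding C'_def using measurable_sets[OF measurable_component_singleton[of n "{n}" "\<lambda>_. borel :: real measure"] D]
    by (simp add: vimage_def Int_def conj_commute)
  have telescope: "(\<Sum>k<l. X k \<omega>) = W i (\<tau> l) \<omega> - W i 0 \<omega>" for l \<omega>
    using sum_lessThan_telescope[of "\<lambda>k. W i (\<tau> k) \<omega>" l] \<tau>(1) by (simp add: X_def)
  have tau_in: "\<tau> k \<in> {0..T}" if "k \<le> Suc n" for k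
  proof -
    have mono: "\<tau> a \<le> \<tau> b" if "a \<le> b" "b \<le> Suc n" for a b
      using that
    proof (induction b)
      case (Suc b)
      then show ?case using \<tau>(2)[of b] by (cases "a = Suc b") auto
    qed simp
    show ?thesis using mono[of 0 k] mono[of k "Suc n"] that \<tau> by auto
  qed
  have t_in: "t \<in> {0..T}" "T \<in> {0..T}" "0 \<in> {0..T}" using t by auto
  have s_in: "s \<in> {0..T}" if "s \<in> J" for s using that J t by auto
  have past_meas: "{\<omega> \<in> space M. \<forall>s\<in>J. W i s \<omega> \<in> A s} \<in> events"
    using measurable_sets[OF W_measurable[OF s_in] A]
    by (intro sets.sets_Collect_finite_All[OF _ J(1)]) (simp add: vimage_def Int_def conj_commute)
  have incr_meas: "{\<omega> \<in> space M. W i T \<omega> - W i t \<omega> \<in> D} \<in> events"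
    using measurable_sets[OF borel_measurable_diff[OF W_measurable[OF t_in(2)] W_measurable[OF t_in(1)]] D]
    by (simp add: vimage_def Int_def conj_commute)
  let ?R = "\<lambda>\<omega>. restrict (\<lambda>k. X k \<omega>) {..<n}" and ?R' = "\<lambda>\<omega>. restrict (\<lambda>k. X k \<omega>) {n}"
  have past: "?R -` C \<inter> space M \<in> events" using measurable_sets[OF rv C] .
  have R: "?R \<omega> \<in> C \<longleftrightarrow> (\<forall>s\<in>J. W i s \<omega> - W i 0 \<omega> \<in> A s)" for \<omega>
  proof -
    have "(\<Sum>k<m s. restrict (\<lambda>k. X k \<omega>) {..<n} k) = W i s \<omega> - W i 0 \<omega>" if "s \<in> J" for s
    proof -
      have "(\<Sum>k<m s. restrict (\<lambda>k. X k \<omega>) {..<n} k) = (\<Sum>k<m s. X k \<omega>)"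
        using m[OF that] by (intro sum.cong) auto
      then show ?thesis using telescope[of \<omega> "m s"] m[OF that] by simp
    qed
    then show ?thesis by (simp add: C_def space_PiM)
  qed
  have R': "?R' \<omega> \<in> C' \<longleftrightarrow> W i T \<omega> - W i t \<omega> \<in> D" for \<omega>
    using \<tau> by (simp add: C'_def space_PiM X_def)
  have incr: "?R' -` C' \<inter> space M = {\<omega> \<in> space M. W i T \<omega> - W i t \<omega> \<in> D}" using R' by auto
  have "prob {\<omega> \<in> space M. \<forall>s\<in>J. W i s \<omega> \<in> A s} = prob (?R -` C \<inter> space M)"
  proof (rule measure_eq_AE[OF _ past_meas past])
    show "AE \<omega> in M. (\<omega> \<in> {\<omega> \<in> space M. \<forall>s\<in>J. W i s \<omega> \<in> A s}) = (\<omega> \<in> ?R -` C \<inter> space M)"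
      using W_start[of i] by eventually_elim (simp add: R conj_commute)
  qed
  moreover have "prob {\<omega> \<in> space M. (\<forall>s\<in>J. W i s \<omega> \<in> A s) \<and> W i T \<omega> - W i t \<omega> \<in> D}
      = prob ((\<lambda>\<omega>. (?R \<omega>, ?R' \<omega>)) -` (C \<times> C') \<inter> space M)"
  proof (rule measure_eq_AE)
    show "AE \<omega> in M. (\<omega> \<in> {\<omega> \<in> space M. (\<forall>s\<in>J. W i s \<omega> \<in> A s) \<and> W i T \<omega> - W i t \<omega> \<in> D})
        = (\<omega> \<in> (\<lambda>\<omega>. (?R \<omega>, ?R' \<omega>)) -` (C \<times> C') \<inter> space M)"
      using W_start[of i] by eventually_elim (simp add: R R' conj_commute)
    have "{\<omega> \<in> space M. (\<forall>s\<in>J. W i s \<omega> \<in> A s) \<and> W i T \<omega> - W i t \<omega> \<in> D}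
      = {\<omega> \<in> space M. \<forall>s\<in>J. W i s \<omega> \<in> A s} \<inter> {\<omega> \<in> space M. W i T \<omega> - W i t \<omega> \<in> D}" by auto
    then show "{\<omega> \<in> space M. (\<forall>s\<in>J. W i s \<omega> \<in> A s) \<and> W i T \<omega> - W i t \<omega> \<in> D} \<in> events"
      using past_meas incr_meas by simp
    have "(\<lambda>\<omega>. (?R \<omega>, ?R' \<omega>)) -` (C \<times> C') \<inter> space M = (?R -` C \<inter> space M) \<inter> {\<omega> \<in> space M. W i T \<omega> - W i t \<omega> \<in> D}"
      unfolding incr[symmetric] by auto
    then show "(\<lambda>\<omega>. (?R \<omega>, ?R' \<omega>)) -` (C \<times> C') \<inter> space M \<in> events"
      using past incr_meas by simp
  qed
  ultimately show ?thesis using indep_varD[OF split C C'] incr by simp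
qed

text \<open>Independence of the paths of different players reduces the claim to the player whose
  increment is considered.\<close>

lemma cylinder_increment_independent:
  assumes t: "0 \<le> t" "t < T" and J: "finite J" "J \<subseteq> UNIV \<times> {0..t}"
    and A: "\<And>p. p \<in> J \<Longrightarrow> A p \<in> sets borel" and D: "D \<in> sets borel"
  shows "prob (cylinder J A \<inter> {\<omega> \<in> space M. W i T \<omega> - W i t \<omega> \<in> D})
    = prob (cylinder J A) * prob {\<omega> \<in> space M. W i T \<omega> - W i t \<omega> \<in> D}"
proof -
  let ?P = "PiM {0..T} (\<lambda>_. borel :: real measure)"
  define R where "R = (\<lambda>j \<omega>. \<lambda>s\<in>{0..T}. W j s \<omega>)"
  have indep: "indep_vars (\<lambda>_. ?P) R UNIV"
    using noise by (simp add: independent_brownian_motions_def R_def)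
  define Jj where "Jj = (\<lambda>j. {s. (j, s) \<in> J})"
  have Jj_fin: "finite (Jj j)" for j
  proof -
    have "Jj j \<subseteq> snd ` J" by (force simp: Jj_def)
    then show ?thesis using J(1) finite_subset by blast
  qed
  have Jj_sub: "Jj j \<subseteq> {0..t}" for j using J(2) by (auto simp: Jj_def)
  have Jj_T: "s \<in> {0..T}" if "s \<in> Jj j" for s j using Jj_sub[of j] that t by auto
  define C where "C = (\<lambda>j. {f \<in> space ?P. \<forall>s\<in>Jj j. f s \<in> A (j, s)})"
  define DD where "DD = {f \<in> space ?P. f T - f t \<in> D}"
  have C: "C j \<in> sets ?P" for j
    unfolding C_def
  proof (rule sets.sets_Collect_finite_All[OF _ Jj_fin])
    fix s assume s: "s \<in> Jj j"
    then have "A (j, s) \<in> sets borel" using A by (simp add: Jj_def)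
    from measurable_sets[OF measurable_component_singleton[OF Jj_T[OF s]] this]
    show "{f \<in> space ?P. f s \<in> A (j, s)} \<in> sets ?P" by (simp add: vimage_def Int_def conj_commute)
  qed
  have DD: "DD \<in> sets ?P"
  proof -
    have "(\<lambda>f. f T - f t) \<in> borel_measurable ?P"
      using t by (intro borel_measurable_diff measurable_component_singleton) auto
    from measurable_sets[OF this D] show ?thesis by (simp add: DD_def vimage_def Int_def conj_commute)
  qed
  have RC: "R j -` C j \<inter> space M = {\<omega> \<in> space M. \<forall>s\<in>Jj j. W j s \<omega> \<in> A (j, s)}" for j
    using Jj_T[of _ j] by (auto simp: R_def C_def space_PiM)
  have RD: "R i -` (C i \<inter> DD) \<inter> space M =
      {\<omega> \<in> space M. (\<forall>s\<in>Jj i. W i s \<omega> \<in> A (i, s)) \<and> W i T \<omega> - W i t \<omega> \<in> D}"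
    using Jj_T[of _ i] t by (auto simp: R_def C_def DD_def space_PiM)
  have cyl: "cylinder J A = (\<Inter>j\<in>UNIV. R j -` C j \<inter> space M)"
    unfolding RC by (auto simp: cylinder_def Jj_def)
  \<comment> \<open>The event about the increment is absorbed into the path event of player \<open>i\<close>.\<close>
  define C' where "C' = (\<lambda>j. if j = i then C i \<inter> DD else C j)"
  have cylD: "cylinder J A \<inter> {\<omega> \<in> space M. W i T \<omega> - W i t \<omega> \<in> D} = (\<Inter>j\<in>UNIV. R j -` C' j \<inter> space M)"
  proof -
    have "(\<Inter>j\<in>UNIV. R j -` C' j \<inter> space M) = (\<Inter>j\<in>UNIV. R j -` C j \<inter> space M) \<inter> (R i -` (C i \<inter> DD) \<inter> space M)"
      by (auto simp: C'_def split: if_splits)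
    then show ?thesis unfolding RD cyl[symmetric] by (auto simp: cylinder_def Jj_def)
  qed
  have "prob (cylinder J A \<inter> {\<omega> \<in> space M. W i T \<omega> - W i t \<omega> \<in> D}) = (\<Prod>j\<in>UNIV. prob (R j -` C' j \<inter> space M))"
    unfolding cylD by (rule indep_varsD[OF indep]) (use C DD in \<open>auto simp: C'_def\<close>)
  also have "\<dots> = prob (R i -` C' i \<inter> space M) * (\<Prod>j\<in>UNIV - {i}. prob (R j -` C' j \<inter> space M))"
    by (rule prod.remove) auto
  also have "(\<Prod>j\<in>UNIV - {i}. prob (R j -` C' j \<inter> space M)) = (\<Prod>j\<in>UNIV - {i}. prob (R j -` C j \<inter> space M))"
    by (rule prod.cong) (auto simp: C'_def)
  also have "prob (R i -` C' i \<inter> space M) =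
      prob (R i -` C i \<inter> space M) * prob {\<omega> \<in> space M. W i T \<omega> - W i t \<omega> \<in> D}"
  proof -
    have "C' i = C i \<inter> DD" by (simp add: C'_def)
    then show ?thesis
      by (simp only: RD RC) (rule single_increment_independent[OF t Jj_fin Jj_sub _ D], use A in \<open>auto simp: Jj_def\<close>)
  qed
  finally have "prob (cylinder J A \<inter> {\<omega> \<in> space M. W i T \<omega> - W i t \<omega> \<in> D}) =
     (prob (R i -` C i \<inter> space M) * (\<Prod>j\<in>UNIV - {i}. prob (R j -` C j \<inter> space M))) * prob {\<omega> \<in> space M. W i T \<omega> - W i t \<omega> \<in> D}"
    by simp
  also have "prob (R i -` C i \<inter> space M) * (\<Prod>j\<in>UNIV - {i}. prob (R j -` C j \<inter> space M)) = (\<Prod>j\<in>UNIV. prob (R j -` C j \<inter> space M))"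
    by (rule prod.remove[symmetric]) auto
  also have "\<dots> = prob (cylinder J A)"
    unfolding cyl by (rule indep_varsD[OF indep, symmetric]) (use C in auto)
  finally show ?thesis .
qed

text \<open>Cylinder events are stable under intersections and generate the past, so independence
  extends from them to the whole past.\<close>

lemma increment_independent:
  assumes t: "0 \<le> t" "t < T" and Y: "Y \<in> borel_measurable (filtration t)"
  shows "indep_var borel Y borel (\<lambda>\<omega>. W i T \<omega> - W i t \<omega>)"
proof -
  define \<C> where "\<C> = {cylinder J A | J A. finite J \<and> J \<subseteq> UNIV \<times> {0..t} \<and> (\<forall>p\<in>J. A p \<in> sets borel)}"
  define \<D> where "\<D> = {(\<lambda>\<omega>. W i T \<omega> - W i t \<omega>) -` D \<inter> space M | D. D \<in> sets borel}"
  have D_eq: "(\<lambda>\<omega>. W i T \<omega> - W i t \<omega>) -` D \<inter> space M = {\<omega> \<in> space M. W i T \<omega> - W i t \<omega> \<in> D}" for D by auto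
  have Wd: "(\<lambda>\<omega>. W i T \<omega> - W i t \<omega>) \<in> borel_measurable M"
    using t by (intro borel_measurable_diff W_measurable) auto
  have \<D>_ev: "\<D> \<subseteq> events" unfolding \<D>_def using measurable_sets[OF Wd] by auto
  have \<C>_ev: "\<C> \<subseteq> events"
  proof
    fix E assume "E \<in> \<C>"
    then obtain J A where E: "E = cylinder J A" and J: "finite J" "J \<subseteq> UNIV \<times> {0..t}" "\<And>p. p \<in> J \<Longrightarrow> A p \<in> sets borel"
      by (auto simp: \<C>_def)
    show "E \<in> events" unfolding E cylinder_def
    proof (rule sets.sets_Collect_finite_All[OF _ J(1)])
      fix p assume p: "p \<in> J"
      then have "snd p \<in> {0..T}" using J(2) t by auto
      from measurable_sets[OF W_measurable[OF this] J(3)[OF p], of "fst p"]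
      show "{\<omega> \<in> space M. W (fst p) (snd p) \<omega> \<in> A p} \<in> events" by (simp add: vimage_def Int_def conj_commute)
    qed
  qed
  have "indep_set \<C> \<D>"
  proof (rule indep_setI[OF \<C>_ev \<D>_ev])
    fix E E' assume "E \<in> \<C>" "E' \<in> \<D>"
    then obtain J A D where E: "E = cylinder J A" "E' = {\<omega> \<in> space M. W i T \<omega> - W i t \<omega> \<in> D}"
      and *: "finite J" "J \<subseteq> UNIV \<times> {0..t}" "\<And>p. p \<in> J \<Longrightarrow> A p \<in> sets borel" "D \<in> sets borel"
      unfolding \<C>_def \<D>_def D_eq by auto
    show "prob (E \<inter> E') = prob E * prob E'"
      unfolding E by (rule cylinder_increment_independent[OF t *])
  qed
  moreover have "Int_stable \<C>"
  proof (rule Int_stableI)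
    fix E E' assume "E \<in> \<C>" "E' \<in> \<C>"
    then obtain J A J' A' where E: "E = cylinder J A" "E' = cylinder J' A'"
      and *: "finite J" "J \<subseteq> UNIV \<times> {0..t}" "\<And>p. p \<in> J \<Longrightarrow> A p \<in> sets borel"
        "finite J'" "J' \<subseteq> UNIV \<times> {0..t}" "\<And>p. p \<in> J' \<Longrightarrow> A' p \<in> sets borel"
      unfolding \<C>_def by auto
    define B where "B = (\<lambda>p. (if p \<in> J then A p else UNIV) \<inter> (if p \<in> J' then A' p else UNIV))"
    have "E \<inter> E' = cylinder (J \<union> J') B"
      unfolding E by (auto simp: cylinder_def B_def split: if_splits)
    moreover have "\<forall>p\<in>J \<union> J'. B p \<in> sets borel" using * by (auto simp: B_def)
    ultimately show "E \<inter> E' \<in> \<C>"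
      unfolding \<C>_def using * by (intro CollectI exI[of _ "J \<union> J'"] exI[of _ B]) auto
  qed
  moreover have "Int_stable \<D>"
  proof (rule Int_stableI)
    fix E E' assume "E \<in> \<D>" "E' \<in> \<D>"
    then obtain D D' where "E = (\<lambda>\<omega>. W i T \<omega> - W i t \<omega>) -` D \<inter> space M" "E' = (\<lambda>\<omega>. W i T \<omega> - W i t \<omega>) -` D' \<inter> space M"
      "D \<in> sets borel" "D' \<in> sets borel" by (auto simp: \<D>_def)
    then show "E \<inter> E' \<in> \<D>"
      unfolding \<D>_def by (intro CollectI exI[of _ "D \<inter> D'"]) auto
  qed
  ultimately have ind: "indep_set (sigma_sets (space M) \<C>) (sigma_sets (space M) \<D>)"
    by (rule indep_set_sigma_sets)
  have F_sub: "sets (filtration t) \<subseteq> sigma_sets (space M) \<C>"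
    unfolding sets_filtration
  proof (rule sigma_sets_subseteq, rule subsetI)
    fix E assume "E \<in> {W i s -` A \<inter> space M | i s A. s \<in> {0..t} \<and> A \<in> sets borel}"
    then obtain j s A where "E = W j s -` A \<inter> space M" "s \<in> {0..t}" "A \<in> sets borel" by auto
    then show "E \<in> \<C>"
      unfolding \<C>_def by (intro CollectI exI[of _ "{(j, s)}"] exI[of _ "\<lambda>_. A"]) (auto simp: cylinder_def)
  qed
  have Y_sub: "sigma_sets (space M) {Y -` A \<inter> space M | A. A \<in> sets borel} \<subseteq> sigma_sets (space M) \<C>"
    using measurable_sets[OF Y] F_sub by (intro sigma_sets_mono) auto
  have YM: "Y \<in> borel_measurable M"
    by (rule measurable_from_subalg[OF _ Y]) (use filtration_subset[of t] t in \<open>auto simp: subalgebra_def\<close>)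
  show ?thesis
    unfolding indep_var_eq
  proof (intro conjI YM Wd)
    show "indep_set (sigma_sets (space M) {Y -` A \<inter> space M | A. A \<in> sets borel})
       (sigma_sets (space M) {(\<lambda>\<omega>. W i T \<omega> - W i t \<omega>) -` A \<inter> space M | A. A \<in> sets borel})"
      unfolding \<D>_def[symmetric]
      using Y_sub indep_setD_ev1[OF ind] indep_setD_ev2[OF ind]
      by (intro indep_setI) (auto intro: indep_setD[OF ind])
  qed
qed

section \<open>Moments of the Brownian motions\<close>

lemma increment_moments:
  assumes "0 \<le> s" "s < t" "t \<le> T"
  shows "integrable M (\<lambda>\<omega>. W i t \<omega> - W i s \<omega>)" "expectation (\<lambda>\<omega>. W i t \<omega> - W i s \<omega>) = 0"
    "integrable M (\<lambda>\<omega>. (W i t \<omega> - W i s \<omega>)\<^sup>2)" "expectation (\<lambda>\<omega>. (W i t \<omega> - W i s \<omega>)\<^sup>2) = t - s"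
proof -
  have sd: "0 < sqrt (t - s)" using assms by simp
  have D: "distributed M lborel (\<lambda>\<omega>. W i t \<omega> - W i s \<omega>) (normal_density 0 (sqrt (t - s)))"
    using brownian[of i] assms by (auto simp: brownian_motion_on_def)
  show "integrable M (\<lambda>\<omega>. W i t \<omega> - W i s \<omega>)"
    using distributed_integrable[OF D, of "\<lambda>x. x"] integrable_normal_moment[OF sd, of 0 1] by simp
  show e: "expectation (\<lambda>\<omega>. W i t \<omega> - W i s \<omega>) = 0" by (rule normal_distributed_expectation[OF sd D])
  show "integrable M (\<lambda>\<omega>. (W i t \<omega> - W i s \<omega>)\<^sup>2)"
    using distributed_integrable[OF D, of "\<lambda>x. x\<^sup>2"] integrable_normal_moment[OF sd, of 0 2] by simp
  show "expectation (\<lambda>\<omega>. (W i t \<omega> - W i s \<omega>)\<^sup>2) = t - s"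
    using normal_distributed_variance[OF sd D] assms unfolding e by simp
qed

lemma W_second_moment:
  assumes "t \<in> {0..T}"
  shows "integrable M (\<lambda>\<omega>. (W i t \<omega>)\<^sup>2)" "expectation (\<lambda>\<omega>. (W i t \<omega>)\<^sup>2) = t"
proof -
  have meas: "(\<lambda>\<omega>. (W i t \<omega>)\<^sup>2) \<in> borel_measurable M" using W_measurable[OF assms] by measurable
  have "integrable M (\<lambda>\<omega>. (W i t \<omega>)\<^sup>2) \<and> expectation (\<lambda>\<omega>. (W i t \<omega>)\<^sup>2) = t"
  proof (cases "t = 0")
    case True
    have ae: "AE \<omega> in M. (W i t \<omega>)\<^sup>2 = 0" using W_start[of i] True by auto
    show ?thesis
      using integrable_cong_AE[OF meas _ ae] integral_cong_AE[OF meas _ ae] True by simp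
  next
    case False
    then have t: "0 < t" "t \<le> T" using assms by auto
    have meas0: "(\<lambda>\<omega>. (W i t \<omega> - W i 0 \<omega>)\<^sup>2) \<in> borel_measurable M"
    proof -
      have "0 \<in> {0..T}" using horizon by simp
      note W_measurable[OF assms, of i, measurable] W_measurable[OF this, of i, measurable]
      show ?thesis by measurable
    qed
    have ae: "AE \<omega> in M. (W i t \<omega>)\<^sup>2 = (W i t \<omega> - W i 0 \<omega>)\<^sup>2" using W_start[of i] by auto
    show ?thesis
      using integrable_cong_AE[OF meas meas0 ae] integral_cong_AE[OF meas meas0 ae]
        increment_moments(3,4)[of 0 t i] t by simp
  qed
  then show "integrable M (\<lambda>\<omega>. (W i t \<omega>)\<^sup>2)" "expectation (\<lambda>\<omega>. (W i t \<omega>)\<^sup>2) = t" by auto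
qed

text \<open>The only martingale property that the Nash argument uses.\<close>

lemma expectation_adapted_increment:
  assumes t: "t \<in> {0..T}" and Y: "Y \<in> borel_measurable (filtration t)" and int: "integrable M Y"
  shows "integrable M (\<lambda>\<omega>. Y \<omega> * (W i T \<omega> - W i t \<omega>))"
    and "expectation (\<lambda>\<omega>. Y \<omega> * (W i T \<omega> - W i t \<omega>)) = 0"
proof -
  have "integrable M (\<lambda>\<omega>. Y \<omega> * (W i T \<omega> - W i t \<omega>)) \<and> expectation (\<lambda>\<omega>. Y \<omega> * (W i T \<omega> - W i t \<omega>)) = 0"
  proof (cases "t = T")
    case False
    then have t': "0 \<le> t" "t < T" using t by auto
    note indep = increment_independent[OF t' Y, of i] int increment_moments(1)[OF t' order_refl, of i]
    show ?thesis
      using indep_var_integrable[OF indep] indep_var_lebesgue_integral[OF indep]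
        increment_moments(2)[OF t' order_refl, of i] by simp
  qed simp
  then show "integrable M (\<lambda>\<omega>. Y \<omega> * (W i T \<omega> - W i t \<omega>))"
    "expectation (\<lambda>\<omega>. Y \<omega> * (W i T \<omega> - W i t \<omega>)) = 0" by auto
qed

end

section \<open>Progressive measurability and existence of state processes\<close>

context brownian_noise
begin

abbreviation progressive :: "(real \<Rightarrow> 'w \<Rightarrow> 'b::topological_space) \<Rightarrow> bool" where
  "progressive \<equiv> progressively_measurable T filtration"

abbreviation past :: "real \<Rightarrow> (real \<times> 'w) measure" where
  "past t \<equiv> restrict_space borel {0..t} \<Otimes>\<^sub>M filtration t"

lemma fst_past: "fst \<in> borel_measurable (past t)"
proof -
  have "(\<lambda>s::real. s) \<in> restrict_space borel {0..t} \<rightarrow>\<^sub>M borel"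
    by (rule measurable_restrict_space1) simp
  from measurable_compose[OF measurable_fst this] show ?thesis .
qed

lemma progressive_continuous_function:
  assumes "continuous_on {0..T} f" "t \<in> {0..T}"
  shows "(\<lambda>x. f (fst x)) \<in> borel_measurable (past t)"
  by (rule measurable_compose[OF measurable_fst borel_measurable_continuous_on_restrict])
    (use assms in \<open>auto intro: continuous_on_subset\<close>)

lemma progressiveD: "progressive Y \<Longrightarrow> t \<in> {0..T} \<Longrightarrow> (\<lambda>x. Y (fst x) (snd x)) \<in> borel_measurable (past t)"
  unfolding progressively_measurable_def case_prod_unfold by blast

lemma progressiveI:
  "(\<And>t. t \<in> {0..T} \<Longrightarrow> (\<lambda>x. Y (fst x) (snd x)) \<in> borel_measurable (past t)) \<Longrightarrow> progressive Y"
  unfolding progressively_measurable_def case_prod_unfold by blast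

lemma progressive_section:
  assumes "progressive Y" "t \<in> {0..T}"
  shows "Y t \<in> borel_measurable (filtration t)"
proof -
  have "(\<lambda>\<omega>. (t, \<omega>)) \<in> filtration t \<rightarrow>\<^sub>M past t"
    by (rule measurable_Pair1') (use assms in \<open>auto simp: space_restrict_space\<close>)
  from measurable_compose[OF this progressiveD[OF assms]] show ?thesis by simp
qed

text \<open>A path is the limit of its values on the grids of mesh \<open>1 / Suc n\<close>. Rounding down keeps
  the grid times in the past.\<close>

lemma progressive_W: "progressive (W i)"
proof (rule progressiveI)
  fix t assume t: "t \<in> {0..T}"
  \<comment> \<open>The clamping is vacuous for times in \<open>{0..t}\<close>; it makes the approximations measurable
    everywhere.\<close>
  define r where "r = (\<lambda>n s. max 0 (min t (of_int \<lfloor>real (Suc n) * s\<rfloor> / real (Suc n))))"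
  show "(\<lambda>x. W i (fst x) (snd x)) \<in> borel_measurable (past t)"
  proof (rule borel_measurable_LIMSEQ_metric)
    fix n
    have "(\<lambda>x. W i (max 0 (min t (of_int k / real (Suc n)))) (snd x)) \<in> borel_measurable (past t)" for k :: int
      using t by (intro measurable_compose[OF measurable_snd] W_adapted) auto
    moreover have "(\<lambda>x. \<lfloor>real (Suc n) * fst x\<rfloor>) \<in> past t \<rightarrow>\<^sub>M count_space UNIV"
      by (rule measurable_compose[OF borel_measurable_times[OF borel_measurable_const fst_past] measurable_real_floor])
    ultimately show "(\<lambda>x. W i (r n (fst x)) (snd x)) \<in> borel_measurable (past t)"
      unfolding r_def by (rule measurable_compose_countable)
  next
    fix x assume "x \<in> space (past t)"
    then have s: "fst x \<in> {0..t}" and \<omega>: "snd x \<in> space M"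
      by (auto simp: space_pair_measure space_restrict_space)
    have lim: "(\<lambda>n. of_int \<lfloor>real (Suc n) * fst x\<rfloor> / real (Suc n)) \<longlonglongrightarrow> fst x"
    proof (rule tendsto_sandwich)
      show "\<forall>\<^sub>F n in sequentially. fst x - inverse (real (Suc n)) \<le> of_int \<lfloor>real (Suc n) * fst x\<rfloor> / real (Suc n)"
      proof (rule always_eventually, rule allI)
        fix n
        have "real (Suc n) * fst x - 1 \<le> of_int \<lfloor>real (Suc n) * fst x\<rfloor>" by linarith
        then have "(real (Suc n) * fst x - 1) / real (Suc n) \<le> of_int \<lfloor>real (Suc n) * fst x\<rfloor> / real (Suc n)"
          by (rule divide_right_mono) simp
        then show "fst x - inverse (real (Suc n)) \<le> of_int \<lfloor>real (Suc n) * fst x\<rfloor> / real (Suc n)"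
          by (simp add: diff_divide_distrib inverse_eq_divide)
      qed
      show "\<forall>\<^sub>F n in sequentially. of_int \<lfloor>real (Suc n) * fst x\<rfloor> / real (Suc n) \<le> fst x"
      proof (rule always_eventually, rule allI)
        fix n
        have "of_int \<lfloor>real (Suc n) * fst x\<rfloor> \<le> real (Suc n) * fst x" by linarith
        then show "of_int \<lfloor>real (Suc n) * fst x\<rfloor> / real (Suc n) \<le> fst x"
          by (simp add: pos_divide_le_eq mult.commute)
      qed
      show "(\<lambda>n. fst x - inverse (real (Suc n))) \<longlonglongrightarrow> fst x"
        using tendsto_diff[OF tendsto_const LIMSEQ_inverse_real_of_nat, of "fst x"] by simp
    qed simp
    have "(\<lambda>n. r n (fst x)) \<longlonglongrightarrow> max 0 (min t (fst x))"
      unfolding r_def by (intro tendsto_max tendsto_min tendsto_const lim)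
    then have lim2: "(\<lambda>n. r n (fst x)) \<longlonglongrightarrow> fst x" using s by simp
    have "r n (fst x) \<in> {0..T}" for n using t by (auto simp: r_def min_le_iff_disj)
    then show "(\<lambda>n. W i (r n (fst x)) (snd x)) \<longlonglongrightarrow> W i (fst x) (snd x)"
      by (intro continuous_on_tendsto_compose[OF W_continuous[OF \<omega>] lim2]) (use s t in auto)
  qed
qed

lemma progressive_bilinear:
  fixes prod :: "'a::euclidean_space \<Rightarrow> 'b::euclidean_space \<Rightarrow> 'c::euclidean_space"
  assumes "bounded_bilinear prod" "continuous_on {0..T} f" "progressive Y"
  shows "progressive (\<lambda>t \<omega>. prod (f t) (Y t \<omega>))"
  by (rule progressiveI)
    (intro borel_measurable_bounded_bilinear[OF assms(1)] progressive_continuous_function progressiveD assms)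

lemma progressive_add:
  fixes Y Z :: "real \<Rightarrow> 'w \<Rightarrow> 'b::euclidean_space"
  shows "progressive Y \<Longrightarrow> progressive Z \<Longrightarrow> progressive (\<lambda>t \<omega>. Y t \<omega> + Z t \<omega>)"
  by (rule progressiveI) (intro borel_measurable_add progressiveD)

lemma progressive_const: "progressive (\<lambda>t \<omega>. b :: 'b::euclidean_space)"
  by (rule progressiveI) simp

lemma progressive_bounded_linear:
  fixes h :: "'a::euclidean_space \<Rightarrow> 'b::euclidean_space"
  assumes "bounded_linear h" "progressive Y"
  shows "progressive (\<lambda>t \<omega>. h (Y t \<omega>))"
proof (rule progressiveI)
  fix t assume "t \<in> {0..T}"
  then show "(\<lambda>x. h (Y (fst x) (snd x))) \<in> borel_measurable (past t)"
    by (intro measurable_compose[OF progressiveD[OF assms(2)]] borel_measurable_continuous_onI linear_continuous_on assms(1))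
qed

lemma progressive_sum:
  fixes Y :: "'i \<Rightarrow> real \<Rightarrow> 'w \<Rightarrow> 'b::euclidean_space"
  assumes "\<And>k. k \<in> I \<Longrightarrow> progressive (Y k)"
  shows "progressive (\<lambda>t \<omega>. \<Sum>k\<in>I. Y k t \<omega>)"
  by (rule progressiveI) (intro borel_measurable_sum progressiveD assms)

text \<open>The integrand is known to be jointly measurable on \<open>{0..t}\<close> only. Clamping the integration
  variable extends it to the line without changing its values where the indicator is nonzero.\<close>

lemma progressive_integral:
  fixes Y :: "real \<Rightarrow> 'w \<Rightarrow> 'b::euclidean_space"
  assumes Y: "progressive Y"
  shows "progressive (\<lambda>t \<omega>. LINT s:{0..t}|lborel. Y s \<omega>)"
proof (rule progressiveI)
  fix t assume t: "t \<in> {0..T}"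
  define cl where "cl = (\<lambda>u::real. max 0 (min t u))"
  have cl: "cl \<in> borel \<rightarrow>\<^sub>M restrict_space borel {0..t}"
  proof (rule measurable_restrict_space2)
    show "cl \<in> space borel \<rightarrow> {0..t}" using t by (auto simp: cl_def)
    show "cl \<in> borel_measurable borel" unfolding cl_def by measurable
  qed
  let ?N = "past t \<Otimes>\<^sub>M lborel"
  have "(\<lambda>z. (cl (snd z), snd (fst z))) \<in> ?N \<rightarrow>\<^sub>M past t"
  proof (rule measurable_Pair)
    show "(\<lambda>z. cl (snd z)) \<in> ?N \<rightarrow>\<^sub>M restrict_space borel {0..t}"
      by (rule measurable_compose[OF _ cl]) simp
    show "(\<lambda>z. snd (fst z)) \<in> ?N \<rightarrow>\<^sub>M filtration t"
      by (rule measurable_compose[OF measurable_fst measurable_snd])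
  qed
  from measurable_compose[OF this progressiveD[OF Y t]]
  have Ycl: "(\<lambda>z. Y (cl (snd z)) (snd (fst z))) \<in> borel_measurable ?N" by simp
  have [measurable]: "(\<lambda>z. fst (fst z)) \<in> borel_measurable ?N" "(\<lambda>z. snd z) \<in> borel_measurable ?N"
    using measurable_compose[OF measurable_fst fst_past] by auto
  have "{z \<in> space ?N. 0 \<le> snd z \<and> snd z \<le> fst (fst z)} \<in> sets ?N" by measurable
  then have "(\<lambda>z. indicator {z \<in> space ?N. 0 \<le> snd z \<and> snd z \<le> fst (fst z)} z *\<^sub>R Y (cl (snd z)) (snd (fst z)))
      \<in> borel_measurable ?N"
    by (intro borel_measurable_scaleR borel_measurable_indicator Ycl)
  then have "(\<lambda>z. indicator {0..fst (fst z)} (snd z) *\<^sub>R Y (cl (snd z)) (snd (fst z))) \<in> borel_measurable ?N"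
    by (rule measurable_cong[THEN iffD1, rotated]) (auto simp: indicator_def space_pair_measure)
  then have "(\<lambda>x. LINT u|lborel. indicator {0..fst x} u *\<^sub>R Y (cl u) (snd x)) \<in> borel_measurable (past t)"
    by (intro lborel.borel_measurable_lebesgue_integral) (simp add: case_prod_beta)
  then show "(\<lambda>x. LINT s:{0..fst x}|lborel. Y s (snd x)) \<in> borel_measurable (past t)"
  proof (rule measurable_cong[THEN iffD1, rotated])
    fix x assume "x \<in> space (past t)"
    then have s: "fst x \<in> {0..t}" by (auto simp: space_pair_measure space_restrict_space)
    have "indicator {0..fst x} u *\<^sub>R Y (cl u) (snd x) = indicator {0..fst x} u *\<^sub>R Y u (snd x)" for u
      using s by (auto simp: indicator_def cl_def)
    then show "(LINT u|lborel. indicator {0..fst x} u *\<^sub>R Y (cl u) (snd x)) = (LINT s:{0..fst x}|lborel. Y s (snd x))"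
      unfolding set_lebesgue_integral_def by (rule Bochner_Integration.integral_cong[OF refl])
  qed
qed

definition noise_vector :: "real \<Rightarrow> real \<Rightarrow> 'w \<Rightarrow> real^'n" where
  "noise_vector \<sigma> t \<omega> = (\<chi> j. \<sigma> * W j t \<omega>)"

lemma noise_vector_eq_sum: "noise_vector \<sigma> t \<omega> = (\<Sum>j\<in>UNIV. W j t \<omega> *\<^sub>R axis j \<sigma>)"
proof -
  have "(\<Sum>j\<in>UNIV. W j t \<omega> * axis j \<sigma> $ k) = (\<Sum>j\<in>UNIV. if j = k then \<sigma> * W k t \<omega> else 0)" for k
    by (intro sum.cong) (auto simp: axis_def)
  then show ?thesis by (simp add: noise_vector_def vec_eq_iff)
qed

lemma progressive_noise_vector: "progressive (noise_vector \<sigma>)"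
  unfolding noise_vector_eq_sum
  by (intro progressive_sum progressive_bounded_linear[OF bounded_linear_scaleR_left progressive_W])

lemma noise_vector_continuous: "\<omega> \<in> space M \<Longrightarrow> continuous_on {0..T} (\<lambda>t. noise_vector \<sigma> t \<omega>)"
  unfolding noise_vector_def by (intro continuous_intros W_continuous)

end

text \<open>\<open>\<Psi>\<close> solves the adjoint equation from the right, so the product \<open>\<Psi> \<Phi>\<close> is constant.\<close>

lemma fundamental_matrices_exist:
  fixes A :: "real \<Rightarrow> real^'n^'n"
  assumes T: "0 \<le> T" and A: "continuous_on {0..T} A"
  shows "\<exists>\<Phi> \<Psi> :: real \<Rightarrow> real^'n^'n. (\<forall>t\<in>{0..T}. (\<Phi> has_vector_derivative A t ** \<Phi> t) (at t within {0..T})) \<and>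
    continuous_on {0..T} \<Phi> \<and> continuous_on {0..T} \<Psi> \<and> (\<forall>t\<in>{0..T}. \<Phi> t ** \<Psi> t = mat 1)"
proof -
  obtain B where B: "B > 0" "\<And>(X::real^'n^'n) (Y::real^'n^'n). norm (X ** Y) \<le> norm X * norm Y * B"
    using bounded_bilinear.pos_bounded[OF bounded_bilinear_matrix_mult] by blast
  obtain H where H: "\<And>t. t \<in> {0..T} \<Longrightarrow> norm (A t) \<le> H"
    using compact_imp_bounded[OF compact_continuous_image[OF A compact_Icc]] unfolding bounded_iff by blast
  have H0: "0 \<le> H" using H[of 0] T norm_ge_zero[of "A 0"] by (meson atLeastAtMost_iff order_refl order_trans)
  have A_fst: "continuous_on ({0..T} \<times> UNIV) (\<lambda>x::real \<times> (real^'n^'n). A (fst x))"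
  proof -
    have sub: "fst ` ({0..T} \<times> (UNIV :: (real^'n^'n) set)) \<subseteq> {0..T}" by auto
    have "continuous_on ({0..T} \<times> (UNIV :: (real^'n^'n) set)) fst" by (rule continuous_on_fst[OF continuous_on_id])
    from continuous_on_compose2[OF A this sub] show ?thesis .
  qed
  have "\<exists>\<Phi> :: real \<Rightarrow> real^'n^'n. \<Phi> 0 = mat 1 \<and> (\<forall>t\<in>{0..T}. (\<Phi> has_vector_derivative A t ** \<Phi> t) (at t within {0..T}))"
  proof (rule lipschitz_ode_solution[OF T, of "H * B"])
    show "continuous_on ({0..T} \<times> UNIV) (\<lambda>(t, X :: real^'n^'n). A t ** X)"
      unfolding case_prod_beta by (intro continuous_intros A_fst)
    fix t and X Y :: "real^'n^'n" assume t: "t \<in> {0..T}"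
    have "norm (A t ** X - A t ** Y) \<le> norm (A t) * norm (X - Y) * B"
      using B(2)[of "A t" "X - Y"] by (simp add: matrix_mult_simps)
    also have "\<dots> \<le> H * norm (X - Y) * B" using B(1) H[OF t] by (intro mult_right_mono) auto
    finally show "norm (A t ** X - A t ** Y) \<le> H * B * norm (X - Y)" by (simp add: mult_ac)
  qed (use H0 B in auto)
  then obtain \<Phi> where \<Phi>: "\<Phi> 0 = mat 1" "\<And>t. t \<in> {0..T} \<Longrightarrow> (\<Phi> has_vector_derivative A t ** \<Phi> t) (at t within {0..T})" by blast
  have "\<exists>\<Psi> :: real \<Rightarrow> real^'n^'n. \<Psi> 0 = mat 1 \<and> (\<forall>t\<in>{0..T}. (\<Psi> has_vector_derivative - (\<Psi> t ** A t)) (at t within {0..T}))"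
  proof (rule lipschitz_ode_solution[OF T, of "H * B"])
    show "continuous_on ({0..T} \<times> UNIV) (\<lambda>(t, X :: real^'n^'n). - (X ** A t))"
      unfolding case_prod_beta by (intro continuous_intros A_fst)
    fix t and X Y :: "real^'n^'n" assume t: "t \<in> {0..T}"
    have "norm (- (X ** A t) - - (Y ** A t)) \<le> norm (X - Y) * norm (A t) * B"
      using B(2)[of "X - Y" "A t"] by (simp add: matrix_mult_simps norm_minus_commute)
    also have "\<dots> \<le> norm (X - Y) * H * B" using B(1) H[OF t] by (intro mult_right_mono mult_left_mono) auto
    finally show "norm (- (X ** A t) - - (Y ** A t)) \<le> H * B * norm (X - Y)" by (simp add: mult_ac)
  qed (use H0 B in auto)
  then obtain \<Psi> where \<Psi>: "\<Psi> 0 = mat 1" "\<And>t. t \<in> {0..T} \<Longrightarrow> (\<Psi> has_vector_derivative - (\<Psi> t ** A t)) (at t within {0..T})" by blast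
  have "\<Phi> t ** \<Psi> t = mat 1" if t: "t \<in> {0..T}" for t
  proof -
    have "((\<lambda>t. \<Psi> t ** \<Phi> t) has_vector_derivative 0) (at s within {0..T})" if s: "s \<in> {0..T}" for s
      using bounded_bilinear.has_vector_derivative[OF bounded_bilinear_matrix_mult \<Psi>(2)[OF s] \<Phi>(2)[OF s]]
      by (simp add: matrix_mult_simps matrix_mul_assoc)
    then obtain C where C: "\<And>s. s \<in> {0..T} \<Longrightarrow> \<Psi> s ** \<Phi> s = C"
      using has_vector_derivative_zero_constant[of "{0..T}" "\<lambda>t. \<Psi> t ** \<Phi> t"] by auto
    have "\<Psi> t ** \<Phi> t = mat 1" using C[OF t] C[of 0] t \<Phi>(1) \<Psi>(1) by (simp add: matrix_mul_lid)
    then show ?thesis by (simp add: matrix_left_right_inverse)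
  qed
  moreover have "continuous_on {0..T} \<Phi>" "continuous_on {0..T} \<Psi>"
    by (rule continuous_on_vector_derivative[OF \<Phi>(2)], assumption)
      (rule continuous_on_vector_derivative[OF \<Psi>(2)], assumption)
  ultimately show ?thesis using \<Phi>(2) by blast
qed

text \<open>Here \<open>g\<close> is merely continuous in time: it contains the noise and the integral of the
  control. Writing the solution as \<open>g\<close> plus a differentiable correction avoids any derivative of
  \<open>g\<close>.\<close>

lemma variation_of_constants:
  fixes A \<Phi> \<Psi> :: "real \<Rightarrow> real^'n^'n" and g :: "real \<Rightarrow> real^'n"
  assumes A: "continuous_on {0..T} A" and \<Phi>: "\<And>t. t \<in> {0..T} \<Longrightarrow> (\<Phi> has_vector_derivative A t ** \<Phi> t) (at t within {0..T})"
    and \<Psi>: "continuous_on {0..T} \<Psi>" and inv: "\<And>t. t \<in> {0..T} \<Longrightarrow> \<Phi> t ** \<Psi> t = mat 1"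
    and g: "continuous_on {0..T} g"
    and x: "\<And>t. t \<in> {0..T} \<Longrightarrow> x t = g t + \<Phi> t *v (LINT s:{0..t}|lborel. (\<Psi> s ** A s) *v g s)"
  shows "continuous_on {0..T} x" "\<And>t. t \<in> {0..T} \<Longrightarrow> x t = g t + (LINT s:{0..t}|lborel. A s *v x s)"
proof -
  define k where "k = (\<lambda>s. (\<Psi> s ** A s) *v g s)"
  define V where "V = (\<lambda>t. integral {0..t} k)"
  have k: "continuous_on {0..T} k" unfolding k_def by (intro continuous_intros \<Psi> A g)
  have conv: "(LINT s:{0..t}|lborel. f s) = integral {0..t} f" if "continuous_on {0..T} f" "t \<in> {0..T}"
    for f :: "real \<Rightarrow> real^'n" and t
    using that by (intro set_borel_integral_eq_integral(2) borel_integrable_atLeastAtMost') (auto intro: continuous_on_subset)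
  have xV: "x t = g t + \<Phi> t *v V t" if "t \<in> {0..T}" for t
    using x[OF that] conv[OF k that] by (simp add: V_def k_def)
  have V: "(V has_vector_derivative k t) (at t within {0..T})" if "t \<in> {0..T}" for t
    unfolding V_def by (rule integral_has_vector_derivative[OF k that])
  have \<Phi>V: "((\<lambda>t. \<Phi> t *v V t) has_vector_derivative A t *v x t) (at t within {0..T})" if t: "t \<in> {0..T}" for t
  proof -
    have "\<Phi> t *v k t = A t *v g t"
      using inv[OF t] by (simp add: k_def matrix_vector_mul_assoc matrix_mul_assoc matrix_mul_lid)
    then have "\<Phi> t *v k t + (A t ** \<Phi> t) *v V t = A t *v x t"
      by (simp add: xV[OF t] matrix_vector_simps matrix_vector_mul_assoc)
    with bounded_bilinear.has_vector_derivative[OF bounded_bilinear_matrix_vector_mult \<Phi>[OF t] V[OF t]]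
    show ?thesis by simp
  qed
  have "continuous_on {0..T} (\<lambda>t. g t + \<Phi> t *v V t)"
    by (intro continuous_intros g continuous_on_vector_derivative[OF \<Phi>V])
  then show cont: "continuous_on {0..T} x" by (rule continuous_on_eq) (simp add: xV)
  fix t assume t: "t \<in> {0..T}"
  have "((\<lambda>s. A s *v x s) has_integral (\<Phi> t *v V t - \<Phi> 0 *v V 0)) {0..t}"
    using t by (intro fundamental_theorem_of_calculus has_vector_derivative_within_subset[OF \<Phi>V]) auto
  moreover have "V 0 = 0" by (simp add: V_def)
  ultimately have "integral {0..t} (\<lambda>s. A s *v x s) = \<Phi> t *v V t"
    by (simp add: integral_unique matrix_vector_mult_0_right)
  moreover have "continuous_on {0..T} (\<lambda>s. A s *v x s)" by (intro continuous_intros A cont)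
  ultimately show "x t = g t + (LINT s:{0..t}|lborel. A s *v x s)"
    using xV[OF t] conv[OF _ t] by simp
qed

text \<open>The explicit solution formula is an integral of progressively measurable processes, hence
  itself progressively measurable, without discarding any scenario; the scenarios in which the
  control is not integrable form a null set.\<close>

lemma (in brownian_noise) linear_state_exists:
  fixes A :: "real \<Rightarrow> real^'n^'n" and e x\<^sub>0 :: "real^'n"
  assumes A: "continuous_on {0..T} A" and \<beta>: "progressive \<beta>"
    and int: "AE \<omega> in M. set_integrable lborel {0..T} (\<lambda>s. \<beta> s \<omega>)"
  shows "\<exists>X. progressive X \<and> (AE \<omega> in M. continuous_on {0..T} (\<lambda>t. X t \<omega>) \<and>
    (\<forall>t\<in>{0..T}. X t \<omega> = x\<^sub>0 + (LINT s:{0..t}|lborel. A s *v X s \<omega> + \<beta> s \<omega> *\<^sub>R e) + noise_vector \<sigma> t \<omega>))"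
proof -
  obtain \<Phi> \<Psi> :: "real \<Rightarrow> real^'n^'n" where \<Phi>: "\<And>t. t \<in> {0..T} \<Longrightarrow> (\<Phi> has_vector_derivative A t ** \<Phi> t) (at t within {0..T})"
    "continuous_on {0..T} \<Phi>" and \<Psi>: "continuous_on {0..T} \<Psi>" and inv: "\<And>t. t \<in> {0..T} \<Longrightarrow> \<Phi> t ** \<Psi> t = mat 1"
    using fundamental_matrices_exist[OF less_imp_le[OF horizon] A] by metis
  define g where "g = (\<lambda>t \<omega>. x\<^sub>0 + (LINT s:{0..t}|lborel. \<beta> s \<omega>) *\<^sub>R e + noise_vector \<sigma> t \<omega>)"
  define X where "X = (\<lambda>t \<omega>. g t \<omega> + \<Phi> t *v (LINT s:{0..t}|lborel. (\<Psi> s ** A s) *v g s \<omega>))"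
  have g_prog: "progressive g"
    unfolding g_def
    by (intro progressive_add progressive_const progressive_noise_vector
        progressive_bounded_linear[OF bounded_linear_scaleR_left progressive_integral[OF \<beta>]])
  have "progressive X"
    unfolding X_def
    by (intro progressive_add g_prog progressive_bilinear[OF bounded_bilinear_matrix_vector_mult \<Phi>(2)]
        progressive_integral progressive_bilinear[OF bounded_bilinear_matrix_vector_mult] continuous_intros \<Psi> A)
  moreover have "AE \<omega> in M. continuous_on {0..T} (\<lambda>t. X t \<omega>) \<and>
    (\<forall>t\<in>{0..T}. X t \<omega> = x\<^sub>0 + (LINT s:{0..t}|lborel. A s *v X s \<omega> + \<beta> s \<omega> *\<^sub>R e) + noise_vector \<sigma> t \<omega>)"
    using int AE_space
  proof eventually_elim
    fix \<omega> assume \<beta>_int: "set_integrable lborel {0..T} (\<lambda>s. \<beta> s \<omega>)" and \<omega>: "\<omega> \<in> space M"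
    have prim: "primitive_on T (\<lambda>t. LINT s:{0..t}|lborel. \<beta> s \<omega>) (\<lambda>s. \<beta> s \<omega>)"
      unfolding primitive_on_def using \<beta>_int by simp
    have g_cont: "continuous_on {0..T} (\<lambda>t. g t \<omega>)"
      unfolding g_def by (intro continuous_intros primitive_on_continuous[OF prim] noise_vector_continuous \<omega>)
    have x: "X t \<omega> = g t \<omega> + \<Phi> t *v (LINT s:{0..t}|lborel. (\<Psi> s ** A s) *v g s \<omega>)" if "t \<in> {0..T}" for t
      by (simp add: X_def)
    have cont: "continuous_on {0..T} (\<lambda>t. X t \<omega>)"
      using variation_of_constants(1)[where A=A and \<Phi>=\<Phi> and \<Psi>=\<Psi> and g="\<lambda>t. g t \<omega>" and x="\<lambda>t. X t \<omega>" and T=T]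
        A \<Phi>(1) \<Psi> inv g_cont x by blast
    have sol: "X t \<omega> = g t \<omega> + (LINT s:{0..t}|lborel. A s *v X s \<omega>)" if "t \<in> {0..T}" for t
      using variation_of_constants(2)[where A=A and \<Phi>=\<Phi> and \<Psi>=\<Psi> and g="\<lambda>t. g t \<omega>" and x="\<lambda>t. X t \<omega>" and T=T]
        A \<Phi>(1) \<Psi> inv g_cont x that by blast
    have "X t \<omega> = x\<^sub>0 + (LINT s:{0..t}|lborel. A s *v X s \<omega> + \<beta> s \<omega> *\<^sub>R e) + noise_vector \<sigma> t \<omega>"
      if t: "t \<in> {0..T}" for t
    proof -
      have \<beta>_t: "set_integrable lborel {0..t} (\<lambda>s. \<beta> s \<omega>)"
        by (rule set_integrable_subset[OF \<beta>_int]) (use t in auto)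
      have 1: "set_integrable lborel {0..t} (\<lambda>s. A s *v X s \<omega>)"
        using t by (intro borel_integrable_atLeastAtMost' continuous_intros continuous_on_subset[OF A] continuous_on_subset[OF cont]) auto
      have 2: "set_integrable lborel {0..t} (\<lambda>s. \<beta> s \<omega> *\<^sub>R e)" using \<beta>_t by (rule set_integrable_scaleR_left)
      have "(LINT s:{0..t}|lborel. \<beta> s \<omega> *\<^sub>R e) = (LINT s:{0..t}|lborel. \<beta> s \<omega>) *\<^sub>R e"
        using integral_scaleR_left[of e lborel "\<lambda>s. indicator {0..t} s * \<beta> s \<omega>"] \<beta>_t
        by (simp add: set_lebesgue_integral_def set_integrable_def)
      moreover have "X t \<omega> = g t \<omega> + (LINT s:{0..t}|lborel. A s *v X s \<omega>)"
        by (rule sol[OF t])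
      ultimately show ?thesis
        unfolding set_integral_add(2)[OF 1 2] by (simp add: g_def)
    qed
    with cont show "continuous_on {0..T} (\<lambda>t. X t \<omega>) \<and>
      (\<forall>t\<in>{0..T}. X t \<omega> = x\<^sub>0 + (LINT s:{0..t}|lborel. A s *v X s \<omega> + \<beta> s \<omega> *\<^sub>R e) + noise_vector \<sigma> t \<omega>)" by blast
  qed
  ultimately show ?thesis by blast
qed

section \<open>Square integrability\<close>

lemma matrix_path_bound:
  fixes A :: "real \<Rightarrow> real^'n^'n"
  assumes "continuous_on {0..T} A"
  shows "\<exists>K\<ge>0. \<forall>s\<in>{0..T}. \<forall>v. norm (A s *v v) \<le> K * norm v"
proof -
  obtain B where B: "B > 0" "\<And>(X::real^'n^'n) v. norm (X *v v) \<le> norm X * norm v * B"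
    using bounded_bilinear.pos_bounded[OF bounded_bilinear_matrix_vector_mult] by blast
  obtain H where H: "\<And>t. t \<in> {0..T} \<Longrightarrow> norm (A t) \<le> H"
    using compact_imp_bounded[OF compact_continuous_image[OF assms compact_Icc]] unfolding bounded_iff by blast
  have "norm (A s *v v) \<le> (max H 0 * B) * norm v" if "s \<in> {0..T}" for s v
  proof -
    have "norm (A s) * norm v * B \<le> max H 0 * norm v * B"
      using H[OF that] B(1) by (intro mult_right_mono) auto
    with B(2)[of "A s" v] show ?thesis by (simp add: mult_ac)
  qed
  then show ?thesis using B(1) by (intro exI[of _ "max H 0 * B"]) auto
qed

text \<open>Gronwall's inequality is applied to \<open>x - w\<close>, for which the noise only enters through an
  integral. A bound at each time by the noise at that time suffices, so that no maximal
  inequality for the noise has to be used.\<close>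

lemma linear_state_growth:
  fixes A :: "real \<Rightarrow> real^'n^'n" and x w :: "real \<Rightarrow> real^'n" and e x\<^sub>0 :: "real^'n"
  assumes T: "0 \<le> T" and A: "continuous_on {0..T} A" and K: "0 \<le> K" "\<And>s v. s \<in> {0..T} \<Longrightarrow> norm (A s *v v) \<le> K * norm v"
    and x: "continuous_on {0..T} x" and w: "continuous_on {0..T} w"
    and \<beta>: "set_integrable lborel {0..T} \<beta>" and e: "norm e \<le> 1"
    and sol: "\<And>t. t \<in> {0..T} \<Longrightarrow> x t = x\<^sub>0 + (LINT s:{0..t}|lborel. A s *v x s + \<beta> s *\<^sub>R e) + w t"
    and t: "t \<in> {0..T}"
  shows "norm (x t) \<le> norm (w t) + (norm x\<^sub>0 + (LINT s:{0..T}|lborel. \<bar>\<beta> s\<bar> + K * norm (w s))) * exp (K * T)"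
proof -
  let ?h = "\<lambda>s. \<bar>\<beta> s\<bar> + K * norm (w s)"
  let ?I = "LINT s:{0..T}|lborel. ?h s"
  let ?u = "\<lambda>t. norm (x t - w t)"
  have h_int: "set_integrable lborel {0..T} ?h"
    by (intro set_integral_add(1)[OF set_integrable_abs[OF \<beta>]] borel_integrable_atLeastAtMost' continuous_intros w)
  have u_cont: "continuous_on {0..T} ?u" by (intro continuous_intros x w)
  have ax: "set_integrable lborel {0..T} (\<lambda>s. A s *v x s + \<beta> s *\<^sub>R e)"
    by (intro set_integral_add(1)[OF _ set_integrable_scaleR_left[OF \<beta>]] borel_integrable_atLeastAtMost' continuous_intros A x)
  have le: "?u r \<le> (norm x\<^sub>0 + ?I) + K * integral {0..r} ?u" if r: "r \<in> {0..T}" for r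
  proof -
    have sub: "set_integrable lborel {0..r} ?h" "set_integrable lborel {0..r} (\<lambda>s. A s *v x s + \<beta> s *\<^sub>R e)"
      by (rule set_integrable_subset[OF h_int], use r in auto) (rule set_integrable_subset[OF ax], use r in auto)
    have u_int: "set_integrable lborel {0..r} (\<lambda>s. K * ?u s)"
      using r by (intro borel_integrable_atLeastAtMost' continuous_intros continuous_on_subset[OF u_cont]
        continuous_on_subset[OF x] continuous_on_subset[OF w]) auto
    have "?u r = norm (x\<^sub>0 + (LINT s:{0..r}|lborel. A s *v x s + \<beta> s *\<^sub>R e))" using sol[OF r] by simp
    also have "\<dots> \<le> norm x\<^sub>0 + norm (LINT s:{0..r}|lborel. A s *v x s + \<beta> s *\<^sub>R e)" by (rule norm_triangle_ineq)
    also have "norm (LINT s:{0..r}|lborel. A s *v x s + \<beta> s *\<^sub>R e) \<le> (LINT s:{0..r}|lborel. norm (A s *v x s + \<beta> s *\<^sub>R e))"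
      by (rule set_integral_norm_bound[OF sub(2)])
    also have "\<dots> \<le> (LINT s:{0..r}|lborel. ?h s + K * ?u s)"
    proof (rule set_integral_mono)
      show "set_integrable lborel {0..r} (\<lambda>s. norm (A s *v x s + \<beta> s *\<^sub>R e))"
        by (rule set_integrable_norm[OF sub(2)])
      show "set_integrable lborel {0..r} (\<lambda>s. ?h s + K * ?u s)" by (rule set_integral_add(1)[OF sub(1) u_int])
      fix s assume "s \<in> {0..r}"
      then have s: "s \<in> {0..T}" using r by auto
      have "norm (A s *v x s + \<beta> s *\<^sub>R e) \<le> norm (A s *v x s) + \<bar>\<beta> s\<bar> * norm e"
        by (rule norm_triangle_le) simp
      also have "\<dots> \<le> K * norm (x s) + \<bar>\<beta> s\<bar> * 1"
        using e K(2)[OF s] by (intro add_mono mult_left_mono) auto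
      also have "K * norm (x s) \<le> K * (norm (w s) + ?u s)"
        using K(1) norm_triangle_sub[of "x s" "w s"] by (intro mult_left_mono) auto
      finally show "norm (A s *v x s + \<beta> s *\<^sub>R e) \<le> ?h s + K * ?u s" by (simp add: algebra_simps)
    qed
    also have "\<dots> = (LINT s:{0..r}|lborel. ?h s) + K * integral {0..r} ?u"
      using set_integral_add(2)[OF sub(1) u_int] set_borel_integral_eq_integral(2)[OF u_int] by simp
    also have "(LINT s:{0..r}|lborel. ?h s) \<le> ?I"
    proof -
      have "AE s in lborel. indicator {0..r} s *\<^sub>R ?h s \<le> indicator {0..T} s *\<^sub>R ?h s"
        using r K(1) by (intro AE_I2) (auto simp: indicator_def)
      then show ?thesis
        unfolding set_lebesgue_integral_def using sub(1) h_int by (intro integral_mono_AE) (auto simp: set_integrable_def)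
    qed
    finally show ?thesis by simp
  qed
  have I0: "0 \<le> ?I"
    unfolding set_lebesgue_integral_def using K(1) by (intro Bochner_Integration.integral_nonneg) auto
  have "?u t \<le> (norm x\<^sub>0 + ?I) * exp (K * t)"
    by (rule gronwall_from_zero[OF u_cont le K(1) t])
  also have "\<dots> \<le> (norm x\<^sub>0 + ?I) * exp (K * T)"
    using I0 K(1) t by (intro mult_left_mono) (auto intro: mult_left_mono)
  finally show ?thesis using norm_triangle_sub[of "x t" "w t"] by linarith
qed

text \<open>The mean square deviation of \<open>h\<close> from its mean over \<open>{0..T}\<close> is nonnegative.\<close>

lemma set_integral_square_le:
  fixes h :: "real \<Rightarrow> real"
  assumes T: "0 < T" and h: "set_integrable lborel {0..T} h" and h2: "set_integrable lborel {0..T} (\<lambda>s. (h s)\<^sup>2)"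
  shows "(LINT s:{0..T}|lborel. h s)\<^sup>2 \<le> T * (LINT s:{0..T}|lborel. (h s)\<^sup>2)"
proof -
  define m where "m = (LINT s:{0..T}|lborel. h s) / T"
  have const: "set_integrable lborel {0..T} (\<lambda>s::real. m\<^sup>2)" by (intro borel_integrable_atLeastAtMost' continuous_intros)
  have cv: "(LINT s:{0..T}|lborel. m\<^sup>2) = T * m\<^sup>2"
    using T by (simp add: set_integral_const)
  have "0 \<le> (LINT s:{0..T}|lborel. ((h s)\<^sup>2 - 2 * m * h s) + m\<^sup>2)"
    unfolding set_lebesgue_integral_def
  proof (rule Bochner_Integration.integral_nonneg)
    fix s
    have "((h s)\<^sup>2 - 2 * m * h s) + m\<^sup>2 = (h s - m)\<^sup>2" by (simp add: power2_eq_square algebra_simps)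
    then show "0 \<le> indicator {0..T} s *\<^sub>R (((h s)\<^sup>2 - 2 * m * h s) + m\<^sup>2)" by simp
  qed
  also have "\<dots> = (LINT s:{0..T}|lborel. (h s)\<^sup>2) - 2 * m * (LINT s:{0..T}|lborel. h s) + T * m\<^sup>2"
    using h h2 const by (simp add: set_integral_add set_integral_diff cv)
  also have "2 * m * (LINT s:{0..T}|lborel. h s) = 2 * T * m\<^sup>2" using T by (simp add: m_def power2_eq_square)
  finally have "T * m\<^sup>2 \<le> (LINT s:{0..T}|lborel. (h s)\<^sup>2)" by simp
  then have "T * (T * m\<^sup>2) \<le> T * (LINT s:{0..T}|lborel. (h s)\<^sup>2)" using T by (intro mult_left_mono) auto
  moreover have "T * (T * m\<^sup>2) = (LINT s:{0..T}|lborel. h s)\<^sup>2" using T by (simp add: m_def power2_eq_square)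
  ultimately show ?thesis by simp
qed

lemma linear_state_growth_square:
  fixes A :: "real \<Rightarrow> real^'n^'n" and x w :: "real \<Rightarrow> real^'n" and e x\<^sub>0 :: "real^'n"
  assumes T: "0 < T" and A: "continuous_on {0..T} A" and K: "0 \<le> K" "\<And>s v. s \<in> {0..T} \<Longrightarrow> norm (A s *v v) \<le> K * norm v"
    and x: "continuous_on {0..T} x" and w: "continuous_on {0..T} w"
    and \<beta>: "set_integrable lborel {0..T} \<beta>" and \<beta>2: "set_integrable lborel {0..T} (\<lambda>s. (\<beta> s)\<^sup>2)" and e: "norm e \<le> 1"
    and sol: "\<And>t. t \<in> {0..T} \<Longrightarrow> x t = x\<^sub>0 + (LINT s:{0..t}|lborel. A s *v x s + \<beta> s *\<^sub>R e) + w t"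
    and t: "t \<in> {0..T}"
  shows "(norm (x t))\<^sup>2 \<le> 2 * (norm (w t))\<^sup>2 + 4 * (exp (K * T))\<^sup>2 * (norm x\<^sub>0)\<^sup>2
    + 4 * (exp (K * T))\<^sup>2 * T * (2 + 2 * K\<^sup>2) * (LINT s:{0..T}|lborel. (\<beta> s)\<^sup>2 + (norm (w s))\<^sup>2)"
proof -
  have sq: "(a + b)\<^sup>2 \<le> 2 * a\<^sup>2 + 2 * b\<^sup>2" for a b :: real
    using zero_le_power2[of "a - b"] by (simp add: power2_eq_square algebra_simps)
  let ?h = "\<lambda>s. \<bar>\<beta> s\<bar> + K * norm (w s)"
  define I where "I = (LINT s:{0..T}|lborel. ?h s)"
  define S where "S = (LINT s:{0..T}|lborel. (\<beta> s)\<^sup>2 + (norm (w s))\<^sup>2)"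
  define E where "E = exp (K * T)"
  have h_int: "set_integrable lborel {0..T} ?h"
    by (intro set_integral_add(1)[OF set_integrable_abs[OF \<beta>]] borel_integrable_atLeastAtMost' continuous_intros w)
  have S_int: "set_integrable lborel {0..T} (\<lambda>s. (\<beta> s)\<^sup>2 + (norm (w s))\<^sup>2)"
    by (intro set_integral_add(1)[OF \<beta>2] borel_integrable_atLeastAtMost' continuous_intros w)
  have h2_int: "set_integrable lborel {0..T} (\<lambda>s. (?h s)\<^sup>2)"
  proof -
    have "set_integrable lborel {0..T} (\<lambda>s. \<bar>\<beta> s\<bar> * (2 * K * norm (w s)))"
      by (rule set_integrable_bilinear_continuous[OF bounded_bilinear_mult set_integrable_abs[OF \<beta>]]) (intro continuous_intros w)
    moreover have "set_integrable lborel {0..T} (\<lambda>s. (K * norm (w s))\<^sup>2)"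
      by (intro borel_integrable_atLeastAtMost' continuous_intros w)
    ultimately have "set_integrable lborel {0..T} (\<lambda>s. ((\<beta> s)\<^sup>2 + \<bar>\<beta> s\<bar> * (2 * K * norm (w s))) + (K * norm (w s))\<^sup>2)"
      using \<beta>2 by (intro set_integral_add(1))
    then show ?thesis by (simp add: power2_sum algebra_simps)
  qed
  have I0: "0 \<le> I" unfolding I_def set_lebesgue_integral_def using K(1) by (intro Bochner_Integration.integral_nonneg) auto
  have "I\<^sup>2 \<le> T * (LINT s:{0..T}|lborel. (?h s)\<^sup>2)" unfolding I_def by (rule set_integral_square_le[OF T h_int h2_int])
  also have "(LINT s:{0..T}|lborel. (?h s)\<^sup>2) \<le> (LINT s:{0..T}|lborel. (2 + 2 * K\<^sup>2) * ((\<beta> s)\<^sup>2 + (norm (w s))\<^sup>2))"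
  proof (rule set_integral_mono[OF h2_int])
    show "set_integrable lborel {0..T} (\<lambda>s. (2 + 2 * K\<^sup>2) * ((\<beta> s)\<^sup>2 + (norm (w s))\<^sup>2))" using S_int by simp
    fix s
    have "(?h s)\<^sup>2 \<le> 2 * (\<beta> s)\<^sup>2 + 2 * K\<^sup>2 * (norm (w s))\<^sup>2"
      using sq[of "\<bar>\<beta> s\<bar>" "K * norm (w s)"] by (simp add: power_mult_distrib)
    moreover have "0 \<le> 2 * K\<^sup>2 * (\<beta> s)\<^sup>2 + 2 * (norm (w s))\<^sup>2" by simp
    ultimately show "(?h s)\<^sup>2 \<le> (2 + 2 * K\<^sup>2) * ((\<beta> s)\<^sup>2 + (norm (w s))\<^sup>2)"
      by (simp only: distrib_left distrib_right)
  qed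
  also have "\<dots> = (2 + 2 * K\<^sup>2) * S" by (simp add: S_def)
  finally have I2: "I\<^sup>2 \<le> T * ((2 + 2 * K\<^sup>2) * S)" using T by simp
  have "norm (x t) \<le> norm (w t) + (norm x\<^sub>0 + I) * E"
    unfolding I_def E_def by (rule linear_state_growth[OF less_imp_le[OF T] A K x w \<beta> e sol t])
  then have "(norm (x t))\<^sup>2 \<le> (norm (w t) + (norm x\<^sub>0 + I) * E)\<^sup>2" by (intro power_mono) auto
  also have "\<dots> \<le> 2 * (norm (w t))\<^sup>2 + 2 * ((norm x\<^sub>0 + I) * E)\<^sup>2" by (rule sq)
  also have "((norm x\<^sub>0 + I) * E)\<^sup>2 \<le> E\<^sup>2 * (2 * (norm x\<^sub>0)\<^sup>2 + 2 * (T * ((2 + 2 * K\<^sup>2) * S)))"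
    unfolding power_mult_distrib
    using mult_right_mono[of "(norm x\<^sub>0 + I)\<^sup>2" "2 * (norm x\<^sub>0)\<^sup>2 + 2 * (T * ((2 + 2 * K\<^sup>2) * S))" "E\<^sup>2"] sq[of "norm x\<^sub>0" I] I2
    by (simp add: mult.commute)
  finally show ?thesis unfolding S_def[symmetric] E_def[symmetric] by (simp add: algebra_simps)
qed

context brownian_noise
begin

abbreviation time :: "real measure" where
  "time \<equiv> restrict_space lborel {0..T}"

lemma finite_time: "finite_measure time"
  by (rule finite_measureI) (simp add: emeasure_restrict_space space_restrict_space less_imp_le[OF horizon])

lemma pair_time: "pair_sigma_finite time M"
proof -
  interpret t: finite_measure time by (rule finite_time)
  show ?thesis by unfold_locales
qed

lemma finite_pair_time: "finite_measure (time \<Otimes>\<^sub>M M)"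
  by (rule finite_measure_pair_measure[OF finite_measure_axioms finite_time])

lemma integral_time: "integral\<^sup>L time f = (LINT t:{0..T}|lborel. f t)" for f :: "real \<Rightarrow> 'b::euclidean_space"
  by (simp add: integral_restrict_space set_lebesgue_integral_def)

lemma integrable_time: "integrable time f \<longleftrightarrow> set_integrable lborel {0..T} f" for f :: "real \<Rightarrow> 'b::euclidean_space"
  by (simp add: integrable_restrict_space set_integrable_def)

lemma integrable_product_paths:
  fixes f :: "real \<Rightarrow> 'w \<Rightarrow> 'b::euclidean_space"
  assumes "integrable (time \<Otimes>\<^sub>M M) (\<lambda>x. f (fst x) (snd x))"
  shows "AE \<omega> in M. set_integrable lborel {0..T} (\<lambda>t. f t \<omega>)"
    and "integrable M (\<lambda>\<omega>. LINT t:{0..T}|lborel. f t \<omega>)"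
    and "AE t in time. integrable M (f t)"
    and "expectation (\<lambda>\<omega>. LINT t:{0..T}|lborel. f t \<omega>) = (LINT t:{0..T}|lborel. (LINT \<omega>|M. f t \<omega>))"
proof -
  interpret P: pair_sigma_finite time M by (rule pair_time)
  have int: "integrable (time \<Otimes>\<^sub>M M) (\<lambda>(t, \<omega>). f t \<omega>)" using assms by (simp add: case_prod_unfold)
  show "AE \<omega> in M. set_integrable lborel {0..T} (\<lambda>t. f t \<omega>)"
    using P.AE_integrable_snd[OF int] by (simp add: integrable_time)
  show "integrable M (\<lambda>\<omega>. LINT t:{0..T}|lborel. f t \<omega>)"
    using P.integrable_snd[OF int] by (simp add: integral_time)
  show "AE t in time. integrable M (f t)" using P.AE_integrable_fst[OF int] .
  show "expectation (\<lambda>\<omega>. LINT t:{0..T}|lborel. f t \<omega>) = (LINT t:{0..T}|lborel. (LINT \<omega>|M. f t \<omega>))"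
    using P.integral_snd[OF int] P.integral_fst[OF int] by (simp add: integral_time)
qed

lemma AE_product_of_AE:
  assumes "AE \<omega> in M. Q \<omega>"
  shows "AE x in time \<Otimes>\<^sub>M M. Q (snd x)"
proof -
  obtain N where N: "{\<omega> \<in> space M. \<not> Q \<omega>} \<subseteq> N" "emeasure M N = 0" "N \<in> sets M"
    using AE_E[OF assms] by blast
  show ?thesis
  proof (rule AE_I)
    show "{x \<in> space (time \<Otimes>\<^sub>M M). \<not> Q (snd x)} \<subseteq> space time \<times> N" using N(1) by (auto simp: space_pair_measure)
    show "emeasure (time \<Otimes>\<^sub>M M) (space time \<times> N) = 0"
      using emeasure_pair_measure_Times[OF sets.top[of time] N(3)] N(2) by (simp only: mult_zero_right)
    show "space time \<times> N \<in> sets (time \<Otimes>\<^sub>M M)" by (rule pair_measureI[OF sets.top N(3)])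
  qed
qed

lemma integrable_product_of_integrable:
  fixes g :: "'w \<Rightarrow> real"
  assumes g: "integrable M g"
  shows "integrable (time \<Otimes>\<^sub>M M) (\<lambda>x. g (snd x))"
proof -
  interpret P: pair_sigma_finite time M by (rule pair_time)
  interpret t: finite_measure time by (rule finite_time)
  show ?thesis
  proof (rule P.Fubini_integrable)
    show "(\<lambda>x. g (snd x)) \<in> borel_measurable (time \<Otimes>\<^sub>M M)"
      by (rule measurable_compose[OF measurable_snd borel_measurable_integrable[OF g]])
  qed (use g in auto)
qed

lemma progressive_product:
  fixes Y :: "real \<Rightarrow> 'w \<Rightarrow> 'b::euclidean_space"
  assumes "progressive Y"
  shows "(\<lambda>x. Y (fst x) (snd x)) \<in> borel_measurable (time \<Otimes>\<^sub>M M)"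
proof -
  have sub: "(\<lambda>\<omega>. \<omega>) \<in> M \<rightarrow>\<^sub>M filtration T"
    using filtration_subset[of T] by (intro measurableI) (auto dest: sets.sets_into_space)
  have "(\<lambda>t. t) \<in> time \<rightarrow>\<^sub>M restrict_space borel {0..T}"
    by (rule measurable_ident_sets) (simp add: sets_restrict_space)
  then have "(\<lambda>x. (fst x, snd x)) \<in> time \<Otimes>\<^sub>M M \<rightarrow>\<^sub>M past T"
    by (intro measurable_Pair measurable_compose[OF measurable_snd sub] measurable_compose[OF measurable_fst])
  from measurable_compose[OF this progressiveD[OF assms, of T]] horizon show ?thesis by simp
qed

definition square_integrable :: "(real \<Rightarrow> 'w \<Rightarrow> 'b::euclidean_space) \<Rightarrow> bool" where
  "square_integrable Y \<longleftrightarrow> (\<lambda>x. Y (fst x) (snd x)) \<in> borel_measurable (time \<Otimes>\<^sub>M M) \<and>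
     integrable (time \<Otimes>\<^sub>M M) (\<lambda>x. (norm (Y (fst x) (snd x)))\<^sup>2)"

lemma square_integrable_dominated:
  fixes Y :: "real \<Rightarrow> 'w \<Rightarrow> 'b::euclidean_space"
  assumes "(\<lambda>x. Y (fst x) (snd x)) \<in> borel_measurable (time \<Otimes>\<^sub>M M)"
    and "integrable (time \<Otimes>\<^sub>M M) g" and "AE x in time \<Otimes>\<^sub>M M. (norm (Y (fst x) (snd x)))\<^sup>2 \<le> g x"
  shows "square_integrable Y"
  unfolding square_integrable_def
proof (intro conjI assms(1))
  show "integrable (time \<Otimes>\<^sub>M M) (\<lambda>x. (norm (Y (fst x) (snd x)))\<^sup>2)"
  proof (rule Bochner_Integration.integrable_bound[OF assms(2)])
    show "AE x in time \<Otimes>\<^sub>M M. norm ((norm (Y (fst x) (snd x)))\<^sup>2) \<le> norm (g x)"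
      using assms(3) by eventually_elim simp
  qed (use assms(1) in measurable)
qed

lemma square_integrable_product:
  fixes prod :: "'a::euclidean_space \<Rightarrow> 'b::euclidean_space \<Rightarrow> 'c::euclidean_space"
  assumes bil: "bounded_bilinear prod" and Y: "square_integrable Y" and Z: "square_integrable Z"
  shows "integrable (time \<Otimes>\<^sub>M M) (\<lambda>x. prod (Y (fst x) (snd x)) (Z (fst x) (snd x)))"
proof -
  obtain K where K: "0 < K" "\<And>a b. norm (prod a b) \<le> norm a * norm b * K"
    using bounded_bilinear.pos_bounded[OF bil] by blast
  show ?thesis
  proof (rule Bochner_Integration.integrable_bound)
    show "integrable (time \<Otimes>\<^sub>M M) (\<lambda>x. K * ((norm (Y (fst x) (snd x)))\<^sup>2 + (norm (Z (fst x) (snd x)))\<^sup>2))"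
      using Y Z by (simp add: square_integrable_def)
    show "(\<lambda>x. prod (Y (fst x) (snd x)) (Z (fst x) (snd x))) \<in> borel_measurable (time \<Otimes>\<^sub>M M)"
      using Y Z by (intro borel_measurable_bounded_bilinear[OF bil]) (auto simp: square_integrable_def)
    show "AE x in time \<Otimes>\<^sub>M M. norm (prod (Y (fst x) (snd x)) (Z (fst x) (snd x)))
        \<le> norm (K * ((norm (Y (fst x) (snd x)))\<^sup>2 + (norm (Z (fst x) (snd x)))\<^sup>2))"
    proof (rule AE_I2)
      fix x
      let ?a = "norm (Y (fst x) (snd x))" and ?b = "norm (Z (fst x) (snd x))"
      have "?a * ?b \<le> ?a\<^sup>2 + ?b\<^sup>2"
      proof -
        have "2 * (?a * ?b) \<le> ?a\<^sup>2 + ?b\<^sup>2" using sum_squares_bound[of ?a ?b] by (simp add: mult_ac)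
        moreover have "0 \<le> ?a * ?b" by simp
        ultimately show ?thesis by linarith
      qed
      then have le: "K * (?a * ?b) \<le> K * (?a\<^sup>2 + ?b\<^sup>2)" using K(1) by (intro mult_left_mono) auto
      have "norm (prod (Y (fst x) (snd x)) (Z (fst x) (snd x))) \<le> K * (?a * ?b)"
        using K(2)[of "Y (fst x) (snd x)" "Z (fst x) (snd x)"] by (simp add: mult_ac)
      also note le
      also have "K * (?a\<^sup>2 + ?b\<^sup>2) \<le> norm (K * (?a\<^sup>2 + ?b\<^sup>2))" by simp
      finally show "norm (prod (Y (fst x) (snd x)) (Z (fst x) (snd x))) \<le> norm (K * (?a\<^sup>2 + ?b\<^sup>2))" .
    qed
  qed
qed

lemma square_integrable_add:
  fixes Y Z :: "real \<Rightarrow> 'w \<Rightarrow> 'b::euclidean_space"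
  assumes Y: "square_integrable Y" and Z: "square_integrable Z"
  shows "square_integrable (\<lambda>t \<omega>. Y t \<omega> + Z t \<omega>)"
proof (rule square_integrable_dominated)
  show "integrable (time \<Otimes>\<^sub>M M) (\<lambda>x. 2 * ((norm (Y (fst x) (snd x)))\<^sup>2 + (norm (Z (fst x) (snd x)))\<^sup>2))"
    using Y Z by (simp add: square_integrable_def)
  show "(\<lambda>x. Y (fst x) (snd x) + Z (fst x) (snd x)) \<in> borel_measurable (time \<Otimes>\<^sub>M M)"
    using Y Z by (auto simp: square_integrable_def)
  show "AE x in time \<Otimes>\<^sub>M M. (norm (Y (fst x) (snd x) + Z (fst x) (snd x)))\<^sup>2
      \<le> 2 * ((norm (Y (fst x) (snd x)))\<^sup>2 + (norm (Z (fst x) (snd x)))\<^sup>2)"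
  proof (rule AE_I2)
    fix x
    let ?a = "norm (Y (fst x) (snd x))" and ?b = "norm (Z (fst x) (snd x))"
    have "(norm (Y (fst x) (snd x) + Z (fst x) (snd x)))\<^sup>2 \<le> (?a + ?b)\<^sup>2"
      by (intro power_mono norm_triangle_ineq) auto
    also have "\<dots> \<le> 2 * (?a\<^sup>2 + ?b\<^sup>2)" using sum_squares_bound[of ?a ?b] by (simp add: power2_sum)
    finally show "(norm (Y (fst x) (snd x) + Z (fst x) (snd x)))\<^sup>2 \<le> 2 * (?a\<^sup>2 + ?b\<^sup>2)" .
  qed
qed

lemma square_integrable_bilinear:
  fixes prod :: "'a::euclidean_space \<Rightarrow> 'b::euclidean_space \<Rightarrow> 'c::euclidean_space"
  assumes bil: "bounded_bilinear prod" and f: "continuous_on {0..T} f" and Y: "square_integrable Y"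
  shows "square_integrable (\<lambda>t \<omega>. prod (f t) (Y t \<omega>))"
proof -
  obtain K where K: "0 < K" "\<And>a b. norm (prod a b) \<le> norm a * norm b * K"
    using bounded_bilinear.pos_bounded[OF bil] by blast
  obtain H where H: "\<And>t. t \<in> {0..T} \<Longrightarrow> norm (f t) \<le> H"
    using compact_imp_bounded[OF compact_continuous_image[OF f compact_Icc]] unfolding bounded_iff by blast
  have f_meas: "(\<lambda>x. f (fst x)) \<in> borel_measurable (time \<Otimes>\<^sub>M M)"
  proof (rule measurable_compose[OF measurable_fst])
    have "measurable time borel = measurable (restrict_space borel {0..T}) (borel :: 'a measure)"
      by (rule measurable_cong_sets) (simp_all add: sets_restrict_space)
    then show "f \<in> borel_measurable time"
      using borel_measurable_continuous_on_restrict[OF f] by simp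
  qed
  show ?thesis
  proof (rule square_integrable_dominated)
    show "(\<lambda>x. prod (f (fst x)) (Y (fst x) (snd x))) \<in> borel_measurable (time \<Otimes>\<^sub>M M)"
      using Y by (intro borel_measurable_bounded_bilinear[OF bil] f_meas) (auto simp: square_integrable_def)
    show "integrable (time \<Otimes>\<^sub>M M) (\<lambda>x. (H * K)\<^sup>2 * (norm (Y (fst x) (snd x)))\<^sup>2)"
      using Y by (simp add: square_integrable_def)
    show "AE x in time \<Otimes>\<^sub>M M. (norm (prod (f (fst x)) (Y (fst x) (snd x))))\<^sup>2 \<le> (H * K)\<^sup>2 * (norm (Y (fst x) (snd x)))\<^sup>2"
      using AE_space
    proof eventually_elim
      fix x assume "x \<in> space (time \<Otimes>\<^sub>M M)"
      then have t: "fst x \<in> {0..T}" by (auto simp: space_pair_measure space_restrict_space)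
      have "norm (prod (f (fst x)) (Y (fst x) (snd x))) \<le> norm (f (fst x)) * norm (Y (fst x) (snd x)) * K" by (rule K(2))
      also have "\<dots> \<le> H * norm (Y (fst x) (snd x)) * K" using H[OF t] K(1) by (intro mult_right_mono) auto
      finally have "(norm (prod (f (fst x)) (Y (fst x) (snd x))))\<^sup>2 \<le> (H * norm (Y (fst x) (snd x)) * K)\<^sup>2"
        by (intro power_mono) auto
      then show "(norm (prod (f (fst x)) (Y (fst x) (snd x))))\<^sup>2 \<le> (H * K)\<^sup>2 * (norm (Y (fst x) (snd x)))\<^sup>2"
        by (simp add: power_mult_distrib mult_ac)
    qed
  qed
qed

lemma square_integrable_linear:
  fixes h :: "'a::euclidean_space \<Rightarrow> 'b::euclidean_space"
  assumes h: "bounded_linear h" and Y: "square_integrable Y"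
  shows "square_integrable (\<lambda>t \<omega>. h (Y t \<omega>))"
proof -
  have "bounded_bilinear (\<lambda>(r::real) a. r *\<^sub>R h a)"
    using bounded_bilinear.comp[OF bounded_bilinear_scaleR bounded_linear_ident h] .
  from square_integrable_bilinear[OF this continuous_on_const Y, of 1] show ?thesis by simp
qed

lemma square_integrable_const: "square_integrable (\<lambda>t \<omega>. b :: 'b::euclidean_space)"
proof -
  interpret f: finite_measure "time \<Otimes>\<^sub>M M" by (rule finite_pair_time)
  show ?thesis by (simp add: square_integrable_def)
qed

lemma square_integrable_integrable:
  fixes Y :: "real \<Rightarrow> 'w \<Rightarrow> real"
  shows "square_integrable Y \<Longrightarrow> integrable (time \<Otimes>\<^sub>M M) (\<lambda>x. Y (fst x) (snd x))"
  using square_integrable_product[OF bounded_bilinear_mult _ square_integrable_const[of 1], of Y] by simp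

lemma square_integrable_sum:
  fixes Y :: "'i \<Rightarrow> real \<Rightarrow> 'w \<Rightarrow> 'b::euclidean_space"
  assumes "finite I" "\<And>k. k \<in> I \<Longrightarrow> square_integrable (Y k)"
  shows "square_integrable (\<lambda>t \<omega>. \<Sum>k\<in>I. Y k t \<omega>)"
  using assms by (induction I rule: finite_induct) (auto intro: square_integrable_add square_integrable_const)

lemma square_integrable_W: "square_integrable (W i)"
proof -
  interpret P: pair_sigma_finite time M by (rule pair_time)
  have meas: "(\<lambda>x. W i (fst x) (snd x)) \<in> borel_measurable (time \<Otimes>\<^sub>M M)"
    by (rule progressive_product[OF progressive_W])
  have "integrable (time \<Otimes>\<^sub>M M) (\<lambda>x. (W i (fst x) (snd x))\<^sup>2)"
  proof (rule P.Fubini_integrable)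
    show "(\<lambda>x. (W i (fst x) (snd x))\<^sup>2) \<in> borel_measurable (time \<Otimes>\<^sub>M M)" using meas by measurable
    have "integrable time (\<lambda>t. t)" unfolding integrable_time by (intro borel_integrable_atLeastAtMost' continuous_intros)
    then show "integrable time (\<lambda>t. LINT \<omega>|M. norm ((W i (fst (t, \<omega>)) (snd (t, \<omega>)))\<^sup>2))"
      by (rule Bochner_Integration.integrable_cong[THEN iffD1, rotated -1])
        (auto simp: space_restrict_space W_second_moment(2))
    show "AE t in time. integrable M (\<lambda>\<omega>. (W i (fst (t, \<omega>)) (snd (t, \<omega>)))\<^sup>2)"
      using W_second_moment(1) by (intro AE_I2) (auto simp: space_restrict_space)
  qed
  with meas show ?thesis by (simp add: square_integrable_def)
qed

lemma square_integrable_noise_vector: "square_integrable (noise_vector \<sigma>)"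
  unfolding noise_vector_eq_sum
  by (intro square_integrable_sum square_integrable_linear[OF bounded_linear_scaleR_left square_integrable_W]) simp

lemma admissible_square_integrable:
  assumes "\<alpha> \<in> admissible_controls T M W"
  shows "progressive \<alpha>" "square_integrable \<alpha>"
proof -
  interpret P: pair_sigma_finite time M by (rule pair_time)
  show prog: "progressive \<alpha>" using assms by (simp add: admissible_controls_def)
  have meas: "(\<lambda>x. \<alpha> (fst x) (snd x)) \<in> borel_measurable (time \<Otimes>\<^sub>M M)" by (rule progressive_product[OF prog])
  have "(\<integral>\<^sup>+x. ennreal (norm ((norm (\<alpha> (fst x) (snd x)))\<^sup>2)) \<partial>(time \<Otimes>\<^sub>M M))
      = (\<integral>\<^sup>+\<omega>. (\<integral>\<^sup>+t. ennreal ((\<alpha> t \<omega>)\<^sup>2) \<partial>time) \<partial>M)"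
    using P.nn_integral_snd[of "\<lambda>x. ennreal ((\<alpha> (fst x) (snd x))\<^sup>2)"] meas by simp
  also have "\<dots> = (\<integral>\<^sup>+\<omega>. (\<integral>\<^sup>+t\<in>{0..T}. ennreal ((\<alpha> t \<omega>)\<^sup>2) \<partial>lborel) \<partial>M)"
    by (simp add: nn_integral_restrict_space)
  also have "\<dots> < \<infinity>" using assms by (simp add: admissible_controls_def)
  finally have "integrable (time \<Otimes>\<^sub>M M) (\<lambda>x. (norm (\<alpha> (fst x) (snd x)))\<^sup>2)"
    using meas by (intro integrableI_bounded) auto
  with meas show "square_integrable \<alpha>" by (simp add: square_integrable_def)
qed

text \<open>The pathwise growth bound is integrated; it bounds the state by the noise at the same time
  and by an integrable random variable that does not depend on time.\<close>

lemma linear_state_square_integrable: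
  fixes A :: "real \<Rightarrow> real^'n^'n" and e x\<^sub>0 :: "real^'n"
  assumes A: "continuous_on {0..T} A" and \<beta>: "square_integrable \<beta>" and e: "norm e \<le> 1"
    and X: "progressive X"
    and sol: "AE \<omega> in M. continuous_on {0..T} (\<lambda>t. X t \<omega>) \<and>
    (\<forall>t\<in>{0..T}. X t \<omega> = x\<^sub>0 + (LINT s:{0..t}|lborel. A s *v X s \<omega> + \<beta> s \<omega> *\<^sub>R e) + noise_vector \<sigma> t \<omega>)"
  shows "square_integrable X" "integrable M (\<lambda>\<omega>. (norm (X T \<omega>))\<^sup>2)"
proof -
  obtain K where K: "0 \<le> K" "\<And>s v. s \<in> {0..T} \<Longrightarrow> norm (A s *v v) \<le> K * norm v"
    using matrix_path_bound[OF A] by blast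
  define C1 where "C1 = 4 * (exp (K * T))\<^sup>2 * (norm x\<^sub>0)\<^sup>2"
  \<comment> \<open>The constants of \<open>linear_state_growth_square\<close>; \<open>Env\<close> collects the integrals over the whole
    horizon.\<close>
  define C2 where "C2 = 4 * (exp (K * T))\<^sup>2 * T * (2 + 2 * K\<^sup>2)"
  define Env where "Env = (\<lambda>\<omega>. LINT s:{0..T}|lborel. (\<beta> s \<omega>)\<^sup>2 + (norm (noise_vector \<sigma> s \<omega>))\<^sup>2)"
  have \<beta>2: "integrable (time \<Otimes>\<^sub>M M) (\<lambda>x. (\<beta> (fst x) (snd x))\<^sup>2)"
    using \<beta> by (simp add: square_integrable_def)
  have w2: "integrable (time \<Otimes>\<^sub>M M) (\<lambda>x. (norm (noise_vector \<sigma> (fst x) (snd x)))\<^sup>2)"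
    using square_integrable_noise_vector by (simp add: square_integrable_def)
  have Env: "integrable M Env"
    unfolding Env_def using \<beta>2 w2 by (intro integrable_product_paths(2)) simp
  have bound: "AE \<omega> in M. \<forall>t\<in>{0..T}. (norm (X t \<omega>))\<^sup>2 \<le> 2 * (norm (noise_vector \<sigma> t \<omega>))\<^sup>2 + C1 + C2 * Env \<omega>"
    using sol AE_space integrable_product_paths(1)[OF square_integrable_integrable[OF \<beta>]] integrable_product_paths(1)[OF \<beta>2]
  proof eventually_elim
    fix \<omega> assume s: "continuous_on {0..T} (\<lambda>t. X t \<omega>) \<and>
      (\<forall>t\<in>{0..T}. X t \<omega> = x\<^sub>0 + (LINT s:{0..t}|lborel. A s *v X s \<omega> + \<beta> s \<omega> *\<^sub>R e) + noise_vector \<sigma> t \<omega>)"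
      and \<omega>: "\<omega> \<in> space M" and b: "set_integrable lborel {0..T} (\<lambda>t. \<beta> t \<omega>)" "set_integrable lborel {0..T} (\<lambda>t. (\<beta> t \<omega>)\<^sup>2)"
    show "\<forall>t\<in>{0..T}. (norm (X t \<omega>))\<^sup>2 \<le> 2 * (norm (noise_vector \<sigma> t \<omega>))\<^sup>2 + C1 + C2 * Env \<omega>"
    proof
      fix t assume t: "t \<in> {0..T}"
      show "(norm (X t \<omega>))\<^sup>2 \<le> 2 * (norm (noise_vector \<sigma> t \<omega>))\<^sup>2 + C1 + C2 * Env \<omega>"
        unfolding C1_def C2_def Env_def
        by (rule linear_state_growth_square[OF horizon A K _ noise_vector_continuous[OF \<omega>] b e _ t]) (use s in auto)
    qed
  qed
  show "square_integrable X"
  proof (rule square_integrable_dominated[OF progressive_product[OF X]])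
    interpret f: finite_measure "time \<Otimes>\<^sub>M M" by (rule finite_pair_time)
    show "integrable (time \<Otimes>\<^sub>M M) (\<lambda>x. 2 * (norm (noise_vector \<sigma> (fst x) (snd x)))\<^sup>2 + C1 + C2 * Env (snd x))"
      using w2 integrable_product_of_integrable[OF Env] by simp
    show "AE x in time \<Otimes>\<^sub>M M. (norm (X (fst x) (snd x)))\<^sup>2 \<le> 2 * (norm (noise_vector \<sigma> (fst x) (snd x)))\<^sup>2 + C1 + C2 * Env (snd x)"
      using AE_product_of_AE[OF bound] AE_space
      by eventually_elim (auto simp: space_pair_measure space_restrict_space)
  qed
  have TT: "T \<in> {0..T}" using horizon by simp
  have XT: "X T \<in> borel_measurable M"
    by (rule measurable_from_subalg[OF _ progressive_section[OF X TT]])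
      (use filtration_subset[of T] in \<open>auto simp: subalgebra_def\<close>)
  have "(norm (noise_vector \<sigma> T \<omega>))\<^sup>2 = (\<Sum>j\<in>UNIV. \<sigma>\<^sup>2 * (W j T \<omega>)\<^sup>2)" for \<omega>
    by (simp add: noise_vector_def norm_vec_def L2_set_def sum_nonneg power_mult_distrib)
  then have wT: "integrable M (\<lambda>\<omega>. (norm (noise_vector \<sigma> T \<omega>))\<^sup>2)"
    using W_second_moment(1)[OF TT] by simp
  show "integrable M (\<lambda>\<omega>. (norm (X T \<omega>))\<^sup>2)"
  proof (rule Bochner_Integration.integrable_bound)
    show "integrable M (\<lambda>\<omega>. 2 * (norm (noise_vector \<sigma> T \<omega>))\<^sup>2 + C1 + C2 * Env \<omega>)"
      using wT Env by simp
    show "AE \<omega> in M. norm ((norm (X T \<omega>))\<^sup>2) \<le> norm (2 * (norm (noise_vector \<sigma> T \<omega>))\<^sup>2 + C1 + C2 * Env \<omega>)"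
      using bound by eventually_elim (use TT in force)
  qed (use XT in measurable)
qed

end

section \<open>The Nash property\<close>

locale noisy_game = brownian_noise M T W + riccati_game L T a q \<epsilon> c G
  for M :: "'w measure" and T :: real and W :: "'n::finite \<Rightarrow> real \<Rightarrow> 'w \<Rightarrow> real"
    and L :: "real^'n^'n" and a q \<epsilon> c :: real and G :: "'n \<Rightarrow> real \<Rightarrow> real^'n^'n" +
  fixes \<sigma> :: real and x\<^sub>0 :: "real^'n"
begin

text \<open>The players in \<open>S\<close> use the equilibrium feedback and all others use the same control \<open>\<alpha>\<close>.
  Only two instances occur: everybody, and everybody except one deviating player.\<close>

definition profile :: "'n set \<Rightarrow> (real \<Rightarrow> 'w \<Rightarrow> real) \<Rightarrow> 'n \<Rightarrow> ('w, 'n) strategy" where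
  "profile S \<alpha> j = (if j \<in> S then feedback (equilibrium j) else open_loop \<alpha>)"

text \<open>The direction in which the control \<open>\<alpha>\<close> acts on the state.\<close>

definition outsiders :: "'n set \<Rightarrow> real^'n" where
  "outsiders S = (\<chi> j. if j \<in> S then 0 else 1)"

lemma drift_cont: "continuous_on {0..T} (game_drift L a q G S)"
  by (rule continuous_on_game_drift) (rule G_continuous)

lemma equilibrium_continuous:
  "continuous_on {0..T} x \<Longrightarrow> continuous_on {0..T} (\<lambda>t. equilibrium i t (x t))"
  by (intro continuous_intros G_continuous)

text \<open>The state equation in vector form, to which the linear theory applies.\<close>

lemma state_process_iff:
  assumes \<alpha>: "AE \<omega> in M. set_integrable lborel {0..T} (\<lambda>s. \<alpha> s \<omega>)"
  shows "state_process L T a \<sigma> x\<^sub>0 M W (profile S \<alpha>) X \<longleftrightarrow>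
    progressive X \<and> (AE \<omega> in M. continuous_on {0..T} (\<lambda>t. X t \<omega>) \<and>
    (\<forall>t\<in>{0..T}. X t \<omega> = x\<^sub>0 + (LINT s:{0..t}|lborel. game_drift L a q G S s *v X s \<omega> + \<alpha> s \<omega> *\<^sub>R outsiders S)
       + noise_vector \<sigma> t \<omega>))"
    (is "_ \<longleftrightarrow> _ \<and> (AE \<omega> in M. ?R \<omega>)")
proof -
  let ?L = "\<lambda>\<omega>. continuous_on {0..T} (\<lambda>t. X t \<omega>) \<and>
        (\<forall>i. set_integrable lborel {0..T} (\<lambda>s. profile S \<alpha> i s \<omega> (X s \<omega>)) \<and>
          (\<forall>t\<in>{0..T}. X t \<omega> $ i = x\<^sub>0 $ i
               + (LINT s:{0..t}|lborel. profile S \<alpha> i s \<omega> (X s \<omega>) - a * (L *v X s \<omega>) $ i) + \<sigma> * W i t \<omega>))"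
  have "AE \<omega> in M. ?L \<omega> \<longleftrightarrow> ?R \<omega>"
    using \<alpha>
  proof eventually_elim
    fix \<omega> assume \<alpha>: "set_integrable lborel {0..T} (\<lambda>s. \<alpha> s \<omega>)"
    show "?L \<omega> \<longleftrightarrow> ?R \<omega>"
    proof (cases "continuous_on {0..T} (\<lambda>t. X t \<omega>)")
      case True
      let ?v = "\<lambda>s. game_drift L a q G S s *v X s \<omega> + \<alpha> s \<omega> *\<^sub>R outsiders S"
      have v_int: "set_integrable lborel {0..T} ?v"
        by (intro set_integral_add(1)[OF _ set_integrable_scaleR_left[OF \<alpha>]] borel_integrable_atLeastAtMost'
            continuous_intros drift_cont True)
      have u_int: "set_integrable lborel {0..T} (\<lambda>s. profile S \<alpha> i s \<omega> (X s \<omega>))" for i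
      proof (cases "i \<in> S")
        case i: True
        show ?thesis
          using borel_integrable_atLeastAtMost'[OF equilibrium_continuous[OF True, of i]] i
          by (simp add: profile_def feedback_def)
      qed (use \<alpha> in \<open>simp add: profile_def open_loop_def\<close>)
      have nth: "?v s $ i = profile S \<alpha> i s \<omega> (X s \<omega>) - a * (L *v X s \<omega>) $ i" for s i
        by (simp add: game_drift_vector_nth profile_def feedback_def open_loop_def outsiders_def)
      have comp: "(LINT s:{0..t}|lborel. ?v s) $ i
          = (LINT s:{0..t}|lborel. profile S \<alpha> i s \<omega> (X s \<omega>) - a * (L *v X s \<omega>) $ i)" if "t \<in> {0..T}" for t i
      proof -
        have "set_integrable lborel {0..t} ?v" by (rule set_integrable_subset[OF v_int]) (use that in auto)
        from integral_bounded_linear[OF bounded_linear_vec_nth[of i] this[unfolded set_integrable_def]]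
        show ?thesis unfolding nth[symmetric] by (simp add: set_lebesgue_integral_def)
      qed
      have "X t \<omega> = x\<^sub>0 + (LINT s:{0..t}|lborel. ?v s) + noise_vector \<sigma> t \<omega> \<longleftrightarrow>
        (\<forall>i. X t \<omega> $ i = x\<^sub>0 $ i
               + (LINT s:{0..t}|lborel. profile S \<alpha> i s \<omega> (X s \<omega>) - a * (L *v X s \<omega>) $ i) + \<sigma> * W i t \<omega>)"
        if "t \<in> {0..T}" for t
        unfolding vec_eq_iff by (simp only: vector_add_component comp[OF that] noise_vector_def vec_lambda_beta)
      then show ?thesis using True u_int by blast
    qed blast
  qed
  then have "(AE \<omega> in M. ?L \<omega>) \<longleftrightarrow> (AE \<omega> in M. ?R \<omega>)" by (rule eventually_subst)
  then show ?thesis by (simp only: state_process_def)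
qed

lemma outsiders_UNIV: "outsiders UNIV = 0"
  by (simp add: outsiders_def vec_eq_iff)

lemma outsiders_remove: "outsiders (UNIV - {i}) = axis i 1"
  by (auto simp: outsiders_def axis_def vec_eq_iff)

lemma profile_UNIV: "profile UNIV \<alpha> = (\<lambda>j. feedback (equilibrium j))"
  by (auto simp: profile_def fun_eq_iff)

lemma profile_remove: "profile (UNIV - {i}) \<alpha> = (\<lambda>j. feedback (equilibrium j))(i := open_loop \<alpha>)"
  by (auto simp: profile_def fun_eq_iff)

lemma cost_integrable:
  assumes u: "square_integrable u" and X: "square_integrable X" "progressive X" "integrable M (\<lambda>\<omega>. (norm (X T \<omega>))\<^sup>2)"
  shows "integrable M (\<lambda>\<omega>. (LINT t:{0..T}|lborel. running_cost L q \<epsilon> i (u t \<omega>) (X t \<omega>)) + c/2 * ((L *v X T \<omega>) $ i)\<^sup>2)"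
proof -
  have blin: "bounded_linear (\<lambda>x. (L *v x) $ i)"
    by (rule bounded_linear_compose[OF bounded_linear_vec_nth matrix_vector_mul_bounded_linear])
  have y: "square_integrable (\<lambda>t \<omega>. (L *v X t \<omega>) $ i)"
    by (rule square_integrable_linear[OF blin X(1)])
  have "integrable (time \<Otimes>\<^sub>M M) (\<lambda>x. running_cost L q \<epsilon> i (u (fst x) (snd x)) (X (fst x) (snd x)))"
    unfolding running_cost_def power2_eq_square mult.assoc
    using square_integrable_product[OF bounded_bilinear_mult u u] square_integrable_product[OF bounded_bilinear_mult u y]
      square_integrable_product[OF bounded_bilinear_mult y y]
    by simp
  note run = integrable_product_paths(2)[OF this]
  have TT: "T \<in> {0..T}" using horizon by simp
  have XT: "X T \<in> borel_measurable M"
    by (rule measurable_from_subalg[OF _ progressive_section[OF X(2) TT]])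
      (use filtration_subset[of T] in \<open>auto simp: subalgebra_def\<close>)
  obtain K where K: "\<And>x. norm ((L *v x) $ i) \<le> norm x * K"
    using bounded_linear.bounded[OF blin] by blast
  have "integrable M (\<lambda>\<omega>. ((L *v X T \<omega>) $ i)\<^sup>2)"
  proof (rule Bochner_Integration.integrable_bound)
    show "integrable M (\<lambda>\<omega>. K\<^sup>2 * (norm (X T \<omega>))\<^sup>2)" using X(3) by simp
    have "(\<lambda>\<omega>. (L *v X T \<omega>) $ i) \<in> borel_measurable M"
      by (rule measurable_compose[OF XT borel_measurable_continuous_onI[OF linear_continuous_on[OF blin]]])
    then show "(\<lambda>\<omega>. ((L *v X T \<omega>) $ i)\<^sup>2) \<in> borel_measurable M" by measurable
    show "AE \<omega> in M. norm (((L *v X T \<omega>) $ i)\<^sup>2) \<le> norm (K\<^sup>2 * (norm (X T \<omega>))\<^sup>2)"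
    proof (rule AE_I2)
      fix \<omega>
      have "(norm ((L *v X T \<omega>) $ i))\<^sup>2 \<le> (norm (X T \<omega>) * K)\<^sup>2" by (rule power_mono[OF K]) simp
      then show "norm (((L *v X T \<omega>) $ i)\<^sup>2) \<le> norm (K\<^sup>2 * (norm (X T \<omega>))\<^sup>2)"
        by (simp add: power_mult_distrib mult.commute)
    qed
  qed
  with run show ?thesis by simp
qed

text \<open>By Fubini's theorem the expectation may be taken at each time, where the adjoint rate is
  measurable with respect to the past and the remaining increment of the noise is centred and
  independent of it.\<close>

lemma adjoint_noise_expectation:
  assumes \<alpha>: "progressive \<alpha>" "square_integrable \<alpha>" and X: "progressive X" "square_integrable X"
    and Y: "progressive Y" "square_integrable Y"
  shows "integrable M (\<lambda>\<omega>. LINT t:{0..T}|lborel.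
       adjoint_rate i t (\<alpha> t \<omega>) (X t \<omega>) (Y t \<omega>) \<bullet> (noise_vector \<sigma> T \<omega> - noise_vector \<sigma> t \<omega>))"
    and "expectation (\<lambda>\<omega>. LINT t:{0..T}|lborel.
       adjoint_rate i t (\<alpha> t \<omega>) (X t \<omega>) (Y t \<omega>) \<bullet> (noise_vector \<sigma> T \<omega> - noise_vector \<sigma> t \<omega>)) = 0"
proof -
  have \<rho>_eq: "adjoint_rate i t u x y = G_rate i t *v (y + (- 1) *\<^sub>R x)
     + G i t *v (deviation_drift i t *v (y + (- 1) *\<^sub>R x)
        + (u + q * (L *v x) $ i + (G i t *v x) $ i) *\<^sub>R axis i 1)" for t u x y
    by (simp add: adjoint_rate_def algebra_simps)
  define \<rho> where "\<rho> = (\<lambda>t \<omega>. adjoint_rate i t (\<alpha> t \<omega>) (X t \<omega>) (Y t \<omega>))"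
  note mv = bounded_bilinear_matrix_vector_mult
  have lin: "bounded_linear (\<lambda>x::real^'n. q * (L *v x) $ i)" "bounded_linear (\<lambda>x::real^'n. (- 1) *\<^sub>R x)"
    by (intro bounded_linear_const_mult bounded_linear_compose[OF bounded_linear_vec_nth matrix_vector_mul_bounded_linear])
      (rule bounded_linear_scaleR_right)
  have \<rho>_prog: "progressive \<rho>"
    unfolding \<rho>_def \<rho>_eq
    by (intro progressive_add progressive_bilinear[OF mv] G_rate_continuous G_continuous drift_cont \<alpha>(1) X(1) Y(1)
        progressive_bounded_linear[OF bounded_linear_scaleR_left] progressive_bounded_linear[OF lin(1)]
        progressive_bounded_linear[OF lin(2)] progressive_bounded_linear[OF bounded_linear_vec_nth])
  have \<rho>_sq: "square_integrable \<rho>"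
    unfolding \<rho>_def \<rho>_eq
    by (intro square_integrable_add square_integrable_bilinear[OF mv] G_rate_continuous G_continuous drift_cont \<alpha>(2) X(2) Y(2)
        square_integrable_linear[OF bounded_linear_scaleR_left] square_integrable_linear[OF lin(1)]
        square_integrable_linear[OF lin(2)] square_integrable_linear[OF bounded_linear_vec_nth])
  have TT: "T \<in> {0..T}" using horizon by simp
  have incr_sq: "square_integrable (\<lambda>t \<omega>. noise_vector \<sigma> T \<omega> - noise_vector \<sigma> t \<omega>)"
  proof -
    have WT: "square_integrable (\<lambda>t. W j T)" for j
      unfolding square_integrable_def
      using integrable_product_of_integrable[OF W_second_moment(1)[OF TT, of j]]
        measurable_compose[OF measurable_snd W_measurable[OF TT, of j]] by simp
    have "square_integrable (\<lambda>t. noise_vector \<sigma> T)"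
      unfolding noise_vector_eq_sum
      by (intro square_integrable_sum square_integrable_linear[OF bounded_linear_scaleR_left WT]) simp
    from square_integrable_add[OF this square_integrable_linear[OF lin(2) square_integrable_noise_vector[of \<sigma>]]]
    show ?thesis by simp
  qed
  note prod_int = square_integrable_product[OF bounded_bilinear_inner \<rho>_sq incr_sq]
  show "integrable M (\<lambda>\<omega>. LINT t:{0..T}|lborel.
       adjoint_rate i t (\<alpha> t \<omega>) (X t \<omega>) (Y t \<omega>) \<bullet> (noise_vector \<sigma> T \<omega> - noise_vector \<sigma> t \<omega>))"
    using integrable_product_paths(2)[OF prod_int] by (simp add: \<rho>_def)
  have zero: "AE t in time. (LINT \<omega>|M. \<rho> t \<omega> \<bullet> (noise_vector \<sigma> T \<omega> - noise_vector \<sigma> t \<omega>)) = 0"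
  proof -
    have "AE t in time. \<forall>k\<in>UNIV. integrable M (\<lambda>\<omega>. \<rho> t \<omega> $ k)"
    proof (rule AE_finite_allI)
      fix k
      show "AE t in time. integrable M (\<lambda>\<omega>. \<rho> t \<omega> $ k)"
        by (rule integrable_product_paths(3)[OF square_integrable_integrable[OF square_integrable_linear[OF bounded_linear_vec_nth \<rho>_sq]]])
    qed simp
    with AE_space show ?thesis
    proof eventually_elim
      fix t assume "t \<in> space time" and int: "\<forall>k\<in>UNIV. integrable M (\<lambda>\<omega>. \<rho> t \<omega> $ k)"
      then have t: "t \<in> {0..T}" by (simp add: space_restrict_space)
      have meas: "(\<lambda>\<omega>. \<rho> t \<omega> $ k) \<in> borel_measurable (filtration t)" for k
        by (rule progressive_section[OF progressive_bounded_linear[OF bounded_linear_vec_nth \<rho>_prog] t])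
      have "(LINT \<omega>|M. \<rho> t \<omega> \<bullet> (noise_vector \<sigma> T \<omega> - noise_vector \<sigma> t \<omega>))
          = (LINT \<omega>|M. (\<Sum>k\<in>UNIV. \<sigma> * (\<rho> t \<omega> $ k * (W k T \<omega> - W k t \<omega>))))"
        by (simp add: inner_vec_def noise_vector_def algebra_simps)
      also have "\<dots> = (\<Sum>k\<in>UNIV. LINT \<omega>|M. \<sigma> * (\<rho> t \<omega> $ k * (W k T \<omega> - W k t \<omega>)))"
        using expectation_adapted_increment(1)[OF t meas] int by (intro Bochner_Integration.integral_sum) simp
      also have "\<dots> = 0"
        using expectation_adapted_increment(2)[OF t meas] int by (intro sum.neutral) simp
      finally show "(LINT \<omega>|M. \<rho> t \<omega> \<bullet> (noise_vector \<sigma> T \<omega> - noise_vector \<sigma> t \<omega>)) = 0" .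
    qed
  qed
  have "(LINT t:{0..T}|lborel. (LINT \<omega>|M. \<rho> t \<omega> \<bullet> (noise_vector \<sigma> T \<omega> - noise_vector \<sigma> t \<omega>))) = 0"
    unfolding integral_time[symmetric] by (rule integral_eq_zero_AE[OF zero])
  then show "expectation (\<lambda>\<omega>. LINT t:{0..T}|lborel.
       adjoint_rate i t (\<alpha> t \<omega>) (X t \<omega>) (Y t \<omega>) \<bullet> (noise_vector \<sigma> T \<omega> - noise_vector \<sigma> t \<omega>)) = 0"
    using integrable_product_paths(4)[OF prod_int] by (simp add: \<rho>_def)
qed

lemma equilibrium_markovian: "markovian_strategy T (equilibrium i)"
  unfolding markovian_strategy_def
proof
  have G_fst: "continuous_on ({0..T} \<times> UNIV) (\<lambda>p::real \<times> (real^'n). G i (fst p))"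
  proof -
    have sub: "fst ` ({0..T} \<times> (UNIV :: (real^'n) set)) \<subseteq> {0..T}" by auto
    have "continuous_on ({0..T} \<times> (UNIV :: (real^'n) set)) fst" by (rule continuous_on_fst[OF continuous_on_id])
    from continuous_on_compose2[OF G_continuous this sub] show ?thesis .
  qed
  show "(\<lambda>(t, x). equilibrium i t x) \<in> borel_measurable (restrict_space borel ({0..T} \<times> UNIV))"
    unfolding case_prod_beta
    by (intro borel_measurable_continuous_on_restrict continuous_intros G_fst)
  have QG: "continuous_on {0..T} (\<lambda>t. q *\<^sub>R L + G i t)" by (intro continuous_intros G_continuous)
  obtain K where K: "0 \<le> K" "\<And>s v. s \<in> {0..T} \<Longrightarrow> norm ((q *\<^sub>R L + G i s) *v v) \<le> K * norm v"
    using matrix_path_bound[OF QG] by blast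
  show "bdd_above ((\<lambda>(t, x). \<bar>equilibrium i t x\<bar> / (1 + norm x)) ` ({0..T} \<times> UNIV))"
  proof (rule bdd_aboveI2, safe)
    fix t :: real and x :: "real^'n" assume t: "t \<in> {0..T}"
    have "equilibrium i t x = - (((q *\<^sub>R L + G i t) *v x) $ i)" by (simp add: matrix_vector_simps)
    then have "\<bar>equilibrium i t x\<bar> \<le> norm ((q *\<^sub>R L + G i t) *v x)"
      using component_le_norm_cart[of "(q *\<^sub>R L + G i t) *v x" i] by simp
    also have "\<dots> \<le> K * norm x" by (rule K(2)[OF t])
    also have "\<dots> \<le> K * (1 + norm x)" using K(1) by (intro mult_left_mono) auto
    finally have "\<bar>equilibrium i t x\<bar> \<le> K * (1 + norm x)" .
    moreover have "0 < 1 + norm x" using norm_ge_zero[of x] by linarith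
    ultimately show "\<bar>equilibrium i t x\<bar> / (1 + norm x) \<le> K" by (simp add: pos_divide_le_eq)
  qed
qed

lemma closed_loop_state:
  assumes "state_process L T a \<sigma> x\<^sub>0 M W (\<lambda>j. feedback (equilibrium j)) X"
  shows "progressive X \<and> (AE \<omega> in M. continuous_on {0..T} (\<lambda>t. X t \<omega>) \<and>
    (\<forall>t\<in>{0..T}. X t \<omega> = x\<^sub>0 + (LINT s:{0..t}|lborel. closed_drift s *v X s \<omega>) + noise_vector \<sigma> t \<omega>))"
  using assms state_process_iff[of "\<lambda>_ _. 0" UNIV X] by (simp add: profile_UNIV outsiders_UNIV set_integrable_def)

text \<open>Expectations are taken in \<open>pathwise_comparison\<close>, whose adjoint term has mean zero.\<close>

theorem equilibrium_is_nash: "markovian_nash L T a q \<epsilon> c \<sigma> x\<^sub>0 M W equilibrium"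
  unfolding markovian_nash_def Let_def
proof (intro conjI allI ballI equilibrium_markovian)
  have zero_prog: "progressive (\<lambda>t \<omega>. 0 :: real)" by (rule progressive_const)
  show "\<exists>X. state_process L T a \<sigma> x\<^sub>0 M W (\<lambda>j. feedback (equilibrium j)) X"
    using linear_state_exists[OF drift_cont[of UNIV] zero_prog, where e="outsiders UNIV" and x\<^sub>0=x\<^sub>0 and \<sigma>=\<sigma>]
      state_process_iff[of "\<lambda>_ _. 0" UNIV] by (simp add: profile_UNIV set_integrable_def)
  fix i \<alpha> assume adm: "\<alpha> \<in> admissible_controls T M W"
  note \<alpha> = admissible_square_integrable[OF adm]
  have \<alpha>_int: "AE \<omega> in M. set_integrable lborel {0..T} (\<lambda>t. \<alpha> t \<omega>)"
    by (rule integrable_product_paths(1)[OF square_integrable_integrable[OF \<alpha>(2)]])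
  have \<alpha>2_int: "AE \<omega> in M. set_integrable lborel {0..T} (\<lambda>t. (\<alpha> t \<omega>)\<^sup>2)"
    using \<alpha>(2) by (intro integrable_product_paths(1)) (simp add: square_integrable_def)
  note dev_iff = state_process_iff[OF \<alpha>_int, of "UNIV - {i}", unfolded profile_remove outsiders_remove]
  show "\<exists>Y. state_process L T a \<sigma> x\<^sub>0 M W ((\<lambda>j. feedback (equilibrium j))(i := open_loop \<alpha>)) Y"
    unfolding dev_iff by (rule linear_state_exists[OF drift_cont \<alpha>(1) \<alpha>_int])
  fix X Y
  show "state_process L T a \<sigma> x\<^sub>0 M W (\<lambda>j. feedback (equilibrium j)) X \<longrightarrow>
     state_process L T a \<sigma> x\<^sub>0 M W ((\<lambda>j. feedback (equilibrium j))(i := open_loop \<alpha>)) Y \<longrightarrow>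
     game_cost L T q \<epsilon> c M i (\<lambda>j. feedback (equilibrium j)) X
      \<le> game_cost L T q \<epsilon> c M i ((\<lambda>j. feedback (equilibrium j))(i := open_loop \<alpha>)) Y"
  proof (intro impI)
    assume "state_process L T a \<sigma> x\<^sub>0 M W (\<lambda>j. feedback (equilibrium j)) X"
    note X = closed_loop_state[OF this, THEN conjunct1] closed_loop_state[OF this, THEN conjunct2]
    assume "state_process L T a \<sigma> x\<^sub>0 M W ((\<lambda>j. feedback (equilibrium j))(i := open_loop \<alpha>)) Y"
    note Y = this[unfolded dev_iff, THEN conjunct1] this[unfolded dev_iff, THEN conjunct2]
    have X_sq: "square_integrable X" "integrable M (\<lambda>\<omega>. (norm (X T \<omega>))\<^sup>2)"
      using linear_state_square_integrable[OF drift_cont[of UNIV] square_integrable_const[of "0::real"], of "0 :: real^'n" X x\<^sub>0 \<sigma>] X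
      by simp_all
    have "norm (axis i 1 :: real^'n) \<le> 1" by (simp add: norm_axis_1)
    note Y_sq = linear_state_square_integrable[OF drift_cont \<alpha>(2) this Y]
    define u where "u = (\<lambda>t \<omega>. equilibrium i t (X t \<omega>))"
    have u_sq: "square_integrable u"
    proof -
      have QG: "continuous_on {0..T} (\<lambda>t. - (q *\<^sub>R L + G i t))" by (intro continuous_intros G_continuous)
      have "u = (\<lambda>t \<omega>. ((- (q *\<^sub>R L + G i t)) *v X t \<omega>) $ i)"
        by (simp add: u_def fun_eq_iff matrix_vector_simps)
      then show ?thesis
        using square_integrable_linear[OF bounded_linear_vec_nth
          square_integrable_bilinear[OF bounded_bilinear_matrix_vector_mult QG X_sq(1)], of i] by simp
    qed
    define CX where "CX = (\<lambda>\<omega>. (LINT t:{0..T}|lborel. running_cost L q \<epsilon> i (u t \<omega>) (X t \<omega>)) + c/2 * ((L *v X T \<omega>) $ i)\<^sup>2)"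
    define CY where "CY = (\<lambda>\<omega>. (LINT t:{0..T}|lborel. running_cost L q \<epsilon> i (\<alpha> t \<omega>) (Y t \<omega>)) + c/2 * ((L *v Y T \<omega>) $ i)\<^sup>2)"
    define D where "D = (\<lambda>\<omega>. LINT t:{0..T}|lborel.
       adjoint_rate i t (\<alpha> t \<omega>) (X t \<omega>) (Y t \<omega>) \<bullet> (noise_vector \<sigma> T \<omega> - noise_vector \<sigma> t \<omega>))"
    have CX: "integrable M CX" unfolding CX_def by (rule cost_integrable[OF u_sq X_sq(1) X(1) X_sq(2)])
    have CY: "integrable M CY" unfolding CY_def by (rule cost_integrable[OF \<alpha>(2) Y_sq(1) Y(1) Y_sq(2)])
    have D: "integrable M D" "expectation D = 0"
      unfolding D_def by (rule adjoint_noise_expectation[OF \<alpha> X(1) X_sq(1) Y(1) Y_sq(1)])+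
    have "AE \<omega> in M. CX \<omega> + D \<omega> \<le> CY \<omega>"
      using X(2) Y(2) \<alpha>_int \<alpha>2_int AE_space
    proof eventually_elim
      fix \<omega>
      assume x: "continuous_on {0..T} (\<lambda>t. X t \<omega>) \<and>
          (\<forall>t\<in>{0..T}. X t \<omega> = x\<^sub>0 + (LINT s:{0..t}|lborel. closed_drift s *v X s \<omega>) + noise_vector \<sigma> t \<omega>)"
        and y: "continuous_on {0..T} (\<lambda>t. Y t \<omega>) \<and>
          (\<forall>t\<in>{0..T}. Y t \<omega> = x\<^sub>0 + (LINT s:{0..t}|lborel. deviation_drift i s *v Y s \<omega> + \<alpha> s \<omega> *\<^sub>R axis i 1) + noise_vector \<sigma> t \<omega>)"
        and al: "set_integrable lborel {0..T} (\<lambda>t. \<alpha> t \<omega>)" "set_integrable lborel {0..T} (\<lambda>t. (\<alpha> t \<omega>)\<^sup>2)"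
        and \<omega>: "\<omega> \<in> space M"
      show "CX \<omega> + D \<omega> \<le> CY \<omega>"
        unfolding CX_def CY_def D_def u_def
        by (rule pathwise_comparison(2)[OF _ _ noise_vector_continuous[OF \<omega>] al]) (use x y in auto)
    qed
    then have "expectation (\<lambda>\<omega>. CX \<omega> + D \<omega>) \<le> expectation CY"
      using CX CY D(1) by (intro integral_mono_AE) auto
    then have "expectation CX \<le> expectation CY" using CX D by simp
    then show "game_cost L T q \<epsilon> c M i (\<lambda>j. feedback (equilibrium j)) X
      \<le> game_cost L T q \<epsilon> c M i ((\<lambda>j. feedback (equilibrium j))(i := open_loop \<alpha>)) Y"
      by (simp add: game_cost_def CX_def CY_def running_cost_def u_def feedback_def open_loop_def)
  qed
qed

end

section \<open>Convergence of fictitious play to a Markovian Nash equilibrium\<close>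

lemma normalized_laplacian_symmetric:
  assumes "simple_graph E"
  shows "transpose (normalized_laplacian E) = normalized_laplacian E"
proof -
  have "E i j = E j i" for i j using assms by (auto simp: simple_graph_def symp_def)
  then show ?thesis by (simp add: normalized_laplacian_def transpose_def vec_eq_iff mult.commute)
qed

theorem theorem3p7:
  fixes E :: "'n::finite \<Rightarrow> 'n \<Rightarrow> bool"
    and L :: "real^'n^'n"
    and T a q \<epsilon> c \<sigma> :: real
    and x\<^sub>0 :: "real^'n"
    and M :: "'w measure"
    and W :: "'n \<Rightarrow> real \<Rightarrow> 'w \<Rightarrow> real"
  assumes "simple_graph E" and "connected_graph E"
    and "L = normalized_laplacian E"
    and "T > 0" and "a \<ge> 0" and "q \<ge> 0" and "\<epsilon> \<ge> 0" and "c > 0" and "\<sigma> > 0" and "q\<^sup>2 \<le> \<epsilon>"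
    and "prob_space M" and "independent_brownian_motions T M W"
    and "max ((c + T * (\<epsilon> - q\<^sup>2)) * (matrix_norm2 L)\<^sup>2)
             (2 / ln 2 * (a + q) * T * matrix_norm2 L) \<le> 1"
    and "T \<le> 1 / 100"
  shows "(\<exists>F. fictitious_play_from_zero L T a q \<epsilon> c F) \<and>
    (\<forall>F. fictitious_play_from_zero L T a q \<epsilon> c F \<longrightarrow>
      (\<exists>G :: 'n \<Rightarrow> real \<Rightarrow> real^'n^'n.
        (\<forall>i. \<forall>t\<in>{0..T}. (\<lambda>k. F i k t) \<longlonglongrightarrow> G i t) \<and>
        riccati_system L T a q \<epsilon> c G \<and>
        (\<forall>i. \<forall>t\<in>{0..T}. \<forall>x. (\<lambda>k. linear_feedback L q i (F i k) t x)
            \<longlonglongrightarrow> - q * (L *v x) $ i - (G i t *v x) $ i) \<and>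
        markovian_nash L T a q \<epsilon> c \<sigma> x\<^sub>0 M W
          (\<lambda>i t x. - q * (L *v x) $ i - (G i t *v x) $ i)))"
proof -
  have sym: "transpose L = L" using normalized_laplacian_symmetric assms(1,3) by simp
  have bounded: "matrix_bounded L (matrix_norm2 L)"
    unfolding matrix_bounded_def matrix_norm2_def
    using onorm[OF matrix_vector_mul_bounded_linear] onorm_pos_le[OF matrix_vector_mul_bounded_linear] by blast
  have "0 < ln (2::real)" by simp
  then have drift: "2 * (a + q) * matrix_norm2 L * T \<le> ln 2"
    using assms(13) by (simp add: field_simps)
  \<comment> \<open>The parameters \<open>a + q\<close> and \<open>\<epsilon> - q\<^sup>2\<close> turn the two smallness conditions into those of the
    locale.\<close>
  interpret small_horizon L "matrix_norm2 L" "a + q" "\<epsilon> - q\<^sup>2" c T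
    by unfold_locales (use bounded sym drift assms in \<open>auto simp: mult_ac\<close>)
  show ?thesis
  proof (intro conjI allI impI fictitious_play_exists refl)
    fix F assume F: "fictitious_play_from_zero L T a q \<epsilon> c F"
    obtain H where H: "best_response_path H H" "\<And>t. t \<in> {0..T} \<Longrightarrow> H t \<in> invariant_families"
      using riccati_fixed_point_exists by blast
    define G where "G = (\<lambda>i t. H t $ i)"
    have riccati: "riccati_system L T a q \<epsilon> c G"
      unfolding G_def by (rule riccati_system_of_fixed_point[OF H(1) refl refl])
    have lim: "(\<lambda>k. F i k t) \<longlonglongrightarrow> G i t" if t: "t \<in> {0..T}" for i t
    proof -
      have zero: "(\<chi> i. F i 0 s) = 0" if "s \<in> {0..T}" for s
        using F that by (simp add: fictitious_play_from_zero_def vec_eq_iff)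
      have "(\<lambda>k. \<chi> i. F i k t) \<longlonglongrightarrow> H t"
        using best_response_iteration_converges[of "\<lambda>k t. \<chi> i. F i k t" H t,
            OF zero fictitious_play_best_response[OF F refl refl] H t] .
      from tendsto_vec_nth[OF this, of i] show ?thesis by (simp add: G_def)
    qed
    have feedback_lim: "(\<lambda>k. linear_feedback L q i (F i k) t x) \<longlonglongrightarrow> - q * (L *v x) $ i - (G i t *v x) $ i"
      if t: "t \<in> {0..T}" for i t x
    proof -
      have eq: "- (((A + q *\<^sub>R L) *v x) $ i) = - q * (L *v x) $ i - (A *v x) $ i" for A :: "real^'n^'n"
        by (simp add: matrix_vector_simps)
      have "(\<lambda>k. - (((F i k t + q *\<^sub>R L) *v x) $ i)) \<longlonglongrightarrow> - (((G i t + q *\<^sub>R L) *v x) $ i)"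
        by (intro tendsto_intros bounded_bilinear.tendsto[OF bounded_bilinear_matrix_vector_mult] lim t)
      then show ?thesis unfolding linear_feedback_def eq .
    qed
    interpret prob_space M by (rule assms(11))
    interpret noisy_game M T W L a q \<epsilon> c G \<sigma> x\<^sub>0
      by unfold_locales (use assms riccati sym in auto)
    show "\<exists>G :: 'n \<Rightarrow> real \<Rightarrow> real^'n^'n.
        (\<forall>i. \<forall>t\<in>{0..T}. (\<lambda>k. F i k t) \<longlonglongrightarrow> G i t) \<and>
        riccati_system L T a q \<epsilon> c G \<and>
        (\<forall>i. \<forall>t\<in>{0..T}. \<forall>x. (\<lambda>k. linear_feedback L q i (F i k) t x)
            \<longlonglongrightarrow> - q * (L *v x) $ i - (G i t *v x) $ i) \<and>
        markovian_nash L T a q \<epsilon> c \<sigma> x\<^sub>0 M W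
          (\<lambda>i t x. - q * (L *v x) $ i - (G i t *v x) $ i)"
      using lim riccati feedback_lim equilibrium_is_nash by (intro exI[of _ G]) blast
  qed
qed

end
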